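(* Let $A$ and $B$ be bialgebras over a field $k$, let $C$ be a $k$-coalgebra, and let $f\colon B\otimes C\to A$ be a covering. If $B$ is a Hopf algebra with cocommutative coradical, then $A$ is a Hopf algebra as well.
   Context: Let $A,B$ be bialgebras and $C$ a coalgebra over the field $k$. A linear map $f\colon B\otimes C\to A$ is a measuring if for all $b,b'\in B$, $c\in C$: $f(bb'\otimes c)=\sum_{(c)}f(b\otimes c_1)f(b'\otimes c_2)$ and $f(1\otimes c)=\varepsilon(c)1_A$. A partial covering is a measuring $f\colon B\otimes C\to A$ that is also a coalgebra map, where $B\otimes C$ has the tensor product coalgebra structure. A covering is a surjective partial covering. Sweedler notation $\Delta(c)=\sum_{(c)}c_1\otimes c_2$ is used. The coradical of a coalgebra is the sum of its simple subcoalgebras. *)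

theory Defs
  imports Complex_Main
begin

section \<open>Vector spaces and tensor products\<close>

text \<open>
  A vector space over the field \<open>'k\<close> is a subspace \<open>vspace V\<close> of an ambient vector space, namely
  the type \<open>'v\<close> with scalar multiplication \<open>vscale V\<close>. A separate carrier is needed because
  \<open>V \<otimes> W\<close> (whose scalar multiplications are term parameters) cannot be a type of its own.
\<close>

record ('k, 'v) vsp =
  vscale :: "'k \<Rightarrow> 'v \<Rightarrow> 'v"
  vspace :: "'v set"

definition vec_space :: "('k::field, 'v::ab_group_add, 'z) vsp_scheme \<Rightarrow> bool" where
  "vec_space V \<longleftrightarrow> vector_space (vscale V) \<and> module.subspace (vscale V) (vspace V)"

definition linear_map ::
  "('k, 'v::plus, 'z) vsp_scheme \<Rightarrow> ('k, 'w::plus, 'y) vsp_scheme \<Rightarrow> ('v \<Rightarrow> 'w) \<Rightarrow> bool" where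
  "linear_map V W f \<longleftrightarrow>
     (\<forall>x\<in>vspace V. f x \<in> vspace W) \<and>
     (\<forall>x\<in>vspace V. \<forall>y\<in>vspace V. f (x + y) = f x + f y) \<and>
     (\<forall>a. \<forall>x\<in>vspace V. f (vscale V a x) = vscale W a (f x))"

definition bilinear_map ::
  "('k, 'v::plus, 'z) vsp_scheme \<Rightarrow> ('k, 'w::plus, 'y) vsp_scheme \<Rightarrow>
   ('k, 'u::plus, 'x) vsp_scheme \<Rightarrow> ('v \<Rightarrow> 'w \<Rightarrow> 'u) \<Rightarrow> bool" where
  "bilinear_map V W U m \<longleftrightarrow>
     (\<forall>w\<in>vspace W. linear_map V U (\<lambda>v. m v w)) \<and> (\<forall>v\<in>vspace V. linear_map W U (m v))"

definition base_field :: "('k::field, 'k) vsp" where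
  "base_field = \<lparr>vscale = (*), vspace = UNIV\<rparr>"

text \<open>
  Over a field, \<open>V \<otimes> W\<close> embeds into the dual of the space of bilinear forms, \<open>v \<otimes> w\<close> being
  evaluation at \<open>(v, w)\<close>, which is the model used here. The bilinear forms are those on the ambient
  spaces: over a field every bilinear form on subspaces extends, so the model is also correct for
  proper subspaces, and \<open>D \<otimes> D\<close> is literally a subset of \<open>C \<otimes> C\<close> when \<open>D \<subseteq> C\<close>. The universal
  property is \<open>tensor_universal\<close> below.
\<close>

typedef ('k, 'v, 'w) tensor = "UNIV :: (('v \<Rightarrow> 'w \<Rightarrow> 'k) \<Rightarrow> 'k) set"
  morphisms tensor_app Tensor ..

setup_lifting type_definition_tensor

instantiation tensor :: (ab_group_add, type, type) ab_group_add
begin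

lift_definition zero_tensor :: "('a, 'b, 'c) tensor" is "\<lambda>_. 0" .
lift_definition plus_tensor :: "('a, 'b, 'c) tensor \<Rightarrow> ('a, 'b, 'c) tensor \<Rightarrow> ('a, 'b, 'c) tensor"
  is "\<lambda>s t \<beta>. s \<beta> + t \<beta>" .
lift_definition minus_tensor :: "('a, 'b, 'c) tensor \<Rightarrow> ('a, 'b, 'c) tensor \<Rightarrow> ('a, 'b, 'c) tensor"
  is "\<lambda>s t \<beta>. s \<beta> - t \<beta>" .
lift_definition uminus_tensor :: "('a, 'b, 'c) tensor \<Rightarrow> ('a, 'b, 'c) tensor"
  is "\<lambda>t \<beta>. - t \<beta>" .

instance
  by standard
    (simp_all flip: tensor_app_inject add: fun_eq_iff zero_tensor.rep_eq plus_tensor.rep_eq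
      minus_tensor.rep_eq uminus_tensor.rep_eq algebra_simps)

end

lift_definition tscale :: "'k::times \<Rightarrow> ('k, 'v, 'w) tensor \<Rightarrow> ('k, 'v, 'w) tensor"
  is "\<lambda>a t \<beta>. a * t \<beta>" .

definition tens ::
  "('k::field, 'v::ab_group_add, 'z) vsp_scheme \<Rightarrow> ('k, 'w::ab_group_add, 'y) vsp_scheme \<Rightarrow>
   'v \<Rightarrow> 'w \<Rightarrow> ('k, 'v, 'w) tensor" where
  "tens V W v w = Tensor
     (\<lambda>\<beta>. if bilinear_map (V\<lparr>vspace := UNIV\<rparr>) (W\<lparr>vspace := UNIV\<rparr>) base_field \<beta> then \<beta> v w else 0)"

definition tensor_space ::
  "('k::field, 'v::ab_group_add, 'z) vsp_scheme \<Rightarrow> ('k, 'w::ab_group_add, 'y) vsp_scheme \<Rightarrow>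
   ('k, ('k, 'v, 'w) tensor) vsp" where
  "tensor_space V W =
     \<lparr>vscale = tscale,
      vspace = module.span tscale {tens V W v w | v w. v \<in> vspace V \<and> w \<in> vspace W}\<rparr>"

text \<open>
  The linear map \<open>V \<otimes> W \<rightarrow> U\<close> induced by a bilinear map \<open>m\<close>; it is unspecified outside \<open>V \<otimes> W\<close>.
\<close>

definition tensor_lift ::
  "('k::field, 'v::ab_group_add, 'z) vsp_scheme \<Rightarrow> ('k, 'w::ab_group_add, 'y) vsp_scheme \<Rightarrow>
   ('k, 'u::ab_group_add, 'x) vsp_scheme \<Rightarrow> ('v \<Rightarrow> 'w \<Rightarrow> 'u) \<Rightarrow> ('k, 'v, 'w) tensor \<Rightarrow> 'u" where
  "tensor_lift V W U m =
     (SOME L. linear_map (tensor_space V W) U L \<and>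
              (\<forall>v\<in>vspace V. \<forall>w\<in>vspace W. L (tens V W v w) = m v w))"

definition tensor_map ::
  "('k::field, 'v::ab_group_add, 'z) vsp_scheme \<Rightarrow> ('k, 'w::ab_group_add, 'y) vsp_scheme \<Rightarrow>
   ('k, 'v'::ab_group_add, 'z') vsp_scheme \<Rightarrow> ('k, 'w'::ab_group_add, 'y') vsp_scheme \<Rightarrow>
   ('v \<Rightarrow> 'v') \<Rightarrow> ('w \<Rightarrow> 'w') \<Rightarrow> ('k, 'v, 'w) tensor \<Rightarrow> ('k, 'v', 'w') tensor" where
  "tensor_map V W V' W' f g =
     tensor_lift V W (tensor_space V' W') (\<lambda>v w. tens V' W' (f v) (g w))"

text \<open>The canonical isomorphism \<open>(U \<otimes> V) \<otimes> W \<rightarrow> U \<otimes> (V \<otimes> W)\<close>.\<close>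

definition tensor_assoc ::
  "('k::field, 'u::ab_group_add, 'x) vsp_scheme \<Rightarrow> ('k, 'v::ab_group_add, 'z) vsp_scheme \<Rightarrow>
   ('k, 'w::ab_group_add, 'y) vsp_scheme \<Rightarrow>
   ('k, ('k, 'u, 'v) tensor, 'w) tensor \<Rightarrow> ('k, 'u, ('k, 'v, 'w) tensor) tensor" where
  "tensor_assoc U V W =
     tensor_lift (tensor_space U V) W (tensor_space U (tensor_space V W))
       (\<lambda>t w. tensor_lift U V (tensor_space U (tensor_space V W))
                (\<lambda>u v. tens U (tensor_space V W) u (tens V W v w)) t)"

definition tensor_flip ::
  "('k::field, 'v::ab_group_add, 'z) vsp_scheme \<Rightarrow> ('k, 'w::ab_group_add, 'y) vsp_scheme \<Rightarrow>
   ('k, 'v, 'w) tensor \<Rightarrow> ('k, 'w, 'v) tensor" where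
  "tensor_flip V W = tensor_lift V W (tensor_space W V) (\<lambda>v w. tens W V w v)"


subsection \<open>The universal property\<close>

lemma vector_space_tscale: "vector_space (tscale :: 'k::field \<Rightarrow> ('k, 'v, 'w) tensor \<Rightarrow> _)"
  by unfold_locales
    (simp_all flip: tensor_app_inject add: fun_eq_iff plus_tensor.rep_eq tscale.rep_eq algebra_simps)

lemma vec_space_tensor:
  fixes V :: "('k::field, 'v::ab_group_add, 'z) vsp_scheme"
    and W :: "('k, 'w::ab_group_add, 'y) vsp_scheme"
  shows "vec_space (tensor_space V W)"
proof -
  interpret T: vector_space "tscale :: 'k \<Rightarrow> ('k, 'v, 'w) tensor \<Rightarrow> _" by (rule vector_space_tscale)
  show ?thesis
    by (simp add: vec_space_def tensor_space_def T.vector_space_axioms T.subspace_span)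
qed

lemma vec_space_projection:
  fixes V :: "('k::field, 'v::ab_group_add, 'z) vsp_scheme"
  assumes "vec_space V"
  obtains P where "Vector_Spaces.linear (vscale V) (vscale V) P" "range P \<subseteq> vspace V"
    "\<And>x. x \<in> vspace V \<Longrightarrow> P x = x"
proof -
  interpret V: vector_space "vscale V" using assms by (simp add: vec_space_def)
  interpret P: vector_space_pair "vscale V" "vscale V" by unfold_locales
  have sub: "V.subspace (vspace V)" using assms by (simp add: vec_space_def)
  obtain B where B: "B \<subseteq> vspace V" "V.independent B" "vspace V \<subseteq> V.span B"
    using V.maximal_independent_subset by blast
  obtain g where g: "Vector_Spaces.linear (vscale V) (vscale V) g" "\<forall>x\<in>B. g x = id x"
      "range g = V.span (id ` B)"
    using P.linear_independent_extend_subspace[OF B(2), of id] by blast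
  have sp: "V.span B = vspace V" using B sub V.span_minimal by blast
  interpret g: Vector_Spaces.linear "vscale V" "vscale V" g by (rule g(1))
  have "g x = x" if "x \<in> vspace V" for x
  proof -
    have "x \<in> V.span B" using that sp by simp
    then show ?thesis
      by (induction rule: V.span_induct_alt) (use g(2) g.zero in \<open>auto simp: g.add g.scale\<close>)
  qed
  with g sp show ?thesis using that[of g] by simp
qed

lemma separating_functional:
  fixes s :: "'k::field \<Rightarrow> 'u::ab_group_add \<Rightarrow> 'u"
  assumes "vector_space s" and "u \<noteq> 0"
  obtains \<phi> where "Vector_Spaces.linear s (*) \<phi>" "\<phi> u \<noteq> 0"
proof -
  interpret s: vector_space s by fact
  interpret k: vector_space "(*) :: 'k \<Rightarrow> 'k \<Rightarrow> 'k" by unfold_locales (auto simp: algebra_simps)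
  interpret p: vector_space_pair s "(*) :: 'k \<Rightarrow> 'k \<Rightarrow> 'k" by unfold_locales
  have "s.independent {u}" using assms(2) by simp
  from p.linear_independent_extend[OF this, of "\<lambda>_. 1"] show ?thesis using that by force
qed

theorem tensor_universal:
  fixes V :: "('k::field, 'v::ab_group_add, 'z) vsp_scheme"
    and W :: "('k, 'w::ab_group_add, 'y) vsp_scheme"
    and U :: "('k, 'u::ab_group_add, 'x) vsp_scheme"
  assumes V: "vec_space V" and W: "vec_space W" and U: "vec_space U"
    and m: "bilinear_map V W U m"
  shows "\<exists>L. linear_map (tensor_space V W) U L \<and>
             (\<forall>v\<in>vspace V. \<forall>w\<in>vspace W. L (tens V W v w) = m v w)"
proof -
  interpret T: vector_space "tscale :: 'k \<Rightarrow> ('k, 'v, 'w) tensor \<Rightarrow> _"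
    by (rule vector_space_tscale)
  interpret U: vector_space "vscale U" using U by (simp add: vec_space_def)
  interpret TU: vector_space_pair "tscale :: 'k \<Rightarrow> ('k, 'v, 'w) tensor \<Rightarrow> _" "vscale U"
    by unfold_locales
  have subU: "U.subspace (vspace U)" using U by (simp add: vec_space_def)
  obtain P where P: "Vector_Spaces.linear (vscale V) (vscale V) P" "range P \<subseteq> vspace V"
    "\<And>x. x \<in> vspace V \<Longrightarrow> P x = x" using vec_space_projection[OF V] by metis
  obtain Q where Q: "Vector_Spaces.linear (vscale W) (vscale W) Q" "range Q \<subseteq> vspace W"
    "\<And>x. x \<in> vspace W \<Longrightarrow> Q x = x" using vec_space_projection[OF W] by metis
  interpret P: Vector_Spaces.linear "vscale V" "vscale V" P by (rule P(1))
  interpret Q: Vector_Spaces.linear "vscale W" "vscale W" Q by (rule Q(1))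
  have PV: "P x \<in> vspace V" for x using P(2) by auto
  have QW: "Q x \<in> vspace W" for x using Q(2) by auto
  let ?X = "{tens V W v w | v w. v \<in> vspace V \<and> w \<in> vspace W}"
  have key: "\<exists>\<beta>. \<forall>v\<in>vspace V. \<forall>w\<in>vspace W. tensor_app (tens V W v w) \<beta> = \<phi> (m v w)"
    if "Vector_Spaces.linear (vscale U) (*) \<phi>" for \<phi>
  proof -
    interpret phi: Vector_Spaces.linear "vscale U" "(*)" \<phi> by fact
    let ?b = "\<lambda>v w. \<phi> (m (P v) (Q w))"
    have "bilinear_map (V\<lparr>vspace := UNIV\<rparr>) (W\<lparr>vspace := UNIV\<rparr>) base_field ?b"
      using m PV QW unfolding bilinear_map_def linear_map_def base_field_def
      by (simp add: P.add Q.add P.scale Q.scale phi.add phi.scale)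
    then show ?thesis by (intro exI[of _ ?b]) (auto simp: tens_def Tensor_inverse P Q)
  qed
  obtain B where B: "B \<subseteq> ?X" "T.independent B" "?X \<subseteq> T.span B"
    using T.maximal_independent_subset by blast
  have "\<forall>b\<in>B. \<exists>v w. v \<in> vspace V \<and> w \<in> vspace W \<and> b = tens V W v w" using B(1) by blast
  then obtain p q where pq: "\<And>b. b \<in> B \<Longrightarrow> p b \<in> vspace V \<and> q b \<in> vspace W \<and> b = tens V W (p b) (q b)"
    by metis
  obtain L where L: "Vector_Spaces.linear tscale (vscale U) L" "\<forall>b\<in>B. L b = m (p b) (q b)"
    using TU.linear_independent_extend[OF B(2), of "\<lambda>b. m (p b) (q b)"] by blast
  interpret L: Vector_Spaces.linear tscale "vscale U" L by (rule L(1))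
  have Leq: "L (tens V W v w) = m v w" if vw: "v \<in> vspace V" "w \<in> vspace W" for v w
  proof (rule ccontr)
    assume "L (tens V W v w) \<noteq> m v w"
    then have "L (tens V W v w) - m v w \<noteq> 0" by simp
    from separating_functional[OF U.vector_space_axioms this] obtain \<phi>
      where phi: "Vector_Spaces.linear (vscale U) (*) \<phi>" "\<phi> (L (tens V W v w) - m v w) \<noteq> 0" .
    interpret phi: Vector_Spaces.linear "vscale U" "(*)" \<phi> by (rule phi(1))
    obtain \<beta> where beta: "\<forall>v\<in>vspace V. \<forall>w\<in>vspace W. tensor_app (tens V W v w) \<beta> = \<phi> (m v w)"
      using key[OF phi(1)] by blast
    have "t \<in> T.span B \<Longrightarrow> \<phi> (L t) = tensor_app t \<beta>" for t
    proof (induction rule: T.span_induct_alt)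
      case base
      show ?case by (simp add: L.zero phi.zero zero_tensor.rep_eq)
    next
      case (step c x y)
      have "tensor_app x \<beta> = \<phi> (m (p x) (q x))" using pq[OF step(1)] beta by metis
      then show ?case using step L(2) by (simp add: L.add L.scale phi.add phi.scale tscale.rep_eq plus_tensor.rep_eq)
    qed
    moreover have "tens V W v w \<in> T.span B" using vw B(3) by auto
    ultimately have "\<phi> (L (tens V W v w)) = \<phi> (m v w)" using vw beta by simp
    then show False using phi(2) by (simp add: phi.diff)
  qed
  have "L t \<in> vspace U" if "t \<in> T.span ?X" for t
    using that
  proof (induction rule: T.span_induct_alt)
    case base
    show ?case unfolding L.zero by (rule U.subspace_0[OF subU])
  next
    case (step c x y)
    then obtain v w where vw: "v \<in> vspace V" "w \<in> vspace W" "x = tens V W v w" by blast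
    then have "L x \<in> vspace U" using Leq m by (simp add: bilinear_map_def linear_map_def)
    then show ?case using step subU by (simp add: L.add L.scale U.subspace_add U.subspace_scale)
  qed
  then have "linear_map (tensor_space V W) U L"
    by (simp add: linear_map_def tensor_space_def L.add L.scale)
  with Leq show ?thesis by blast
qed

lemma tensor_lift:
  assumes "vec_space V" "vec_space W" "vec_space U" "bilinear_map V W U m"
  shows linear_map_tensor_lift: "linear_map (tensor_space V W) U (tensor_lift V W U m)"
    and tensor_lift_tens:
      "v \<in> vspace V \<Longrightarrow> w \<in> vspace W \<Longrightarrow> tensor_lift V W U m (tens V W v w) = m v w"
  using someI_ex[OF tensor_universal[OF assms]] unfolding tensor_lift_def by blast+


section \<open>Coalgebras\<close>

record ('k, 'c) coalg = "('k, 'c) vsp" +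
  comult :: "'c \<Rightarrow> ('k, 'c, 'c) tensor"
  counit :: "'c \<Rightarrow> 'k"

text \<open>
  The Sweedler sum \<open>\<Sum> m(c\<^sub>1, c\<^sub>2)\<close> in \<open>U\<close>, for a bilinear map \<open>m\<close>.
\<close>

definition sweedler ::
  "('k::field, 'c::ab_group_add, 'z) coalg_scheme \<Rightarrow> ('k, 'u::ab_group_add, 'x) vsp_scheme \<Rightarrow>
   ('c \<Rightarrow> 'c \<Rightarrow> 'u) \<Rightarrow> 'c \<Rightarrow> 'u" where
  "sweedler C U m c = tensor_lift C C U m (comult C c)"

definition coalgebra :: "('k::field, 'c::ab_group_add, 'z) coalg_scheme \<Rightarrow> bool" where
  "coalgebra C \<longleftrightarrow>
     vec_space C \<and>
     linear_map C (tensor_space C C) (comult C) \<and>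
     linear_map C base_field (counit C) \<and>
     (\<forall>c\<in>vspace C.
        tensor_assoc C C C (tensor_map C C (tensor_space C C) C (comult C) id (comult C c)) =
        tensor_map C C C (tensor_space C C) id (comult C) (comult C c)) \<and>
     (\<forall>c\<in>vspace C. sweedler C C (\<lambda>c1 c2. vscale C (counit C c1) c2) c = c) \<and>
     (\<forall>c\<in>vspace C. sweedler C C (\<lambda>c1 c2. vscale C (counit C c2) c1) c = c)"

definition coalgebra_map ::
  "('k::field, 'c::ab_group_add, 'z) coalg_scheme \<Rightarrow> ('k, 'd::ab_group_add, 'y) coalg_scheme \<Rightarrow>
   ('c \<Rightarrow> 'd) \<Rightarrow> bool" where
  "coalgebra_map C D f \<longleftrightarrow>
     linear_map C D f \<and>
     (\<forall>c\<in>vspace C. comult D (f c) = tensor_map C C D D f f (comult C c)) \<and>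
     (\<forall>c\<in>vspace C. counit D (f c) = counit C c)"

text \<open>
  \<open>\<Delta>(b \<otimes> c) = \<Sum> (b\<^sub>1 \<otimes> c\<^sub>1) \<otimes> (b\<^sub>2 \<otimes> c\<^sub>2)\<close> and \<open>\<epsilon>(b \<otimes> c) = \<epsilon>(b) \<epsilon>(c)\<close>.
\<close>

definition tensor_coalg ::
  "('k::field, 'b::ab_group_add, 'z) coalg_scheme \<Rightarrow> ('k, 'c::ab_group_add, 'y) coalg_scheme \<Rightarrow>
   ('k, ('k, 'b, 'c) tensor) coalg" where
  "tensor_coalg B C =
     (let T = tensor_space B C; TT = tensor_space T T in
      \<lparr>vscale = vscale T,
       vspace = vspace T,
       comult = tensor_lift B C TT (\<lambda>b c.
         sweedler B TT (\<lambda>b1 b2.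
           sweedler C TT (\<lambda>c1 c2. tens T T (tens B C b1 c1) (tens B C b2 c2)) c) b),
       counit = tensor_lift B C base_field (\<lambda>b c. counit B b * counit C c)\<rparr>)"

definition subcoalgebra ::
  "('k::field, 'c::ab_group_add, 'z) coalg_scheme \<Rightarrow> 'c set \<Rightarrow> bool" where
  "subcoalgebra C D \<longleftrightarrow>
     D \<subseteq> vspace C \<and> module.subspace (vscale C) D \<and>
     (\<forall>d\<in>D. comult C d \<in> vspace (tensor_space (C\<lparr>vspace := D\<rparr>) (C\<lparr>vspace := D\<rparr>)))"

definition simple_subcoalgebra ::
  "('k::field, 'c::ab_group_add, 'z) coalg_scheme \<Rightarrow> 'c set \<Rightarrow> bool" where
  "simple_subcoalgebra C D \<longleftrightarrow>
     subcoalgebra C D \<and> D \<noteq> {0} \<and> (\<forall>E. subcoalgebra C E \<and> E \<subseteq> D \<longrightarrow> E = {0} \<or> E = D)"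

definition coradical ::
  "('k::field, 'c::ab_group_add, 'z) coalg_scheme \<Rightarrow> ('k, 'c, 'z) coalg_scheme" where
  "coradical C = C\<lparr>vspace := module.span (vscale C) (\<Union>{D. simple_subcoalgebra C D})\<rparr>"

definition cocommutative :: "('k::field, 'c::ab_group_add, 'z) coalg_scheme \<Rightarrow> bool" where
  "cocommutative C \<longleftrightarrow> (\<forall>c\<in>vspace C. tensor_flip C C (comult C c) = comult C c)"


section \<open>Bialgebras and Hopf algebras\<close>

definition tensor_mult ::
  "('k::field, 'a::ring_1, 'z) vsp_scheme \<Rightarrow>
   ('k, 'a, 'a) tensor \<Rightarrow> ('k, 'a, 'a) tensor \<Rightarrow> ('k, 'a, 'a) tensor" where
  "tensor_mult A s t =
     tensor_lift A A (tensor_space A A) (\<lambda>a b.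
       tensor_lift A A (tensor_space A A) (\<lambda>c d. tens A A (a * c) (b * d)) t) s"

text \<open>
  The underlying ring of a bialgebra is the type \<open>'a\<close> itself. Its class \<open>ring_1\<close> requires \<open>0 \<noteq> 1\<close>,
  which is automatic in a bialgebra since \<open>\<epsilon>(1) = 1\<close>.
\<close>

definition bialgebra :: "('k::field, 'a::ring_1, 'z) coalg_scheme \<Rightarrow> bool" where
  "bialgebra A \<longleftrightarrow>
     coalgebra A \<and> vspace A = UNIV \<and>
     (\<forall>r x y. vscale A r (x * y) = vscale A r x * y \<and> vscale A r (x * y) = x * vscale A r y) \<and>
     comult A 1 = tens A A 1 1 \<and>
     (\<forall>x y. comult A (x * y) = tensor_mult A (comult A x) (comult A y)) \<and>
     counit A 1 = 1 \<and>
     (\<forall>x y. counit A (x * y) = counit A x * counit A y)"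

definition antipode :: "('k::field, 'a::ring_1, 'z) coalg_scheme \<Rightarrow> ('a \<Rightarrow> 'a) \<Rightarrow> bool" where
  "antipode A S \<longleftrightarrow>
     linear_map A A S \<and>
     (\<forall>a. sweedler A A (\<lambda>a1 a2. S a1 * a2) a = vscale A (counit A a) 1) \<and>
     (\<forall>a. sweedler A A (\<lambda>a1 a2. a1 * S a2) a = vscale A (counit A a) 1)"

definition hopf_algebra :: "('k::field, 'a::ring_1, 'z) coalg_scheme \<Rightarrow> bool" where
  "hopf_algebra A \<longleftrightarrow> bialgebra A \<and> (\<exists>S. antipode A S)"


section \<open>Measurings and coverings\<close>

definition measuring ::
  "('k::field, 'b::ring_1, 'z) coalg_scheme \<Rightarrow> ('k, 'c::ab_group_add, 'y) coalg_scheme \<Rightarrow>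
   ('k, 'a::ring_1, 'x) coalg_scheme \<Rightarrow> (('k, 'b, 'c) tensor \<Rightarrow> 'a) \<Rightarrow> bool" where
  "measuring B C A f \<longleftrightarrow>
     linear_map (tensor_space B C) A f \<and>
     (\<forall>b\<in>vspace B. \<forall>b'\<in>vspace B. \<forall>c\<in>vspace C.
        f (tens B C (b * b') c) =
        sweedler C A (\<lambda>c1 c2. f (tens B C b c1) * f (tens B C b' c2)) c) \<and>
     (\<forall>c\<in>vspace C. f (tens B C 1 c) = vscale A (counit C c) 1)"

definition partial_covering ::
  "('k::field, 'b::ring_1, 'z) coalg_scheme \<Rightarrow> ('k, 'c::ab_group_add, 'y) coalg_scheme \<Rightarrow>
   ('k, 'a::ring_1, 'x) coalg_scheme \<Rightarrow> (('k, 'b, 'c) tensor \<Rightarrow> 'a) \<Rightarrow> bool" where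
  "partial_covering B C A f \<longleftrightarrow> measuring B C A f \<and> coalgebra_map (tensor_coalg B C) A f"

definition covering ::
  "('k::field, 'b::ring_1, 'z) coalg_scheme \<Rightarrow> ('k, 'c::ab_group_add, 'y) coalg_scheme \<Rightarrow>
   ('k, 'a::ring_1, 'x) coalg_scheme \<Rightarrow> (('k, 'b, 'c) tensor \<Rightarrow> 'a) \<Rightarrow> bool" where
  "covering B C A f \<longleftrightarrow> partial_covering B C A f \<and> f ` vspace (tensor_space B C) = vspace A"

end

theory Submission
  imports Defs
begin

text \<open>
  Put \<open>h(b, c) = f(b \<otimes> c)\<close>. The map \<open>g(b \<otimes> c) = h(S b, c)\<close> is a two-sided convolution inverse
  of \<open>f\<close>, so an antipode of \<open>A\<close> exists as soon as \<open>g\<close> vanishes on the kernel of \<open>f\<close>. This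
  follows if, for all finite-dimensional subcoalgebras \<open>E \<subseteq> B\<close> and \<open>F \<subseteq> C\<close>, the identity of \<open>A\<close>
  has a left convolution inverse on \<open>f(E \<otimes> F)\<close>. Left invertibility passes from \<open>X\<close> and \<open>Y\<close> to
  their wedge, so for fixed \<open>F\<close> a minimal counterexample \<open>E\<close> has a prime dual algebra; being
  finite-dimensional it is simple, lies in the coradical, and is cocommutative.

  Expanding \<open>\<Delta>(h(b b', c))\<close> in two ways and cancelling with the antipode of \<open>B\<close> gives
  \<open>h(b', c\<^sub>1) \<otimes> h(b, c\<^sub>2) = h(b', c\<^sub>2) \<otimes> h(b, c\<^sub>1)\<close>. Hence \<open>f(E \<otimes> F)\<close> is cocommutative,
  and a minimal subcoalgebra \<open>T\<close> of it without left inverse is dual to a field. A lying-over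
  argument for the commutative algebra \<open>f(E \<otimes> F)\<^sup>*\<close> acting on \<open>E \<otimes> F\<close> then yields a colinear
  section of \<open>f\<close> over \<open>T\<close>, whose composite with \<open>g\<close> is a left inverse on \<open>T\<close> after all.
\<close>

section \<open>Linear algebra\<close>

text \<open>The obstacle is that nothing forces \<open>g\<close> to factor through \<open>f\<close>:
  from f(x) = 0 one learns nothing directly about h(S b, c). If r is a left inverse of the identity
  on f(E \<otimes> F), then r \<circ> f and g are a left and a right convolution inverse of f on E
  \<otimes> F, hence equal there, and g vanishes wherever f does. This is tested at one element at a
  time, so the functions r for different E and F never have to be compared, and a one-sided r is
  enough because g supplies both antipode identities. One-sided local invertibility also passes to
  wedges, so a descent to a minimal counterexample takes the place of an induction along the
  coradical filtration.

  C is arbitrary; f(E \<otimes> F) becomes cocommutative because the exchange identity lets the two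
  factors coming from C trade places. Wedges, coideals and functionals on the ambient space stand in
  for ideals, quotients and modules, so no dual space has to be formed as a structure.\<close>

definition lin :: "('k::field \<Rightarrow> 'v::ab_group_add \<Rightarrow> 'v) \<Rightarrow> ('k \<Rightarrow> 'w::ab_group_add \<Rightarrow> 'w) \<Rightarrow> ('v \<Rightarrow> 'w) \<Rightarrow> bool" where
  "lin s t f \<longleftrightarrow> (\<forall>x y. f (x + y) = f x + f y) \<and> (\<forall>a x. f (s a x) = t a (f x))"

definition bil :: "('k::field \<Rightarrow> 'v::ab_group_add \<Rightarrow> 'v) \<Rightarrow> ('k \<Rightarrow> 'w::ab_group_add \<Rightarrow> 'w) \<Rightarrow>
    ('k \<Rightarrow> 'u::ab_group_add \<Rightarrow> 'u) \<Rightarrow> ('v \<Rightarrow> 'w \<Rightarrow> 'u) \<Rightarrow> bool" where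
  "bil s t u m \<longleftrightarrow> (\<forall>y. lin s u (\<lambda>x. m x y)) \<and> (\<forall>x. lin t u (m x))"

definition tril :: "('k::field \<Rightarrow> 'v::ab_group_add \<Rightarrow> 'v) \<Rightarrow> ('k \<Rightarrow> 'w::ab_group_add \<Rightarrow> 'w) \<Rightarrow>
    ('k \<Rightarrow> 'x::ab_group_add \<Rightarrow> 'x) \<Rightarrow> ('k \<Rightarrow> 'u::ab_group_add \<Rightarrow> 'u) \<Rightarrow> ('v \<Rightarrow> 'w \<Rightarrow> 'x \<Rightarrow> 'u) \<Rightarrow> bool" where
  "tril s t r u m \<longleftrightarrow> (\<forall>y z. lin s u (\<lambda>x. m x y z)) \<and> (\<forall>x z. lin t u (\<lambda>y. m x y z)) \<and> (\<forall>x y. lin r u (m x y))"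

lemma linI:
  assumes "\<And>x y. f (x + y) = f x + f y" "\<And>a x. f (s a x) = t a (f x)"
  shows "lin s t f"
  using assms by (simp add: lin_def)

lemma lin_add: "lin s t f \<Longrightarrow> f (x + y) = f x + f y"
  by (simp add: lin_def)

lemma lin_scale: "lin s t f \<Longrightarrow> f (s a x) = t a (f x)"
  by (simp add: lin_def)

lemma lin_0: "lin s t f \<Longrightarrow> f 0 = 0"
  using lin_add[of s t f 0 0] by simp

lemma lin_diff: "lin s t f \<Longrightarrow> f (x - y) = f x - f y"
  using lin_add[of s t f "x - y" y] by simp

lemma lin_neg: "lin s t f \<Longrightarrow> f (- x) = - f x"
  using lin_diff[of s t f 0 x] by (simp add: lin_0)

lemma lin_sum_list: "lin s t f \<Longrightarrow> f (\<Sum>p\<leftarrow>l. g p) = (\<Sum>p\<leftarrow>l. f (g p))"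
  by (induction l) (simp_all add: lin_0 lin_add)

lemma lin_comp: "lin t u g \<Longrightarrow> lin s t f \<Longrightarrow> lin s u (\<lambda>x. g (f x))"
  by (simp add: lin_def)

lemma lin_id: "lin s s (\<lambda>x. x)"
  by (simp add: lin_def)

lemma linear_imp_lin: "Vector_Spaces.linear s t f \<Longrightarrow> lin s t f"
  by (simp add: Vector_Spaces.linear_iff lin_def)

lemma vector_space_field: "vector_space ((*) :: 'k::field \<Rightarrow> 'k \<Rightarrow> 'k)"
  by unfold_locales (auto simp: algebra_simps)

lemma vector_space_simps:
  assumes "vector_space t"
  shows "t a (x + y) = t a x + t a y" "t (a + b) x = t a x + t b x" "t a (t b x) = t (a * b) x"
    "t 1 x = x" "t 0 x = 0" "t a 0 = 0" "t a (x - y) = t a x - t a y" "t (a - b) x = t a x - t b x"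
proof -
  interpret vector_space t by fact
  show "t a (x + y) = t a x + t a y" "t (a + b) x = t a x + t b x" "t a (t b x) = t (a * b) x"
    "t 1 x = x" "t 0 x = 0" "t a 0 = 0" "t a (x - y) = t a x - t a y" "t (a - b) x = t a x - t b x"
    by (simp_all add: algebra_simps)
qed

lemma lin_plus: "vector_space t \<Longrightarrow> lin s t f \<Longrightarrow> lin s t g \<Longrightarrow> lin s t (\<lambda>x. f x + g x)"
  by (simp add: lin_def vector_space_simps algebra_simps)

lemma lin_minus: "vector_space t \<Longrightarrow> lin s t f \<Longrightarrow> lin s t g \<Longrightarrow> lin s t (\<lambda>x. f x - g x)"
  by (simp add: lin_def vector_space_simps algebra_simps)

lemma lin_zero: "vector_space t \<Longrightarrow> lin s t (\<lambda>x. 0)"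
  by (simp add: lin_def vector_space_simps)

lemma lin_scale_const: "vector_space t \<Longrightarrow> lin s t f \<Longrightarrow> lin s t (\<lambda>x. t c (f x))"
  by (simp add: lin_def vector_space_simps mult.commute)

lemma lin_scale_var: "vector_space t \<Longrightarrow> lin s (*) f \<Longrightarrow> lin s t (\<lambda>x. t (f x) v)"
  by (simp add: lin_def vector_space_simps)

lemma lin_times_const: "lin s (*) f \<Longrightarrow> lin s (*) (\<lambda>x. c * (f x :: 'k::field))"
  by (rule lin_scale_const[OF vector_space_field])

lemma lin_times_var: "lin s (*) f \<Longrightarrow> lin s (*) (\<lambda>x. f x * (c :: 'k::field))"
  by (rule lin_scale_var[OF vector_space_field])

lemma lin_sum: "vector_space t \<Longrightarrow> (\<And>p. p \<in> set l \<Longrightarrow> lin s t (\<lambda>x. F x p)) \<Longrightarrow> lin s t (\<lambda>x. \<Sum>p\<leftarrow>l. F x p)"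
  by (induction l) (simp_all add: lin_zero lin_plus)

lemma bilI:
  assumes "\<And>y. lin s u (\<lambda>x. m x y)" "\<And>x. lin t u (m x)"
  shows "bil s t u m"
  using assms by (simp add: bil_def)

lemma bil1: "bil s t u m \<Longrightarrow> lin s u (\<lambda>x. m x y)"
  and bil2: "bil s t u m \<Longrightarrow> lin t u (m x)"
  by (simp_all add: bil_def)

lemma trilI:
  assumes "\<And>y z. lin s u (\<lambda>x. m x y z)" "\<And>x z. lin t u (\<lambda>y. m x y z)" "\<And>x y. lin r u (m x y)"
  shows "tril s t r u m"
  using assms by (simp add: tril_def)

text \<open>The standard device for turning a map that is linear only on a carrier into one that is
  linear on the whole ambient type.\<close>

lemma subspace_projection:
  fixes s :: "'k::field \<Rightarrow> 'v::ab_group_add \<Rightarrow> 'v"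
  assumes "vector_space s" "module.subspace s X"
  obtains P where "lin s s P" "\<And>x. P x \<in> X" "\<And>x. x \<in> X \<Longrightarrow> P x = x"
proof -
  have "vec_space \<lparr>vscale = s, vspace = X\<rparr>" using assms by (simp add: vec_space_def)
  then obtain P where "Vector_Spaces.linear s s P" "range P \<subseteq> X" "\<And>x. x \<in> X \<Longrightarrow> P x = x"
    by (rule vec_space_projection) auto
  then show ?thesis using that[of P] linear_imp_lin by blast
qed

lemma lin_image_subspace:
  assumes "vector_space s" "vector_space t" and f: "lin s t f" and X: "module.subspace s X"
  shows "module.subspace t (f ` X)"
proof -
  interpret s: vector_space s by fact
  interpret t: vector_space t by fact
  show ?thesis
    using s.subspace_def[of X] X
    by (auto simp: t.subspace_def lin_0[OF f, symmetric] lin_add[OF f, symmetric] lin_scale[OF f, symmetric])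
qed

text \<open>Precompose a functional that is nonzero at \<open>v - P v\<close> with 1 - P, for a
  projection \<open>P\<close> onto \<open>X\<close>.\<close>

lemma functional_separates:
  fixes s :: "'k::field \<Rightarrow> 'v::ab_group_add \<Rightarrow> 'v"
  assumes "vector_space s" "module.subspace s X" "v \<notin> X"
  obtains \<phi> where "lin s (*) \<phi>" "\<And>x. x \<in> X \<Longrightarrow> \<phi> x = 0" "\<phi> v \<noteq> 0"
proof -
  obtain P where P: "lin s s P" "\<And>x. P x \<in> X" "\<And>x. x \<in> X \<Longrightarrow> P x = x"
    using subspace_projection[OF assms(1,2)] by metis
  have "v - P v \<noteq> 0" using P(2)[of v] assms(3) by auto
  from separating_functional[OF assms(1) this] obtain \<phi>
    where phi: "Vector_Spaces.linear s (*) \<phi>" "\<phi> (v - P v) \<noteq> 0" .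
  have "lin s (*) (\<lambda>x. \<phi> (x - P x))"
    by (rule lin_comp[OF linear_imp_lin[OF phi(1)] lin_minus[OF assms(1) lin_id P(1)]])
  moreover have "\<phi> (x - P x) = 0" if "x \<in> X" for x
    using that P(3) lin_0[OF linear_imp_lin[OF phi(1)]] by simp
  ultimately show ?thesis using that[of "\<lambda>x. \<phi> (x - P x)"] phi(2) by blast
qed

lemma subspace_zero: "vector_space s \<Longrightarrow> module.subspace s {0}"
  by (simp add: module.subspace_single_0 module_iff_vector_space)

lemma functional_nonzero:
  fixes s :: "'k::field \<Rightarrow> 'v::ab_group_add \<Rightarrow> 'v"
  assumes "vector_space s" "v \<noteq> 0"
  obtains \<phi> where "lin s (*) \<phi>" "\<phi> v \<noteq> 0"
  using functional_separates[OF assms(1) subspace_zero[OF assms(1)], of v] assms(2) by auto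

text \<open>Reduces vector-valued Sweedler identities to scalar ones; this is why the axioms of
  \<open>coal\<close> below mention forms only.\<close>

lemma eq_by_functionals:
  assumes "vector_space s" "\<And>\<phi>. lin s (*) \<phi> \<Longrightarrow> \<phi> x = \<phi> y"
  shows "x = y"
proof (rule ccontr)
  assume "x \<noteq> y"
  then have "x - y \<noteq> 0" by simp
  from functional_nonzero[OF assms(1) this] obtain \<phi> where "lin s (*) \<phi>" "\<phi> (x - y) \<noteq> 0" .
  then show False using assms(2) lin_diff by fastforce
qed

lemma sum_list_swap:
  fixes f :: "'p \<Rightarrow> 'q \<Rightarrow> 'u::comm_monoid_add"
  shows "(\<Sum>p\<leftarrow>k. \<Sum>q\<leftarrow>l. f p q) = (\<Sum>q\<leftarrow>l. \<Sum>p\<leftarrow>k. f p q)"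
  by (induction k) (simp_all add: sum_list_addf)

lemma sum_list_sum_swap:
  fixes f :: "'p \<Rightarrow> 'q \<Rightarrow> 'u::comm_monoid_add"
  shows "(\<Sum>p\<leftarrow>k. \<Sum>q\<in>K. f p q) = (\<Sum>q\<in>K. \<Sum>p\<leftarrow>k. f p q)"
  by (induction k) (simp_all add: sum.distrib)

lemma lin_sum_set: "lin s t f \<Longrightarrow> f (\<Sum>p\<in>K. g p) = (\<Sum>p\<in>K. f (g p))"
  by (induction K rule: infinite_finite_induct) (simp_all add: lin_0 lin_add)

text \<open>The list stands for a sum of elementary tensors, and the premise says that this tensor
  is zero, tested by contracting its second factor. Expanding the second components in a basis turns
  the sum into terms m(v, e) in which each v is such a contraction.\<close>

lemma bilinear_sum_zero:
  fixes s :: "'k::field \<Rightarrow> 'v::ab_group_add \<Rightarrow> 'v" and t :: "'k \<Rightarrow> 'w::ab_group_add \<Rightarrow> 'w"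
    and u :: "'k \<Rightarrow> 'u::ab_group_add \<Rightarrow> 'u"
  assumes t: "vector_space t" and m: "bil s t u m"
    and z: "\<And>\<phi>. lin t (*) \<phi> \<Longrightarrow> (\<Sum>p\<leftarrow>l. s (\<phi> (snd p)) (fst p)) = 0"
  shows "(\<Sum>p\<leftarrow>l. m (fst p) (snd p)) = 0"
proof -
  interpret t: vector_space t by fact
  define B where "B = t.extend_basis {}"
  have B: "t.independent B" "t.span B = UNIV"
    using t.independent_extend_basis[OF t.independent_empty] t.span_extend_basis[OF t.independent_empty]
    by (simp_all add: B_def)
  define r where "r = t.representation B"
  have r: "lin t (*) (\<lambda>b. r b e)" for e
    using linear_imp_lin[OF t.linear_representation[OF B]] by (simp add: r_def)
  define K where "K = (\<Union>p\<in>set l. {e. r (snd p) e \<noteq> 0})"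
  have K: "finite K" by (simp add: K_def r_def t.finite_representation)
  have ex: "(\<Sum>e\<in>K. t (r (snd p) e) e) = snd p" if "p \<in> set l" for p
  proof -
    have "(\<Sum>e\<in>K. t (r (snd p) e) e) = (\<Sum>e | r (snd p) e \<noteq> 0. t (r (snd p) e) e)"
      using that by (intro sum.mono_neutral_right[OF K]) (auto simp: K_def)
    also have "\<dots> = snd p"
      unfolding r_def by (rule t.sum_nonzero_representation_eq) (use B in auto)
    finally show ?thesis .
  qed
  have "(\<Sum>p\<leftarrow>l. m (fst p) (snd p)) = (\<Sum>p\<leftarrow>l. \<Sum>e\<in>K. m (s (r (snd p) e) (fst p)) e)"
  proof (intro arg_cong[of _ _ sum_list] map_cong refl)
    fix p assume "p \<in> set l"
    then have "m (fst p) (snd p) = m (fst p) (\<Sum>e\<in>K. t (r (snd p) e) e)" by (simp add: ex)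
    also have "\<dots> = (\<Sum>e\<in>K. m (s (r (snd p) e) (fst p)) e)"
      by (simp add: lin_sum_set[OF bil2[OF m]] lin_scale[OF bil2[OF m]] lin_scale[OF bil1[OF m]])
    finally show "m (fst p) (snd p) = (\<Sum>e\<in>K. m (s (r (snd p) e) (fst p)) e)" .
  qed
  also have "\<dots> = (\<Sum>e\<in>K. m (\<Sum>p\<leftarrow>l. s (r (snd p) e) (fst p)) e)"
    by (simp add: sum_list_sum_swap lin_sum_list[OF bil1[OF m]])
  also have "\<dots> = 0" by (simp add: z[OF r] lin_0[OF bil1[OF m]])
  finally show ?thesis .
qed

text \<open>A criterion for two lists to represent the same tensor. It compares Sweedler sums of
  different elements, even over different coalgebras, without forming the tensors.\<close>

lemma bilinear_sum_eq:
  fixes s :: "'k::field \<Rightarrow> 'v::ab_group_add \<Rightarrow> 'v" and t :: "'k \<Rightarrow> 'w::ab_group_add \<Rightarrow> 'w"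
    and u :: "'k \<Rightarrow> 'u::ab_group_add \<Rightarrow> 'u"
  assumes s: "vector_space s" and t: "vector_space t" and m: "bil s t u m"
    and z: "\<And>\<phi>. lin t (*) \<phi> \<Longrightarrow>
      (\<Sum>p\<leftarrow>k. s (\<phi> (G p)) (F p)) = (\<Sum>p\<leftarrow>l. s (\<phi> (G' p)) (F' p))"
  shows "(\<Sum>p\<leftarrow>k. m (F p) (G p)) = (\<Sum>p\<leftarrow>l. m (F' p) (G' p))"
proof -
  let ?L = "map (\<lambda>p. (F p, G p)) k @ map (\<lambda>p. (- F' p, G' p)) l"
  have neg: "lin s s uminus"
    using vector_space_simps[OF s] by (intro linI) (simp_all, metis (no_types) minus_add_distrib diff_0)
  have "(\<Sum>p\<leftarrow>?L. m (fst p) (snd p)) = 0"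
  proof (rule bilinear_sum_zero[OF t m])
    fix \<phi> assume phi: "lin t (*) \<phi>"
    show "(\<Sum>p\<leftarrow>?L. s (\<phi> (snd p)) (fst p)) = 0"
      using z[OF phi] by (simp add: o_def flip: lin_scale[OF neg] uminus_sum_list_map[unfolded o_def])
  qed
  then show ?thesis
    by (simp add: o_def lin_neg[OF bil1[OF m]] flip: uminus_sum_list_map[unfolded o_def])
qed

section \<open>Finite-dimensional subsets\<close>

definition findim :: "('k::field \<Rightarrow> 'v::ab_group_add \<Rightarrow> 'v) \<Rightarrow> 'v set \<Rightarrow> bool" where
  "findim s X \<longleftrightarrow> (\<exists>B. finite B \<and> X \<subseteq> module.span s B)"

lemma findim_subset: "findim s Y \<Longrightarrow> X \<subseteq> Y \<Longrightarrow> findim s X"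
  by (auto simp: findim_def)

lemma findim_span:
  assumes "vector_space s" "findim s X"
  shows "findim s (module.span s X)"
proof -
  interpret s: vector_space s by fact
  show ?thesis using assms(2) unfolding findim_def by (meson s.span_minimal s.subspace_span)
qed

lemma findim_Un:
  assumes "vector_space s" "findim s X" "findim s Y"
  shows "findim s (X \<union> Y)"
proof -
  interpret s: vector_space s by fact
  obtain B B' where "finite B" "X \<subseteq> s.span B" "finite B'" "Y \<subseteq> s.span B'"
    using assms by (auto simp: findim_def)
  then have "finite (B \<union> B')" "X \<union> Y \<subseteq> s.span (B \<union> B')"
    using s.span_mono[of B "B \<union> B'"] s.span_mono[of B' "B \<union> B'"] by auto
  then show ?thesis unfolding findim_def by blast
qed

text \<open>Drives every choice by minimal or maximal dimension. Finiteness matters: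
  \<open>dim\<close> is the cardinality of a basis, which is 0 for an infinite one.\<close>

lemma dim_strict_mono:
  assumes s: "vector_space s" and E: "findim s E" "module.subspace s X" "X \<subset> E"
  shows "vector_space.dim s X < vector_space.dim s E"
proof -
  interpret vector_space s by fact
  obtain G where G: "finite G" "E \<subseteq> span G" using E by (auto simp: findim_def)
  obtain B where B: "B \<subseteq> X" "independent B" "X \<subseteq> span B" "card B = dim X"
    using basis_exists by blast
  obtain v where v: "v \<in> E" "v \<notin> X" using E(3) by blast
  have "span B \<subseteq> X" using B E by (simp add: span_minimal)
  then have "independent (insert v B)" using B v by (intro independent_insertI) auto
  moreover have "insert v B \<subseteq> E" using B E v by auto
  ultimately obtain B' where B': "insert v B \<subseteq> B'" "B' \<subseteq> E" "independent B'" "E \<subseteq> span B'"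
    using maximal_independent_subset_extend by blast
  have fin: "finite B'" using independent_span_bound[OF G(1) B'(3)] B' G by blast
  have "v \<notin> B" using v B by blast
  then have "card B < card (insert v B)" using fin B'(1) finite_subset[of "insert v B" B'] by simp
  also have "\<dots> \<le> card B'" using fin B' by (simp add: card_mono)
  finally show ?thesis using basis_card_eq_dim[of B' E] B B' by simp
qed

section \<open>Sweedler calculus\<close>

text \<open>The value depends on the list chosen for \<Delta>(c) unless \<open>m\<close> is
  bilinear, so linearity and coassociativity are stated only for bilinear and trilinear
  arguments.\<close>

definition sw :: "('c \<Rightarrow> ('c \<times> 'c) list) \<Rightarrow> 'c \<Rightarrow> ('c \<Rightarrow> 'c \<Rightarrow> 'u::monoid_add) \<Rightarrow> 'u" where
  "sw d c m = (\<Sum>p\<leftarrow>d c. m (fst p) (snd p))"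

lemma lin_sw_right: "lin t u f \<Longrightarrow> f (sw d c m) = sw d c (\<lambda>a b. f (m a b))"
  by (simp add: sw_def lin_sum_list)

lemma sw_add: "sw d c (\<lambda>a b. m a b + n a b) = sw d c m + sw d c (n :: _ \<Rightarrow> _ \<Rightarrow> _::ab_group_add)"
  by (simp add: sw_def sum_list_addf)

lemma sw_diff: "sw d c (\<lambda>a b. m a b - n a b) = sw d c m - sw d c (n :: _ \<Rightarrow> _ \<Rightarrow> _::ab_group_add)"
  by (simp add: sw_def sum_list_subtractf)

lemma sw_swap:
  "sw d c (\<lambda>a b. sw d' c' (m a b)) = sw d' c' (\<lambda>x y. sw d c (\<lambda>a b. m a b x y :: 'u::comm_monoid_add))"
  unfolding sw_def by (rule sum_list_swap)

lemma sw_times_left: "r * sw d c m = sw d c (\<lambda>a b. r * (m a b :: 'u::semiring_0))"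
  by (simp add: sw_def sum_list_const_mult)

lemma sw_times_right: "sw d c m * r = sw d c (\<lambda>a b. (m a b :: 'u::semiring_0) * r)"
  by (simp add: sw_def sum_list_mult_const)

lemma lin_sw_param: "vector_space t \<Longrightarrow> (\<And>a b. lin s t (\<lambda>x. m x a b)) \<Longrightarrow> lin s t (\<lambda>x. sw d c (m x))"
  unfolding sw_def by (rule lin_sum)

text \<open>
  \<open>d c\<close> is a list of pairs representing \<open>\<Delta>(P c)\<close> for a projection \<open>P\<close> onto the carrier \<open>V\<close>;
  with the projection built in, all Sweedler sums are linear on the ambient space.
\<close>

locale coal =
  fixes s :: "'k::field \<Rightarrow> 'c::ab_group_add \<Rightarrow> 'c" and V :: "'c set" and P :: "'c \<Rightarrow> 'c"
    and d :: "'c \<Rightarrow> ('c \<times> 'c) list" and e :: "'c \<Rightarrow> 'k"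
  assumes vs: "vector_space s" and V: "module.subspace s V"
    and P: "lin s s P" "\<And>x. P x \<in> V" "\<And>x. x \<in> V \<Longrightarrow> P x = x"
    and d_in: "\<And>c p. p \<in> set (d c) \<Longrightarrow> fst p \<in> V \<and> snd p \<in> V"
    and form_lin: "\<And>m. bil s s (*) m \<Longrightarrow> lin s (*) (\<lambda>c. sw d c m)"
    and form_P: "\<And>m c. bil s s (*) m \<Longrightarrow> sw d (P c) m = sw d c m"
    and form_coassoc: "\<And>m c. tril s s s (*) m \<Longrightarrow>
      sw d c (\<lambda>a b. sw d a (\<lambda>a1 a2. m a1 a2 b)) = sw d c (\<lambda>a b. sw d b (m a))"
    and e: "lin s (*) e"
    and counit_left: "\<And>c. c \<in> V \<Longrightarrow> sw d c (\<lambda>a b. s (e a) b) = c"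
    and counit_right: "\<And>c. c \<in> V \<Longrightarrow> sw d c (\<lambda>a b. s (e b) a) = c"
begin

sublocale vector_space s by (rule vs)

lemma sw_cong: "(\<And>a b. a \<in> V \<Longrightarrow> b \<in> V \<Longrightarrow> m a b = n a b) \<Longrightarrow> sw d c m = sw d c n"
  unfolding sw_def using d_in by (metis (mono_tags, lifting) map_eq_conv)

lemma lin_sw:
  assumes u: "vector_space u" and m: "bil s s u m"
  shows "lin s u (\<lambda>c. sw d c m)"
proof -
  have *: "lin s (*) (\<lambda>c. \<phi> (sw d c m))" if "lin u (*) \<phi>" for \<phi>
    unfolding lin_sw_right[OF that]
    by (intro form_lin bilI lin_comp[OF that] bil1[OF m] bil2[OF m])
  show ?thesis
  proof (rule linI)
    show "sw d (x + y) m = sw d x m + sw d y m" for x y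
      by (rule eq_by_functionals[OF u]) (simp add: lin_add[OF *] lin_add)
    show "sw d (s a x) m = u a (sw d x m)" for a x
      by (rule eq_by_functionals[OF u]) (simp add: lin_scale[OF *] lin_scale)
  qed
qed

lemma sw_P:
  assumes u: "vector_space u" and m: "bil s s u m"
  shows "sw d (P c) m = sw d c m"
proof (rule eq_by_functionals[OF u])
  fix \<phi> assume phi: "lin u (*) \<phi>"
  show "\<phi> (sw d (P c) m) = \<phi> (sw d c m)"
    unfolding lin_sw_right[OF phi]
    by (intro form_P bilI lin_comp[OF phi] bil1[OF m] bil2[OF m])
qed

lemma coassoc:
  assumes u: "vector_space u" and m: "tril s s s u m"
  shows "sw d c (\<lambda>a b. sw d a (\<lambda>a1 a2. m a1 a2 b)) = sw d c (\<lambda>a b. sw d b (m a))"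
proof (rule eq_by_functionals[OF u])
  fix \<phi> assume phi: "lin u (*) \<phi>"
  have "tril s s s (*) (\<lambda>x y z. \<phi> (m x y z))"
    using m unfolding tril_def by (auto intro: lin_comp[OF phi])
  from form_coassoc[OF this]
  show "\<phi> (sw d c (\<lambda>a b. sw d a (\<lambda>a1 a2. m a1 a2 b))) = \<phi> (sw d c (\<lambda>a b. sw d b (m a)))"
    by (simp add: lin_sw_right[OF phi])
qed

lemma counit_left_lin:
  assumes f: "lin s u f" and c: "c \<in> V"
  shows "sw d c (\<lambda>a b. u (e a) (f b)) = f c"
  using lin_sw_right[OF f, of d c "\<lambda>a b. s (e a) b"] by (simp add: counit_left[OF c] lin_scale[OF f])

lemma counit_right_lin:
  assumes f: "lin s u f" and c: "c \<in> V"
  shows "sw d c (\<lambda>a b. u (e b) (f a)) = f c"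
  using lin_sw_right[OF f, of d c "\<lambda>a b. s (e b) a"] by (simp add: counit_right[OF c] lin_scale[OF f])

text \<open>The action of the dual algebra by \<phi>(c_1) c_2. The names \<open>lact\<close> and
  \<open>ract\<close> tell which tensor factor is evaluated; as module structures
  \<open>lact\<close> is a right action and \<open>ract\<close> a left one, as the order of the
  products in \<open>lact_lact\<close> and \<open>ract_ract\<close> shows.\<close>

definition lact :: "('c \<Rightarrow> 'k) \<Rightarrow> 'c \<Rightarrow> 'c" where
  "lact \<phi> c = sw d c (\<lambda>a b. s (\<phi> a) b)"

definition ract :: "('c \<Rightarrow> 'k) \<Rightarrow> 'c \<Rightarrow> 'c" where
  "ract \<phi> c = sw d c (\<lambda>a b. s (\<phi> b) a)"

definition conv :: "('c \<Rightarrow> 'k) \<Rightarrow> ('c \<Rightarrow> 'k) \<Rightarrow> 'c \<Rightarrow> 'k" where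
  "conv \<phi> \<psi> c = sw d c (\<lambda>a b. \<phi> a * \<psi> b)"

lemma bil_lact: "lin s (*) \<phi> \<Longrightarrow> lin s u f \<Longrightarrow> vector_space u \<Longrightarrow> bil s s u (\<lambda>a b. u (\<phi> a) (f b))"
  by (intro bilI lin_scale_var lin_scale_const)

lemma bil_ract: "lin s (*) \<phi> \<Longrightarrow> lin s u f \<Longrightarrow> vector_space u \<Longrightarrow> bil s s u (\<lambda>a b. u (\<phi> b) (f a))"
  by (intro bilI lin_scale_var lin_scale_const)

lemma lin_lact: "lin s (*) \<phi> \<Longrightarrow> lin s s (lact \<phi>)"
  unfolding lact_def by (intro lin_sw vs bil_lact lin_id)

lemma lin_ract: "lin s (*) \<phi> \<Longrightarrow> lin s s (ract \<phi>)"
  unfolding ract_def by (intro lin_sw vs bil_ract lin_id)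

lemma lin_conv: "lin s (*) \<phi> \<Longrightarrow> lin s (*) \<psi> \<Longrightarrow> lin s (*) (conv \<phi> \<psi>)"
  unfolding conv_def by (intro lin_sw vector_space_field bil_lact)

lemma lin_lact_apply: "lin s u f \<Longrightarrow> f (lact \<phi> c) = sw d c (\<lambda>a b. u (\<phi> a) (f b))"
  unfolding lact_def by (subst lin_sw_right[of s u f]) (simp_all add: lin_scale)

lemma lin_ract_apply: "lin s u f \<Longrightarrow> f (ract \<phi> c) = sw d c (\<lambda>a b. u (\<phi> b) (f a))"
  unfolding ract_def by (subst lin_sw_right[of s u f]) (simp_all add: lin_scale)

lemma conv_lact: "lin s (*) \<psi> \<Longrightarrow> \<psi> (lact \<phi> c) = conv \<phi> \<psi> c"
  by (simp add: lin_lact_apply conv_def)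

lemma conv_ract: "lin s (*) \<phi> \<Longrightarrow> \<phi> (ract \<psi> c) = conv \<phi> \<psi> c"
  by (simp add: lin_ract_apply conv_def mult.commute)

lemma sum_list_in_subspace: "subspace X \<Longrightarrow> (\<And>p. p \<in> set l \<Longrightarrow> g p \<in> X) \<Longrightarrow> (\<Sum>p\<leftarrow>l. g p) \<in> X"
  by (induction l) (auto simp: subspace_0 subspace_add)

lemma sw_in_subspace: "subspace X \<Longrightarrow> (\<And>a b. a \<in> V \<Longrightarrow> b \<in> V \<Longrightarrow> m a b \<in> X) \<Longrightarrow> sw d c m \<in> X"
  unfolding sw_def using d_in by (intro sum_list_in_subspace) auto

lemma lact_V: "lact \<phi> c \<in> V"
  unfolding lact_def by (intro sw_in_subspace V subspace_scale)

lemma ract_V: "ract \<phi> c \<in> V"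
  unfolding ract_def by (intro sw_in_subspace V subspace_scale)

lemma lact_counit: "c \<in> V \<Longrightarrow> lact e c = c"
  by (simp add: lact_def counit_left)

lemma ract_counit: "c \<in> V \<Longrightarrow> ract e c = c"
  by (simp add: ract_def counit_right)

lemma sw_lact:
  assumes "lin s (*) \<phi>" "vector_space u" "bil s s u m"
  shows "sw d (lact \<phi> c) m = sw d c (\<lambda>a b. sw d b (\<lambda>b1 b2. u (\<phi> a) (m b1 b2)))"
  using lin_lact_apply[OF lin_sw[OF assms(2,3)], of \<phi> c]
  by (simp add: lin_sw_right[of u u "u _"] lin_def vector_space_simps[OF assms(2)] mult.commute)

lemma sw_ract:
  assumes "lin s (*) \<phi>" "vector_space u" "bil s s u m"
  shows "sw d (ract \<phi> c) m = sw d c (\<lambda>a b. sw d a (\<lambda>a1 a2. u (\<phi> b) (m a1 a2)))"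
  using lin_ract_apply[OF lin_sw[OF assms(2,3)], of \<phi> c]
  by (simp add: lin_sw_right[of u u "u _"] lin_def vector_space_simps[OF assms(2)] mult.commute)

lemma lact_lact:
  assumes "lin s (*) \<phi>" "lin s (*) \<psi>"
  shows "lact \<psi> (lact \<phi> c) = lact (conv \<phi> \<psi>) c"
proof -
  have "lact \<psi> (lact \<phi> c) = sw d c (\<lambda>a b. sw d b (\<lambda>b1 b2. s (\<phi> a) (s (\<psi> b1) b2)))"
    unfolding lact_def[of \<psi>] by (rule sw_lact) (use assms in \<open>auto intro!: vs bil_lact lin_id\<close>)
  also have "\<dots> = sw d c (\<lambda>a b. sw d a (\<lambda>a1 a2. s (\<phi> a1) (s (\<psi> a2) b)))"
    by (rule coassoc[symmetric, OF vs], rule trilI)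
      (use assms vs in \<open>auto intro!: vector_space_field lin_scale_var lin_scale_const lin_id\<close>)
  also have "\<dots> = lact (conv \<phi> \<psi>) c"
    by (simp add: lact_def conv_def lin_sw_right[OF lin_scale_var[OF vs lin_id]] )
  finally show ?thesis .
qed

lemma ract_ract:
  assumes "lin s (*) \<phi>" "lin s (*) \<psi>"
  shows "ract \<phi> (ract \<psi> c) = ract (conv \<phi> \<psi>) c"
proof -
  have "ract \<phi> (ract \<psi> c) = sw d c (\<lambda>a b. sw d a (\<lambda>a1 a2. s (\<psi> b) (s (\<phi> a2) a1)))"
    unfolding ract_def[of \<phi>] by (rule sw_ract) (use assms in \<open>auto intro!: vs bil_ract lin_id\<close>)
  also have "\<dots> = sw d c (\<lambda>a b. sw d b (\<lambda>b1 b2. s (\<psi> b2) (s (\<phi> b1) a)))"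
    by (rule coassoc[OF vs], rule trilI)
      (use assms vs in \<open>auto intro!: vector_space_field lin_scale_var lin_scale_const lin_id\<close>)
  also have "\<dots> = ract (conv \<phi> \<psi>) c"
    by (simp add: ract_def conv_def lin_sw_right[OF lin_scale_var[OF vs lin_id]] mult.commute)
  finally show ?thesis .
qed

lemma lact_ract:
  assumes "lin s (*) \<phi>" "lin s (*) \<psi>"
  shows "lact \<phi> (ract \<psi> c) = ract \<psi> (lact \<phi> c)"
proof -
  have "lact \<phi> (ract \<psi> c) = sw d c (\<lambda>a b. sw d a (\<lambda>a1 a2. s (\<psi> b) (s (\<phi> a1) a2)))"
    unfolding lact_def by (rule sw_ract) (use assms in \<open>auto intro!: vs bil_lact lin_id\<close>)
  also have "\<dots> = sw d c (\<lambda>a b. sw d b (\<lambda>b1 b2. s (\<psi> b2) (s (\<phi> a) b1)))"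
    by (rule coassoc[OF vs], rule trilI)
      (use assms vs in \<open>auto intro!: vector_space_field lin_scale_var lin_scale_const lin_id\<close>)
  also have "\<dots> = sw d c (\<lambda>a b. sw d b (\<lambda>b1 b2. s (\<phi> a) (s (\<psi> b2) b1)))"
    by (simp add: mult.commute)
  also have "\<dots> = ract \<psi> (lact \<phi> c)"
    unfolding ract_def by (rule sw_lact[symmetric]) (use assms in \<open>auto intro!: vs bil_ract lin_id\<close>)
  finally show ?thesis .
qed

text \<open>Subcoalgebras as subbimodules over the dual algebra: closure under both actions puts
  \<Delta>(E) into E \<otimes> V and V \<otimes> E, whose intersection is E \<otimes> E. The
  agreement with the tensor definition is \<open>subcoalgebra_iff_sub\<close>.\<close>

definition sub :: "'c set \<Rightarrow> bool" where
  "sub E \<longleftrightarrow> subspace E \<and> E \<subseteq> V \<and>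
     (\<forall>\<phi> x. lin s (*) \<phi> \<longrightarrow> x \<in> E \<longrightarrow> lact \<phi> x \<in> E \<and> ract \<phi> x \<in> E)"

lemma subD:
  assumes "sub E"
  shows "subspace E" "x \<in> E \<Longrightarrow> x \<in> V" "lin s (*) \<phi> \<Longrightarrow> x \<in> E \<Longrightarrow> lact \<phi> x \<in> E"
    "lin s (*) \<phi> \<Longrightarrow> x \<in> E \<Longrightarrow> ract \<phi> x \<in> E"
  using assms by (auto simp: sub_def)

lemma sub_zero: "sub {0}"
  using subspace_0[OF V] by (auto simp: sub_def lin_0[OF lin_lact] lin_0[OF lin_ract])

text \<open>The premise on \<open>ract\<close> says that \<Delta>(x) lies in X \<otimes> V, so a
  projection onto \<open>X\<close> may be inserted in the first factor. Inserting projections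
  replaces membership statements about tensors throughout.\<close>

lemma sw_project_left:
  assumes Q: "lin s s Q" "\<And>x. x \<in> X \<Longrightarrow> Q x = x" and u: "vector_space u" and m: "bil s s u m"
    and x: "\<And>\<phi>. lin s (*) \<phi> \<Longrightarrow> ract \<phi> x \<in> X"
  shows "sw d x (\<lambda>a b. m (Q a) b) = sw d x m"
  unfolding sw_def
proof (rule bilinear_sum_eq[OF vs vs m])
  fix \<phi> assume phi: "lin s (*) \<phi>"
  have "(\<Sum>p\<leftarrow>d x. s (\<phi> (snd p)) (Q (fst p))) = Q (ract \<phi> x)"
    by (simp add: ract_def sw_def lin_sum_list[OF Q(1)] lin_scale[OF Q(1)])
  also have "\<dots> = ract \<phi> x" using Q(2) x[OF phi] by simp
  also have "\<dots> = (\<Sum>p\<leftarrow>d x. s (\<phi> (snd p)) (fst p))" by (simp add: ract_def sw_def)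
  finally show "(\<Sum>p\<leftarrow>d x. s (\<phi> (snd p)) (Q (fst p))) = (\<Sum>p\<leftarrow>d x. s (\<phi> (snd p)) (fst p))" .
qed

lemma bil_flip: "bil s' t u m \<Longrightarrow> bil t s' u (\<lambda>a b. m b a)"
  by (simp add: bil_def)

lemma sw_project_right:
  assumes Q: "lin s s Q" "\<And>x. x \<in> X \<Longrightarrow> Q x = x" and u: "vector_space u" and m: "bil s s u m"
    and x: "\<And>\<phi>. lin s (*) \<phi> \<Longrightarrow> lact \<phi> x \<in> X"
  shows "sw d x (\<lambda>a b. m a (Q b)) = sw d x m"
  unfolding sw_def
proof (rule bilinear_sum_eq[OF vs vs bil_flip[OF m]])
  fix \<phi> assume phi: "lin s (*) \<phi>"
  have "(\<Sum>p\<leftarrow>d x. s (\<phi> (fst p)) (Q (snd p))) = Q (lact \<phi> x)"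
    by (simp add: lact_def sw_def lin_sum_list[OF Q(1)] lin_scale[OF Q(1)])
  also have "\<dots> = lact \<phi> x" using Q(2) x[OF phi] by simp
  also have "\<dots> = (\<Sum>p\<leftarrow>d x. s (\<phi> (fst p)) (snd p))" by (simp add: lact_def sw_def)
  finally show "(\<Sum>p\<leftarrow>d x. s (\<phi> (fst p)) (Q (snd p))) = (\<Sum>p\<leftarrow>d x. s (\<phi> (fst p)) (snd p))" .
qed

lemma sw_project:
  assumes Q: "lin s s Q" "\<And>x. x \<in> E \<Longrightarrow> Q x = x" and u: "vector_space u" and m: "bil s s u m"
    and E: "sub E" "x \<in> E"
  shows "sw d x (\<lambda>a b. m (Q a) (Q b)) = sw d x m"
proof -
  have "bil s s u (\<lambda>a b. m (Q a) b)"
    by (intro bilI lin_comp[OF bil1[OF m] Q(1)] bil2[OF m])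
  from sw_project_right[OF Q u this subD(3)[OF E(1) _ E(2)]]
  show ?thesis using sw_project_left[OF Q u m subD(4)[OF E(1) _ E(2)]] by simp
qed

lemma sub_span:
  assumes "Y \<subseteq> V" "\<And>\<phi> y. lin s (*) \<phi> \<Longrightarrow> y \<in> Y \<Longrightarrow> lact \<phi> y \<in> span Y \<and> ract \<phi> y \<in> span Y"
  shows "sub (span Y)"
  unfolding sub_def
proof (intro conjI allI impI)
  show "span Y \<subseteq> V" by (rule span_minimal[OF assms(1) V])
  fix \<chi> y assume chi: "lin s (*) \<chi>" and "y \<in> span Y"
  from this(2) show "lact \<chi> y \<in> span Y"
    by (induction rule: span_induct_alt)
      (simp_all add: assms chi lin_0[OF lin_lact[OF chi]] span_zero lin_add[OF lin_lact[OF chi]]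
        lin_scale[OF lin_lact[OF chi]] span_add span_scale)
  from \<open>y \<in> span Y\<close> show "ract \<chi> y \<in> span Y"
    by (induction rule: span_induct_alt)
      (simp_all add: assms chi lin_0[OF lin_ract[OF chi]] span_zero lin_add[OF lin_ract[OF chi]]
        lin_scale[OF lin_ract[OF chi]] span_add span_scale)
qed (rule subspace_span)

text \<open>The fundamental theorem of coalgebras. All elements \<psi>(x_1) x_2 \<phi>(x_3) lie in
  the span of the finitely many middle factors of one representation of the iterated coproduct of x,
  and they form a set stable under both actions.\<close>

lemma sub_span_ract_lact:
  assumes x: "x \<in> V"
  shows "\<exists>E. sub E \<and> findim s E \<and> x \<in> E"
proof -
  define Y where "Y = {ract \<phi> (lact \<psi> x) | \<phi> \<psi>. lin s (*) \<phi> \<and> lin s (*) \<psi>}"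
  define G where "G = (\<Union>p\<in>set (d x). fst ` set (d (snd p)))"
  have "y \<in> span G" if "y \<in> Y" for y
  proof -
    obtain \<phi> \<psi> where y: "y = ract \<phi> (lact \<psi> x)" "lin s (*) \<phi>" "lin s (*) \<psi>" using \<open>y \<in> Y\<close> by (auto simp: Y_def)
    have y_eq: "y = (\<Sum>p\<leftarrow>d x. s (\<psi> (fst p)) (\<Sum>q\<leftarrow>d (snd p). s (\<phi> (snd q)) (fst q)))"
      unfolding y lin_lact_apply[OF lin_ract[OF y(2)]] by (simp add: sw_def ract_def)
    have mem: "fst q \<in> span G" if "p \<in> set (d x)" "q \<in> set (d (snd p))" for p q
      using that by (intro span_base) (auto simp: G_def)
    show ?thesis
      unfolding y_eq by (intro sum_list_in_subspace subspace_span span_scale) (rule mem)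
  qed
  then have "span Y \<subseteq> span G" by (intro span_minimal subspace_span) blast
  moreover have "finite G" by (simp add: G_def)
  ultimately have "findim s (span Y)" unfolding findim_def by blast
  moreover have "x \<in> Y"
    using x e unfolding Y_def by (intro CollectI exI[of _ e]) (simp add: ract_counit lact_counit)
  then have "x \<in> span Y" by (rule span_base)
  moreover have "sub (span Y)"
  proof (rule sub_span)
    show "Y \<subseteq> V" by (auto simp: Y_def ract_V)
    fix \<chi> y assume chi: "lin s (*) \<chi>" and "y \<in> Y"
    then obtain \<phi> \<psi> where y: "y = ract \<phi> (lact \<psi> x)" "lin s (*) \<phi>" "lin s (*) \<psi>"
      by (auto simp: Y_def)
    have "lact \<chi> y = ract \<phi> (lact (conv \<psi> \<chi>) x)"
      using y chi by (simp add: lact_ract lact_lact)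
    then have "lact \<chi> y \<in> Y" using y(2) lin_conv[OF y(3) chi] unfolding Y_def by blast
    moreover have "ract \<chi> y = ract (conv \<chi> \<phi>) (lact \<psi> x)"
      using y chi by (simp add: ract_ract)
    then have "ract \<chi> y \<in> Y" using y(3) lin_conv[OF chi y(2)] unfolding Y_def by blast
    ultimately show "lact \<chi> y \<in> span Y \<and> ract \<chi> y \<in> span Y" by (simp add: span_base)
  qed
  ultimately show ?thesis by blast
qed

lemma sub_span_Un:
  assumes "sub E" "sub F"
  shows "sub (span (E \<union> F))"
  by (rule sub_span) (use assms in \<open>auto simp: sub_def intro!: span_base\<close>)

lemma findim_sub_cover:
  assumes "finite X" "X \<subseteq> V"
  shows "\<exists>E. sub E \<and> findim s E \<and> X \<subseteq> E"
  using assms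
proof (induction X rule: finite_induct)
  case empty
  show ?case using sub_zero by (intro exI[of _ "{0}"]) (auto simp: findim_def intro!: exI[of _ "{}"])
next
  case (insert x X)
  then obtain E where E: "sub E" "findim s E" "X \<subseteq> E" by blast
  obtain F where F: "sub F" "findim s F" "x \<in> F" using insert sub_span_ract_lact by blast
  show ?case
    using sub_span_Un[OF E(1) F(1)] findim_span[OF vs findim_Un[OF vs E(2) F(2)]] E F
    by (intro exI[of _ "span (E \<union> F)"]) (auto intro: span_base)
qed

end

section \<open>Prime subcoalgebras are simple\<close>

context coal
begin

text \<open>\<open>E\<close> is contained in the wedge of \<open>X\<close> and \<open>Y\<close>,
  that is \<Delta>(E) \<subseteq> X \<otimes> V + V \<otimes> Y; dually, the product of the
  annihilators of \<open>X\<close> and \<open>Y\<close> kills \<open>E\<close>.\<close>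

definition wedge :: "'c set \<Rightarrow> 'c set \<Rightarrow> 'c set \<Rightarrow> bool" where
  "wedge E X Y \<longleftrightarrow> (\<forall>x\<in>E. \<forall>\<phi> \<psi>. lin s (*) \<phi> \<longrightarrow> lin s (*) \<psi> \<longrightarrow>
     (\<forall>x\<in>X. \<phi> x = 0) \<longrightarrow> (\<forall>y\<in>Y. \<psi> y = 0) \<longrightarrow> conv \<phi> \<psi> x = 0)"

text \<open>
  In the dual algebra \<open>wedge_prime E\<close> says that the zero ideal of \<open>E\<^sup>*\<close> is prime.
\<close>

definition wedge_prime :: "'c set \<Rightarrow> bool" where
  "wedge_prime E \<longleftrightarrow> sub E \<and> E \<noteq> {0} \<and>
     (\<forall>X Y. sub X \<longrightarrow> X \<subseteq> E \<longrightarrow> sub Y \<longrightarrow> Y \<subseteq> E \<longrightarrow> wedge E X Y \<longrightarrow> X = E \<or> Y = E)"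

lemma lact_plus: "lact (\<lambda>c. \<phi> c + \<psi> c) x = lact \<phi> x + lact \<psi> x"
  by (simp add: lact_def scale_left_distrib sw_add)

lemma lact_minus: "lact (\<lambda>c. \<phi> c - \<psi> c) x = lact \<phi> x - lact \<psi> x"
  by (simp add: lact_def scale_left_diff_distrib sw_diff)

lemma lact_times: "lact (\<lambda>c. a * \<phi> c) x = s a (lact \<phi> x)"
  unfolding lact_def lin_sw_right[OF lin_scale_const[OF vs lin_id]] by simp

lemma lact_zero: "lact (\<lambda>c. 0) x = 0"
  by (simp add: lact_def sw_def)

lemma ract_plus: "ract (\<lambda>c. \<phi> c + \<psi> c) x = ract \<phi> x + ract \<psi> x"
  by (simp add: ract_def scale_left_distrib sw_add)

lemma ract_minus: "ract (\<lambda>c. \<phi> c - \<psi> c) x = ract \<phi> x - ract \<psi> x"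
  by (simp add: ract_def scale_left_diff_distrib sw_diff)

lemma ract_times: "ract (\<lambda>c. a * \<phi> c) x = s a (ract \<phi> x)"
  unfolding ract_def lin_sw_right[OF lin_scale_const[OF vs lin_id]] by simp

lemma ract_zero: "ract (\<lambda>c. 0) x = 0"
  by (simp add: ract_def sw_def)

lemma functional_counit_lact: "x \<in> V \<Longrightarrow> lin s (*) \<phi> \<Longrightarrow> e (lact \<phi> x) = \<phi> x"
  by (metis conv_lact conv_ract e ract_counit)

lemma functional_counit_ract: "x \<in> V \<Longrightarrow> lin s (*) \<phi> \<Longrightarrow> e (ract \<phi> x) = \<phi> x"
  by (metis conv_lact conv_ract e lact_counit)

text \<open>
  Dually: a finite-dimensional prime algebra is simple. For a maximal proper left coideal \<open>N\<close>,
  primeness makes the functionals \<open>l\<close> killing \<open>N\<close> (a minimal left ideal) act faithfully, so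
  that \<open>E\<close> is spanned by the elements \<open>x\<^sub>1 l(x\<^sub>2)\<close>. Write a nonzero \<open>z \<in> Z\<close> as the
  shortest possible sum of these. By minimality, \<open>x\<^sub>0 \<mapsto> z\<close>, for \<open>x\<^sub>0\<close> the first element
  occurring, induces a colinear map \<open>E/N \<rightarrow> Z\<close>, hence a functional \<open>\<Lambda> \<noteq> 0\<close> killing \<open>N\<close>
  with \<open>x\<^sub>1 \<Lambda>(x\<^sub>2) \<in> Z\<close> for all \<open>x\<close>, and \<open>\<Lambda>\<close> generates the minimal left ideal.
\<close>

theorem wedge_prime_simple:
  assumes fin: "findim s E" and E: "wedge_prime E" and Z: "sub Z" "Z \<subseteq> E" "Z \<noteq> {0}"
  shows "Z = E"
proof -
  have subE: "sub E" and E0: "E \<noteq> {0}" using E by (auto simp: wedge_prime_def)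
  note E' = subD[OF subE]
  note Z' = subD[OF Z(1)]
  \<comment> \<open>\<open>closed\<close> means a left coideal inside \<open>E\<close>: \<Delta>(N)
    \<subseteq> V \<otimes> N.\<close>
  define closed where "closed N \<longleftrightarrow> subspace N \<and> N \<subseteq> E \<and> (\<forall>\<phi> x. lin s (*) \<phi> \<longrightarrow> x \<in> N \<longrightarrow> lact \<phi> x \<in> N)" for N
  have "closed {0} \<and> {0} \<noteq> E"
    using E0 subspace_0[OF E'(1)] by (auto simp: closed_def lin_0[OF lin_lact])
  moreover have "\<forall>N. closed N \<and> N \<noteq> E \<longrightarrow> dim N < dim E"
    using dim_strict_mono[OF vs fin] by (auto simp: closed_def)
  ultimately have "\<exists>N. (closed N \<and> N \<noteq> E) \<and> (\<forall>M. closed M \<and> M \<noteq> E \<longrightarrow> dim M \<le> dim N)"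
    by (rule ex_has_greatest_nat)
  then obtain N where N: "closed N" "N \<noteq> E" and
    N_max: "\<And>M. closed M \<Longrightarrow> M \<noteq> E \<Longrightarrow> dim M \<le> dim N" by blast
  have N': "subspace N" "N \<subseteq> E" "\<And>\<phi> x. lin s (*) \<phi> \<Longrightarrow> x \<in> N \<Longrightarrow> lact \<phi> x \<in> N"
    using N by (auto simp: closed_def)
  have maximal: "M = E" if "closed M" "N \<subseteq> M" "M \<noteq> N" for M
  proof (rule ccontr)
    assume "M \<noteq> E"
    moreover have "dim N < dim M"
      by (rule dim_strict_mono[OF vs findim_subset[OF fin]]) (use that N' in \<open>auto simp: closed_def\<close>)
    ultimately show False using N_max[OF that(1)] by simp
  qed
  \<comment> \<open>Dually, \<open>span R\<close> is orthogonal to the left annihilator of the left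
    ideal \<open>L\<close>, and \<open>Y\<close>, the largest subcoalgebra inside \<open>N\<close>,
    is orthogonal to the two-sided ideal generated by \<open>L\<close>. The product of these two
    ideals is zero and \<open>Y\<close> is not \<open>E\<close>, so primeness will give
    \<open>span R = E\<close>.\<close>
  define L where "L l \<longleftrightarrow> lin s (*) l \<and> (\<forall>n\<in>N. l n = 0)" for l
  define R where "R = {ract l x | l x. L l \<and> x \<in> E}"
  define Y where "Y = {x\<in>E. \<forall>\<phi>. lin s (*) \<phi> \<longrightarrow> ract \<phi> x \<in> N}"
  have RE: "R \<subseteq> E" using E' by (auto simp: R_def L_def)
  have subX: "sub (span R)"
  proof (rule sub_span)
    show "R \<subseteq> V" using RE E' by blast
    fix \<phi> y assume phi: "lin s (*) \<phi>" and "y \<in> R"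
    then obtain l x where y: "y = ract l x" "L l" "x \<in> E" by (auto simp: R_def)
    have "lact \<phi> y = ract l (lact \<phi> x)" using y phi by (simp add: lact_ract L_def)
    then have "lact \<phi> y \<in> R" using y E' phi unfolding R_def by blast
    moreover have "ract \<phi> y = ract (conv \<phi> l) x" using y phi by (simp add: ract_ract L_def)
    moreover have "L (conv \<phi> l)"
      using y phi N'(3) by (simp add: L_def lin_conv flip: conv_lact)
    then have "ract (conv \<phi> l) x \<in> R" using y unfolding R_def by blast
    ultimately show "lact \<phi> y \<in> span R \<and> ract \<phi> y \<in> span R" by (simp add: span_base)
  qed
  have subY: "sub Y"
    unfolding sub_def
  proof (intro conjI allI impI)
    show "subspace Y"
      using E'(1) N'(1) by (auto simp: Y_def subspace_def lin_0[OF lin_ract] lin_add[OF lin_ract] lin_scale[OF lin_ract])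
    show "Y \<subseteq> V" using E' by (auto simp: Y_def)
    fix \<phi> x assume phi: "lin s (*) \<phi>" and x: "x \<in> Y"
    show "lact \<phi> x \<in> Y" using phi x E' N' by (simp add: Y_def lact_ract[symmetric])
    show "ract \<phi> x \<in> Y" using phi x E' N' by (simp add: Y_def ract_ract lin_conv)
  qed
  have "Y \<noteq> E"
  proof
    assume "Y = E"
    then have "ract e x \<in> N" if "x \<in> E" for x using that e by (auto simp: Y_def)
    then show False using E' N N' by (auto simp: ract_counit)
  qed
  moreover have "wedge E (span R) Y"
    unfolding wedge_def
  proof (intro ballI allI impI)
    fix x \<phi> \<psi> assume x: "x \<in> E" and phi: "lin s (*) \<phi>" "\<forall>x\<in>span R. \<phi> x = 0"
      and psi: "lin s (*) \<psi>" "\<forall>y\<in>Y. \<psi> y = 0"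
    have "lact \<phi> x \<in> Y"
      unfolding Y_def
    proof (intro CollectI conjI allI impI)
      show "lact \<phi> x \<in> E" using x phi E' by simp
      fix \<chi> assume chi: "lin s (*) \<chi>"
      show "ract \<chi> (lact \<phi> x) \<in> N"
      proof (rule ccontr)
        assume "ract \<chi> (lact \<phi> x) \<notin> N"
        from functional_separates[OF vs N'(1) this] obtain l
          where l: "lin s (*) l" "\<And>n. n \<in> N \<Longrightarrow> l n = 0" "l (ract \<chi> (lact \<phi> x)) \<noteq> 0" by blast
        have "l (ract \<chi> (lact \<phi> x)) = \<phi> (ract l (ract \<chi> x))"
          using phi chi l by (simp add: lact_ract[symmetric] conv_lact conv_ract)
        moreover have "ract l (ract \<chi> x) \<in> R" using l E'(4)[OF chi x] unfolding R_def L_def by blast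
        ultimately show False using phi(2) l(3) by (simp add: span_base)
      qed
    qed
    then show "conv \<phi> \<psi> x = 0" using psi by (simp flip: conv_lact)
  qed
  moreover have "span R \<subseteq> E" "Y \<subseteq> E" using RE E'(1) by (auto simp: Y_def span_minimal[THEN subsetD])
  ultimately have XE: "span R = E" using E subX subY by (auto simp: wedge_prime_def)

  have ract_N: "ract l n = 0" if "L l" "n \<in> N" for l n
  proof (rule eq_by_functionals[OF vs])
    fix \<phi> assume "lin s (*) \<phi>"
    then show "\<phi> (ract l n) = \<phi> 0"
      using that N' by (simp add: conv_ract L_def lin_0 flip: conv_lact)
  qed
  define rep where "rep z ps \<longleftrightarrow> (\<forall>p\<in>set ps. L (fst p) \<and> snd p \<in> E) \<and> z = (\<Sum>p\<leftarrow>ps. ract (fst p) (snd p))" for z ps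
  have "\<exists>ps. rep z ps" if "z \<in> span R" for z
    using that
  proof (induction rule: span_induct_alt)
    case base
    show ?case by (intro exI[of _ "[]"]) (simp add: rep_def)
  next
    case (step c x y)
    then obtain ps l x0 where "rep y ps" "x = ract l x0" "L l" "x0 \<in> E" by (auto simp: R_def)
    then show ?case
      using E' by (intro exI[of _ "(l, s c x0) # ps"])
        (auto simp: rep_def L_def lin_scale[OF lin_ract] subspace_scale)
  qed
  moreover obtain z0 where z0: "z0 \<in> Z" "z0 \<noteq> 0" using Z(3) subspace_0[OF Z'(1)] by blast
  ultimately obtain ps0 where "rep z0 ps0" using Z(2) XE by blast
  define good where "good p \<longleftrightarrow> fst p \<in> Z \<and> fst p \<noteq> 0 \<and> rep (fst p) (snd p)" for p
  have "good (z0, ps0)" using z0 \<open>rep z0 ps0\<close> by (simp add: good_def)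
  then have "\<exists>p. good p \<and> (\<forall>q. good q \<longrightarrow> length (snd p) \<le> length (snd q))"
    by (rule ex_has_least_nat)
  then
  obtain z ps where z: "z \<in> Z" "z \<noteq> 0" "rep z ps"
    and z_min: "\<And>z' ps'. z' \<in> Z \<Longrightarrow> z' \<noteq> 0 \<Longrightarrow> rep z' ps' \<Longrightarrow> length ps \<le> length ps'"
    by (auto simp: good_def)
  have "ps \<noteq> []" using z by (auto simp: rep_def)
  then obtain l0 x0 qs where ps: "ps = (l0, x0) # qs" by (metis neq_Nil_conv surj_pair)
  have l0: "L l0" "x0 \<in> E" using z ps by (auto simp: rep_def)
  \<comment> \<open>If \<open>lact \<phi> x0\<close> falls into \<open>N\<close>, the first term of
    the representation drops out of \<open>lact \<phi> z\<close>, leaving an element of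
    \<open>Z\<close> with a shorter representation.\<close>
  have z_kill: "lact \<phi> z = 0" if phi: "lin s (*) \<phi>" and N: "lact \<phi> x0 \<in> N" for \<phi>
  proof (rule ccontr)
    assume "lact \<phi> z \<noteq> 0"
    moreover have "rep (lact \<phi> z) (map (\<lambda>p. (fst p, lact \<phi> (snd p))) qs)"
    proof -
      have "lact \<phi> (ract l0 x0) = 0" using l0 N phi ract_N by (simp add: lact_ract L_def)
      moreover have "lact \<phi> (ract (fst p) (snd p)) = ract (fst p) (lact \<phi> (snd p))" if "p \<in> set qs" for p
        using that z phi by (auto simp: lact_ract ps rep_def L_def)
      ultimately show ?thesis
        using z E' phi by (simp add: rep_def ps lin_add[OF lin_lact[OF phi]] lin_sum_list[OF lin_lact[OF phi]] o_def cong: map_cong)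
    qed
    ultimately show False using z_min[of "lact \<phi> z"] z Z' phi ps by fastforce
  qed
  have z_kill': "\<phi> z = 0" if phi: "lin s (*) \<phi>" and N: "lact \<phi> x0 \<in> N" for \<phi>
    using z_kill[OF that] functional_counit_lact[of z \<phi>] z Z' phi lin_0[OF e] by simp
  have x0: "x0 \<notin> N"
    using z_kill[OF e] l0 z E' Z' by (auto simp: lact_counit)
  \<comment> \<open>\<open>M \<inter> E\<close> is the left coideal generated by \<open>x0\<close>
    and \<open>N\<close>; maximality of \<open>N\<close> makes it all of \<open>E\<close>.\<close>
  define M where "M = {x. \<exists>\<phi>. lin s (*) \<phi> \<and> x - lact \<phi> x0 \<in> N}"
  have M_I: "x \<in> M" if "lin s (*) \<phi>" "x - lact \<phi> x0 \<in> N" for x \<phi>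
    using that by (auto simp: M_def)
  have "M \<inter> E = E"
  proof (rule maximal)
    show "N \<subseteq> M \<inter> E"
      using N' by (auto simp: M_def lact_zero intro!: exI[of _ "\<lambda>c. 0"] lin_zero vector_space_field)
    have "x0 \<in> M" using e l0 E' subspace_0[OF N'(1)] by (auto simp: M_def lact_counit intro!: exI[of _ e])
    then show "M \<inter> E \<noteq> N" using x0 l0 by blast
    show "closed (M \<inter> E)"
      unfolding closed_def
    proof (intro conjI allI impI)
      show "subspace (M \<inter> E)"
      proof (rule subspaceI)
        show "0 \<in> M \<inter> E" using \<open>N \<subseteq> M \<inter> E\<close> subspace_0[OF N'(1)] by blast
        fix x y assume "x \<in> M \<inter> E" "y \<in> M \<inter> E"
        then obtain \<phi> \<psi> where *: "lin s (*) \<phi>" "x - lact \<phi> x0 \<in> N" "lin s (*) \<psi>" "y - lact \<psi> x0 \<in> N" "x \<in> E" "y \<in> E"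
          by (auto simp: M_def)
        have "x + y - lact (\<lambda>c. \<phi> c + \<psi> c) x0 \<in> N"
          using subspace_add[OF N'(1) *(2,4)] by (simp add: lact_plus algebra_simps)
        then show "x + y \<in> M \<inter> E"
          using * E' M_I[OF lin_plus[OF vector_space_field *(1,3)]] by (simp add: subspace_add)
      next
        fix a x assume "x \<in> M \<inter> E"
        then obtain \<phi> where *: "lin s (*) \<phi>" "x - lact \<phi> x0 \<in> N" "x \<in> E" by (auto simp: M_def)
        have "s a x - lact (\<lambda>c. a * \<phi> c) x0 \<in> N"
          using subspace_scale[OF N'(1) *(2), of a] by (simp add: lact_times scale_right_diff_distrib)
        then show "s a x \<in> M \<inter> E"
          using * E' M_I[OF lin_times_const[OF *(1)]] by (simp add: subspace_scale)
      qed
      fix \<psi> x assume psi: "lin s (*) \<psi>" and "x \<in> M \<inter> E"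
      then obtain \<phi> where *: "lin s (*) \<phi>" "x - lact \<phi> x0 \<in> N" "x \<in> E" by (auto simp: M_def)
      have "lact \<psi> x - lact (conv \<phi> \<psi>) x0 \<in> N"
        using N'(3)[OF psi *(2)] * psi by (simp add: lin_diff[OF lin_lact] lact_lact)
      then show "lact \<psi> x \<in> M \<inter> E"
        using * E' psi M_I[OF lin_conv[OF *(1) psi]] by simp
    qed auto
  qed
  then have "\<forall>x\<in>E. \<exists>\<phi>. lin s (*) \<phi> \<and> x - lact \<phi> x0 \<in> N" by (auto simp: M_def)
  then obtain \<Phi> where Phi: "\<And>x. x \<in> E \<Longrightarrow> lin s (*) (\<Phi> x) \<and> x - lact (\<Phi> x) x0 \<in> N" by metis
  have Phi_eq: "\<Phi> x z = \<phi> z" if "x \<in> E" "lin s (*) \<phi>" "x - lact \<phi> x0 \<in> N" for x \<phi>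
  proof -
    have "lact (\<lambda>c. \<Phi> x c - \<phi> c) x0 \<in> N"
      using subspace_diff[OF N'(1) that(3) conjunct2[OF Phi[OF that(1)]]] by (simp add: lact_minus)
    then have "\<Phi> x z - \<phi> z = 0"
      using Phi[OF that(1)] that(2) by (intro z_kill' lin_minus vector_space_field) auto
    then show ?thesis by simp
  qed
  obtain Q where Q: "lin s s Q" "\<And>x. Q x \<in> E" "\<And>x. x \<in> E \<Longrightarrow> Q x = x"
    using subspace_projection[OF vs E'(1)] by metis
  \<comment> \<open>\<open>\<Lambda>\<close> is the counit after the colinear map E/N \<rightarrow>
    Z that takes the class of \<open>lact \<phi> x0\<close> to \<open>lact \<phi> z\<close>, since
    the counit of \<open>lact \<phi> z\<close> is \<phi>(z). The projection \<open>Q\<close> makes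
    it total.\<close>
  define \<Lambda> where "\<Lambda> x = \<Phi> (Q x) z" for x
  have Lam: "\<Lambda> x = \<phi> z" if "x \<in> E" "lin s (*) \<phi>" "x - lact \<phi> x0 \<in> N" for x \<phi>
    using that Q Phi_eq by (simp add: \<Lambda>_def)
  have Lam_lin: "lin s (*) \<Lambda>"
  proof (rule linI)
    fix x y
    have "Q x - lact (\<Phi> (Q x)) x0 + (Q y - lact (\<Phi> (Q y)) x0) \<in> N"
      using Phi Q(2) by (intro subspace_add N') auto
    then have "\<Phi> (Q (x + y)) z = \<Phi> (Q x) z + \<Phi> (Q y) z"
      using Phi Q(2) by (intro Phi_eq[of _ "\<lambda>c. \<Phi> (Q x) c + \<Phi> (Q y) c"] lin_plus vector_space_field)
        (simp_all add: lact_plus lin_add[OF Q(1)] algebra_simps subspace_add[OF E'(1)])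
    then show "\<Lambda> (x + y) = \<Lambda> x + \<Lambda> y" by (simp add: \<Lambda>_def)
  next
    fix a x
    have "s a (Q x - lact (\<Phi> (Q x)) x0) \<in> N"
      using Phi Q(2) by (intro subspace_scale N') auto
    then have "\<Phi> (Q (s a x)) z = a * \<Phi> (Q x) z"
      using Phi Q(2) by (intro Phi_eq[of _ "\<lambda>c. a * \<Phi> (Q x) c"] lin_times_const)
        (simp_all add: lact_times lin_scale[OF Q(1)] scale_right_diff_distrib subspace_scale[OF E'(1)])
    then show "\<Lambda> (s a x) = a * \<Lambda> x" by (simp add: \<Lambda>_def)
  qed
  have Lam_Z: "ract \<Lambda> x \<in> Z" if x: "x \<in> E" for x
  proof -
    have "ract \<Lambda> x = lact (\<Phi> x) z"
    proof (rule eq_by_functionals[OF vs])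
      fix \<psi> assume psi: "lin s (*) \<psi>"
      have "lact \<psi> x - lact (conv (\<Phi> x) \<psi>) x0 \<in> N"
        using N'(3)[OF psi conjunct2[OF Phi[OF x]]] Phi[OF x] psi by (simp add: lin_diff[OF lin_lact] lact_lact)
      then have "\<Lambda> (lact \<psi> x) = conv (\<Phi> x) \<psi> z"
        using psi x Phi E' by (intro Lam lin_conv) auto
      then show "\<psi> (ract \<Lambda> x) = \<psi> (lact (\<Phi> x) z)"
        using psi Lam_lin by (simp add: conv_ract conv_lact)
    qed
    then show ?thesis using Phi[OF x] z Z' by simp
  qed
  \<comment> \<open>The elements killed by the left ideal generated by \<open>\<Lambda>\<close> form
    a left coideal containing \<open>N\<close>. It is proper, as \<phi>(z) is a value of
    \<open>\<Lambda>\<close> on the orbit of \<open>x0\<close> and z is nonzero, so it equals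
    \<open>N\<close>.\<close>
  have NN: "{x\<in>E. \<forall>q. lin s (*) q \<longrightarrow> \<Lambda> (lact q x) = 0} = N" (is "?N = N")
  proof (rule ccontr)
    assume "?N \<noteq> N"
    have "?N = E"
    proof (rule maximal[OF _ _ \<open>?N \<noteq> N\<close>])
      have "\<Lambda> n = 0" if "n \<in> N" for n
        using that N' Lam[of n "\<lambda>c. 0"] lin_zero[OF vector_space_field] by (auto simp: lact_zero)
      then show "N \<subseteq> ?N" using N' by auto
      show "closed ?N"
        using E' by (auto simp: closed_def subspace_def lin_0[OF lin_lact] lin_0[OF Lam_lin] lin_add[OF lin_lact]
            lin_add[OF Lam_lin] lin_scale[OF lin_lact] lin_scale[OF Lam_lin] lact_lact lin_conv)
    qed
    obtain \<phi> where phi: "lin s (*) \<phi>" "\<phi> z \<noteq> 0" using functional_nonzero[OF vs z(2)] .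
    have "\<Lambda> (lact \<phi> x0) = \<phi> z" using l0 phi E' subspace_0[OF N'(1)] by (intro Lam) auto
    moreover have "\<Lambda> (lact e (lact \<phi> x0)) = 0"
      using \<open>?N = E\<close> e E'(3)[OF phi(1) l0(2)] by blast
    ultimately show False using phi by (simp add: lact_counit lact_V)
  qed
  have "R \<subseteq> Z"
  proof
    fix y assume "y \<in> R"
    then obtain l x where y: "y = ract l x" "L l" "x \<in> E" by (auto simp: R_def)
    show "y \<in> Z"
    proof (rule ccontr)
      assume "y \<notin> Z"
      from functional_separates[OF vs Z'(1) this] obtain \<psi> where psi: "lin s (*) \<psi>" "\<And>x. x \<in> Z \<Longrightarrow> \<psi> x = 0" "\<psi> y \<noteq> 0"
        by blast
      have "l (lact \<psi> x) \<noteq> 0" using psi y by (simp add: conv_ract conv_lact L_def)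
      then have "lact \<psi> x \<notin> N" using y by (auto simp: L_def)
      then obtain q where q: "lin s (*) q" "\<Lambda> (lact q (lact \<psi> x)) \<noteq> 0"
        using NN E' y psi by blast
      \<comment> \<open>Reassociated, the product of \<psi>, q and \<Lambda> at x is \<psi> applied
        to an element of \<open>Z\<close>, because \<open>ract \<Lambda> x\<close> lies in
        \<open>Z\<close>.\<close>
      have "\<Lambda> (lact q (lact \<psi> x)) = conv (conv \<psi> q) \<Lambda> x"
        using q psi Lam_lin by (simp add: lact_lact conv_lact)
      also have "\<dots> = conv \<psi> q (ract \<Lambda> x)" using q psi by (simp add: conv_ract lin_conv)
      also have "\<dots> = \<psi> (ract q (ract \<Lambda> x))" using psi by (simp add: conv_ract)
      also have "\<dots> = 0" using psi(2) Z'(4)[OF q(1) Lam_Z[OF y(3)]] by simp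
      finally show False using q by simp
    qed
  qed
  then have "span R \<subseteq> Z" using Z' by (intro span_minimal)
  with XE Z(2) show ?thesis by blast
qed

end

section \<open>One-sided convolution inverses\<close>

context coal
begin

text \<open>Passes from products of functionals to arbitrary bilinear maps: \<open>m\<close> factors
  through V/X and V/Y, which are realised here by 1 - Q and 1 - R, and functionals composed with
  these kill \<open>X\<close> and \<open>Y\<close>.\<close>

lemma sw_wedge_zero:
  assumes w: "wedge E X Y" and X: "subspace X" and Y: "subspace Y" and x: "x \<in> E"
    and u: "vector_space u" and m: "bil s s u m"
    and mX: "\<And>a b. a \<in> X \<Longrightarrow> m a b = 0" and mY: "\<And>a b. b \<in> Y \<Longrightarrow> m a b = 0"
  shows "sw d x m = 0"
proof -
  obtain Q where Q: "lin s s Q" "\<And>x. Q x \<in> X" "\<And>x. x \<in> X \<Longrightarrow> Q x = x"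
    using subspace_projection[OF vs X] by metis
  obtain R where R: "lin s s R" "\<And>x. R x \<in> Y" "\<And>x. x \<in> Y \<Longrightarrow> R x = x"
    using subspace_projection[OF vs Y] by metis
  have m': "m a b = m (a - Q a) (b - R b)" for a b
    using mX[OF Q(2)] mY[OF R(2)] by (simp add: lin_diff[OF bil1[OF m]] lin_diff[OF bil2[OF m]])
  have "(\<Sum>p\<leftarrow>map (\<lambda>p. (fst p - Q (fst p), snd p - R (snd p))) (d x). m (fst p) (snd p)) = 0"
  proof (rule bilinear_sum_zero[OF vs m], rule eq_by_functionals[OF vs])
    fix \<phi> \<psi> assume phi: "lin s (*) \<phi>" and psi: "lin s (*) \<psi>"
    have "conv (\<lambda>a. \<psi> (a - Q a)) (\<lambda>b. \<phi> (b - R b)) x = 0"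
    proof (rule w[unfolded wedge_def, rule_format, OF x])
      show "lin s (*) (\<lambda>a. \<psi> (a - Q a))"
        by (intro lin_comp[OF psi] lin_minus vs lin_id Q(1))
      show "lin s (*) (\<lambda>a. \<phi> (a - R a))"
        by (intro lin_comp[OF phi] lin_minus vs lin_id R(1))
    qed (simp_all add: Q R lin_0[OF phi] lin_0[OF psi])
    then show "\<psi> (\<Sum>p\<leftarrow>map (\<lambda>p. (fst p - Q (fst p), snd p - R (snd p))) (d x). s (\<phi> (snd p)) (fst p)) = \<psi> 0"
      by (simp add: lin_sum_list[OF psi] lin_scale[OF psi] lin_0[OF psi] conv_def sw_def o_def mult.commute)
  qed
  then show ?thesis by (simp add: sw_def o_def flip: m')
qed

lemma ract_cong_sub:
  assumes E: "sub E" "x \<in> E" and f: "lin s (*) \<phi>" "lin s (*) \<psi>" "\<And>y. y \<in> E \<Longrightarrow> \<phi> y = \<psi> y"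
  shows "ract \<phi> x = ract \<psi> x"
proof -
  obtain Q where Q: "lin s s Q" "\<And>x. Q x \<in> E" "\<And>x. x \<in> E \<Longrightarrow> Q x = x"
    using subspace_projection[OF vs subD(1)[OF E(1)]] by metis
  have *: "ract \<chi> x = sw d x (\<lambda>a b. s (\<chi> (Q b)) (Q a))" if "lin s (*) \<chi>" for \<chi>
    unfolding ract_def by (rule sw_project[symmetric, OF Q(1,3) vs _ E]) (use that in \<open>auto intro!: bil_ract vs lin_id\<close>)
  show ?thesis by (simp add: * f Q)
qed

lemma ract_cong: "(\<And>y. y \<in> V \<Longrightarrow> \<phi> y = \<psi> y) \<Longrightarrow> ract \<phi> x = ract \<psi> x"
  unfolding ract_def by (rule sw_cong) simp

end

text \<open>An algebra and a coalgebra on one space, the setting for convolution of endomorphisms.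
  Multiplicativity of the coproduct enters in \<open>covering_data\<close>.\<close>

locale alg_coal = coal s UNIV "\<lambda>x. x" d e
  for s :: "'k::field \<Rightarrow> 'a::ring_1 \<Rightarrow> 'a" and d e +
  assumes smult_left: "s r x * y = s r (x * y)" and smult_right: "x * s r y = s r (x * y)"
begin

lemma lin_mult_left: "lin t s f \<Longrightarrow> lin t s (\<lambda>x. c * f x)"
  by (simp add: lin_def distrib_left smult_right)

lemma lin_mult_right: "lin t s f \<Longrightarrow> lin t s (\<lambda>x. f x * c)"
  by (simp add: lin_def distrib_right smult_left)

lemma bil_mult: "lin t s f \<Longrightarrow> lin u s g \<Longrightarrow> bil t u s (\<lambda>x y. f x * g y)"
  by (intro bilI lin_mult_left lin_mult_right)

text \<open>A left convolution inverse of the inclusion of T. Letting \<open>r\<close> be linear on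
  the whole space loses nothing, since linear maps extend from subspaces, and it lets inverses found
  on different T be combined.\<close>

definition left_invertible_on :: "'a set \<Rightarrow> bool" where
  "left_invertible_on T \<longleftrightarrow> (\<exists>r. lin s s r \<and> (\<forall>t\<in>T. sw d t (\<lambda>a b. r a * b) = s (e t) 1))"

text \<open>
  If \<open>v\<close> and \<open>w'\<close> are left inverses on \<open>X\<close> and \<open>Y\<close>, then
  \<open>(\<epsilon> - v * id) * (\<epsilon> - w' * id)\<close> vanishes on \<open>T\<close>, and it is of the form \<open>\<epsilon> - r * id\<close>.
\<close>

lemma left_invertible_on_wedge:
  assumes w: "wedge T X Y" and X: "subspace X" "left_invertible_on X" and Y: "subspace Y" "left_invertible_on Y"
  shows "left_invertible_on T"
proof -
  obtain v where v: "lin s s v" "\<And>t. t \<in> X \<Longrightarrow> sw d t (\<lambda>a b. v a * b) = s (e t) 1"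
    using X(2) by (auto simp: left_invertible_on_def)
  obtain w' where w': "lin s s w'" "\<And>t. t \<in> Y \<Longrightarrow> sw d t (\<lambda>a b. w' a * b) = s (e t) 1"
    using Y(2) by (auto simp: left_invertible_on_def)
  define p where "p a = s (e a) 1 - sw d a (\<lambda>a b. v a * b)" for a
  define q where "q a = s (e a) 1 - sw d a (\<lambda>a b. w' a * b)" for a
  \<comment> \<open>In the convolution algebra \<open>r\<close> is v + w' - v * id * w', read off
    from expanding the product of \<open>p\<close> and \<open>q\<close>.\<close>
  define r where "r a = v a + w' a - sw d a (\<lambda>a b. sw d b (\<lambda>b1 b2. v a * b1 * w' b2))" for a
  have V: "lin s s (\<lambda>a. sw d a (\<lambda>a b. v a * b))" and W: "lin s s (\<lambda>a. sw d a (\<lambda>a b. w' a * b))"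
    by (intro lin_sw vs bil_mult v(1) w'(1) lin_id)+
  have T: "lin s s (\<lambda>a. sw d a (\<lambda>a b. sw d b (\<lambda>b1 b2. v a * b1 * w' b2)))"
    by (intro lin_sw vs bilI lin_sw_param lin_mult_right lin_mult_left v(1) w'(1) lin_id)
  have lp: "lin s s p" and lq: "lin s s q"
    unfolding p_def q_def by (intro lin_minus vs lin_scale_var e V W)+
  have lr: "lin s s r"
    unfolding r_def by (intro lin_minus lin_plus vs v(1) w'(1) T)
  have "sw d t (\<lambda>a b. r a * b) = s (e t) 1" if t: "t \<in> T" for t
  proof -
    have "sw d t (\<lambda>a b. p a * q b) = 0"
      by (rule sw_wedge_zero[OF w X(1) Y(1) t vs bil_mult[OF lp lq]]) (simp_all add: p_def q_def v w')
    also have "sw d t (\<lambda>a b. p a * q b) = sw d t (\<lambda>a b. s (e a) (s (e b) 1))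
        - sw d t (\<lambda>a b. s (e b) (sw d a (\<lambda>a b. v a * b)))
        - sw d t (\<lambda>a b. s (e a) (sw d b (\<lambda>a b. w' a * b)))
        + sw d t (\<lambda>a b. sw d a (\<lambda>a b. v a * b) * sw d b (\<lambda>a b. w' a * b))"
      by (simp add: p_def q_def sw_diff[symmetric] sw_add[symmetric] algebra_simps smult_left smult_right)
    also have "sw d t (\<lambda>a b. s (e a) (s (e b) 1)) = s (e t) 1"
      by (intro counit_left_lin lin_scale_var vs e) simp
    also have "sw d t (\<lambda>a b. s (e b) (sw d a (\<lambda>a b. v a * b))) = sw d t (\<lambda>a b. v a * b)"
      by (rule counit_right_lin[OF V]) simp
    also have "sw d t (\<lambda>a b. s (e a) (sw d b (\<lambda>a b. w' a * b))) = sw d t (\<lambda>a b. w' a * b)"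
      by (rule counit_left_lin[OF W]) simp
    also have "sw d t (\<lambda>a b. sw d a (\<lambda>a b. v a * b) * sw d b (\<lambda>a b. w' a * b))
        = sw d t (\<lambda>a b. sw d a (\<lambda>a b. sw d b (\<lambda>b1 b2. v a * b1 * w' b2)) * b)"
    proof -
      have "sw d t (\<lambda>a b. sw d a (\<lambda>a b. v a * b) * sw d b (\<lambda>a b. w' a * b))
          = sw d t (\<lambda>a b. sw d a (\<lambda>a1 a2. v a1 * a2 * sw d b (\<lambda>a b. w' a * b)))"
        by (simp add: sw_times_right)
      also have "\<dots> = sw d t (\<lambda>a b. sw d b (\<lambda>b1 b2. v a * b1 * sw d b2 (\<lambda>a b. w' a * b)))"
        by (rule coassoc[OF vs]) (intro trilI lin_mult_left lin_mult_right v(1) lin_id W)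
      also have "\<dots> = sw d t (\<lambda>a b. sw d b (\<lambda>b1 b2. sw d b2 (\<lambda>x y. v a * b1 * w' x * y)))"
        by (simp add: sw_times_left mult.assoc)
      also have "\<dots> = sw d t (\<lambda>a b. sw d b (\<lambda>b1 b2. sw d b1 (\<lambda>x y. v a * x * w' y * b2)))"
        by (subst coassoc[OF vs, where m = "\<lambda>x y z. v _ * x * w' y * z"])
          (intro trilI lin_mult_left lin_mult_right v(1) w'(1) lin_id refl)+
      also have "\<dots> = sw d t (\<lambda>a b. sw d b (\<lambda>b1 b2. sw d b1 (\<lambda>x y. v a * x * w' y) * b2))"
        by (simp add: sw_times_right)
      also have "\<dots> = sw d t (\<lambda>a b. sw d a (\<lambda>a1 a2. sw d a2 (\<lambda>x y. v a1 * x * w' y) * b))"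
        by (rule coassoc[OF vs, symmetric])
          (intro trilI lin_mult_left lin_mult_right v(1) w'(1) lin_id lin_sw vs bilI lin_sw_param)
      finally show ?thesis by (simp add: sw_times_right)
    qed
    finally have "s (e t) 1 = sw d t (\<lambda>a b. v a * b) + sw d t (\<lambda>a b. w' a * b)
        - sw d t (\<lambda>a b. sw d a (\<lambda>a b. sw d b (\<lambda>b1 b2. v a * b1 * w' b2)) * b)"
      by (simp add: algebra_simps)
    also have "\<dots> = sw d t (\<lambda>a b. r a * b)"
      by (simp add: r_def algebra_simps sw_diff sw_add)
    finally show ?thesis by simp
  qed
  then show ?thesis using lr by (auto simp: left_invertible_on_def)
qed

end

text \<open>Every value \<phi>(x) is the counit of \<open>lact \<phi> x\<close>, so a counit
  vanishing on \<open>E\<close> would force all functionals to vanish there.\<close>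

lemma (in coal) functional_counit_nonzero:
  assumes E: "sub E" "E \<noteq> {0}"
  shows "\<exists>x\<in>E. e x \<noteq> 0"
proof (rule ccontr)
  assume *: "\<not> (\<exists>x\<in>E. e x \<noteq> 0)"
  obtain x where x: "x \<in> E" "x \<noteq> 0" using E(2) subspace_0[OF subD(1)[OF E(1)]] by blast
  obtain \<phi> where phi: "lin s (*) \<phi>" "\<phi> x \<noteq> 0" using functional_nonzero[OF vs x(2)] .
  have "e (lact \<phi> x) = 0" using * subD(3)[OF E(1) phi(1) x(1)] by blast
  then show False using functional_counit_lact[OF subD(2)[OF E(1) x(1)] phi(1)] phi(2) by simp
qed

context alg_coal
begin

lemma left_invertible_on_zero: "left_invertible_on {0}"
  unfolding left_invertible_on_def
  by (intro exI[of _ "\<lambda>x. 0"]) (simp add: lin_zero[OF vs] lin_0[OF e] sw_def)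

text \<open>
  By the previous lemma a minimal counterexample \<open>T \<subseteq> f(D)\<close> is simple, so \<open>T\<^sup>*\<close> is a field.
  Here \<open>Op \<alpha> x = x\<^sub>1 \<alpha>(f(x\<^sub>2))\<close>, and \<open>M\<close> is the set of functionals killing \<open>T\<close>. An element
  \<open>x\<close> not annihilated by anything outside \<open>M\<close>, with the smallest orbit possible, is annihilated
  by \<open>M\<close>; acting on the other side gives such a \<open>y\<close> with \<open>\<epsilon>(y) \<noteq> 0\<close>. Then
  \<open>ract \<alpha> (f y) \<mapsto> Op \<alpha> y\<close> is a colinear section \<open>\<tau>\<close> of \<open>f\<close> over \<open>T\<close>, and \<open>g \<circ> \<tau>\<close> is a left
  inverse.
\<close>

lemma left_invertible_cocommutative:
  fixes sH :: "'k \<Rightarrow> 'h::ab_group_add \<Rightarrow> 'h" and f g :: "'h \<Rightarrow> 'a"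
  assumes H: "coal sH VH PH dH eH"
    and f: "lin sH s f" and g: "lin sH s g"
    and f_comult: "\<And>x \<alpha> \<beta>. x \<in> VH \<Longrightarrow> lin s (*) \<alpha> \<Longrightarrow> lin s (*) \<beta> \<Longrightarrow>
      conv \<alpha> \<beta> (f x) = sw dH x (\<lambda>a b. \<alpha> (f a) * \<beta> (f b))"
    and f_counit: "\<And>x. x \<in> VH \<Longrightarrow> e (f x) = eH x"
    and D: "coal.sub sH VH dH D" "findim sH D"
    and gf: "\<And>x. x \<in> D \<Longrightarrow> sw dH x (\<lambda>a b. g a * f b) = s (eH x) 1"
    and sym: "\<And>x \<alpha> \<beta>. x \<in> D \<Longrightarrow> lin s (*) \<alpha> \<Longrightarrow> lin s (*) \<beta> \<Longrightarrow> conv \<alpha> \<beta> (f x) = conv \<beta> \<alpha> (f x)"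
  shows "left_invertible_on (f ` D)"
proof (rule ccontr)
  assume bad: "\<not> left_invertible_on (f ` D)"
  interpret H: coal sH VH PH dH eH by (rule H)
  note D' = H.subD[OF D(1)]
  have af: "lin sH (*) (\<lambda>x. \<alpha> (f x))" if "lin s (*) \<alpha>" for \<alpha>
    by (rule lin_comp[OF that f])
  have f_ract: "f (H.ract (\<lambda>x. \<alpha> (f x)) x) = ract \<alpha> (f x)" if "lin s (*) \<alpha>" "x \<in> VH" for \<alpha> x
  proof (rule eq_by_functionals[OF vs])
    fix \<beta> assume beta: "lin s (*) \<beta>"
    have "\<beta> (f (H.ract (\<lambda>x. \<alpha> (f x)) x)) = H.conv (\<lambda>x. \<beta> (f x)) (\<lambda>x. \<alpha> (f x)) x"
      by (rule H.conv_ract[OF af[OF beta]])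
    then show "\<beta> (f (H.ract (\<lambda>x. \<alpha> (f x)) x)) = \<beta> (ract \<alpha> (f x))"
      using that beta by (simp add: conv_ract f_comult H.conv_def)
  qed
  have f_lact: "f (H.lact (\<lambda>x. \<alpha> (f x)) x) = lact \<alpha> (f x)" if "lin s (*) \<alpha>" "x \<in> VH" for \<alpha> x
  proof (rule eq_by_functionals[OF vs])
    fix \<beta> assume beta: "lin s (*) \<beta>"
    have "\<beta> (f (H.lact (\<lambda>x. \<alpha> (f x)) x)) = H.conv (\<lambda>x. \<alpha> (f x)) (\<lambda>x. \<beta> (f x)) x"
      by (rule H.conv_lact[OF af[OF beta]])
    then show "\<beta> (f (H.lact (\<lambda>x. \<alpha> (f x)) x)) = \<beta> (lact \<alpha> (f x))"
      using that beta by (simp add: conv_lact f_comult H.conv_def)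
  qed
  have subspace_fD: "subspace (f ` D)"
    by (rule lin_image_subspace[OF H.vs vs f D'(1)])
  have sub_fD: "sub (f ` D)"
    unfolding sub_def
  proof (intro conjI allI impI)
    fix \<alpha> y assume alpha: "lin s (*) \<alpha>" and "y \<in> f ` D"
    then obtain x where x: "x \<in> D" "y = f x" by blast
    show "lact \<alpha> y \<in> f ` D"
      using D'(3)[OF af[OF alpha] x(1)] f_lact[OF alpha D'(2)[OF x(1)]] x(2) by force
    show "ract \<alpha> y \<in> f ` D"
      using D'(4)[OF af[OF alpha] x(1)] f_ract[OF alpha D'(2)[OF x(1)]] x(2) by force
  qed (use subspace_fD in auto)
  have fin_fD: "findim s (f ` D)"
  proof -
    obtain G where G: "finite G" "D \<subseteq> H.span G" using D(2) by (auto simp: findim_def)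
    have "f x \<in> span (f ` G)" if "x \<in> H.span G" for x
      using that by (induction rule: H.span_induct_alt)
        (simp_all add: lin_0[OF f] lin_add[OF f] lin_scale[OF f] span_zero span_add span_scale span_base)
    then show ?thesis unfolding findim_def using G by (intro exI[of _ "f ` G"]) auto
  qed
  define bads where "bads T \<longleftrightarrow> sub T \<and> T \<subseteq> f ` D \<and> \<not> left_invertible_on T" for T
  have "bads (f ` D)" using bad sub_fD by (simp add: bads_def)
  then have "\<exists>T. bads T \<and> (\<forall>U. bads U \<longrightarrow> dim T \<le> dim U)" by (rule ex_has_least_nat)
  then obtain T where T: "bads T" and T_min: "\<And>U. bads U \<Longrightarrow> dim T \<le> dim U" by blast
  have subT: "sub T" and TD: "T \<subseteq> f ` D" and badT: "\<not> left_invertible_on T" using T by (auto simp: bads_def)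
  note T' = subD[OF subT]
  have finT: "findim s T" by (rule findim_subset[OF fin_fD TD])
  have T0: "T \<noteq> {0}" using badT left_invertible_on_zero by auto
  have "left_invertible_on X" if X: "sub X" "X \<subseteq> T" "X \<noteq> T" for X
  proof (rule ccontr)
    assume "\<not> left_invertible_on X"
    then have "dim T \<le> dim X" using X TD by (intro T_min) (auto simp: bads_def)
    moreover have "dim X < dim T" by (rule dim_strict_mono[OF vs finT subD(1)[OF X(1)]]) (use X in blast)
    ultimately show False by simp
  qed
  then have "wedge_prime T"
    unfolding wedge_prime_def using subT T0 badT left_invertible_on_wedge subD(1) by metis
  then have simple: "Z = T" if "sub Z" "Z \<subseteq> T" "Z \<noteq> {0}" for Z
    using wedge_prime_simple[OF finT _ that] by blast
  have comm: "conv \<alpha> \<beta> t = conv \<beta> \<alpha> t" if "t \<in> T" "lin s (*) \<alpha>" "lin s (*) \<beta>" for \<alpha> \<beta> t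
    using that TD sym by blast
  have lact_eq_ract: "lact \<alpha> t = ract \<alpha> t" if "t \<in> T" "lin s (*) \<alpha>" for \<alpha> t
    by (rule eq_by_functionals[OF vs]) (use that comm in \<open>simp add: conv_lact conv_ract\<close>)
  have e_ract: "e (ract \<alpha> t) = \<alpha> t" if "lin s (*) \<alpha>" for \<alpha> t
    using functional_counit_ract[OF _ that] by simp
  define M where "M \<alpha> \<longleftrightarrow> (\<forall>t\<in>T. \<alpha> t = 0)" for \<alpha> :: "'a \<Rightarrow> 'k"
  have M_ract: "ract \<alpha> t = 0" if "M \<alpha>" "lin s (*) \<alpha>" "t \<in> T" for \<alpha> t
  proof (rule eq_by_functionals[OF vs])
    fix \<psi> assume "lin s (*) \<psi>"
    then show "\<psi> (ract \<alpha> t) = \<psi> 0"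
      using that T'(3)[of \<psi> t] by (simp add: conv_ract M_def lin_0 flip: conv_lact)
  qed
  \<comment> \<open>The kernel of \<open>ract \<alpha>\<close> on T is a subcoalgebra, hence 0 or T
    by simplicity. This is the field property of the dual of T.\<close>
  have ract_inj: "M \<alpha>" if "lin s (*) \<alpha>" "t \<in> T" "t \<noteq> 0" "ract \<alpha> t = 0" for \<alpha> t
  proof -
    let ?Z = "{t\<in>T. ract \<alpha> t = 0}"
    have "sub ?Z"
      unfolding sub_def
    proof (intro conjI allI impI)
      show "subspace ?Z"
        using T'(1) that(1) by (auto simp: subspace_def lin_0[OF lin_ract] lin_add[OF lin_ract] lin_scale[OF lin_ract])
      fix \<phi> x assume phi: "lin s (*) \<phi>" and x: "x \<in> ?Z"
      have "ract \<alpha> (lact \<phi> x) = 0"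
        using x phi that(1) by (simp add: lin_0[OF lin_lact] flip: lact_ract)
      then show "lact \<phi> x \<in> ?Z" using x phi T' by simp
      then show "ract \<phi> x \<in> ?Z" using x phi lact_eq_ract by simp
    qed simp
    then have "?Z = T" by (rule simple) (use that in auto)
    then have "ract \<alpha> u = 0" if "u \<in> T" for u using that by blast
    then show ?thesis using e_ract[OF that(1)] lin_0[OF e] by (metis M_def)
  qed
  define Op where "Op \<alpha> x = H.ract (\<lambda>y. \<alpha> (f y)) x" for \<alpha> x
  have lin_Op: "lin sH sH (Op \<alpha>)" if "lin s (*) \<alpha>" for \<alpha>
    unfolding Op_def by (rule H.lin_ract[OF af[OF that]])
  have Op_D: "Op \<alpha> x \<in> D" if "lin s (*) \<alpha>" "x \<in> D" for \<alpha> x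
    unfolding Op_def by (rule D'(4)[OF af[OF that(1)] that(2)])
  have f_Op: "f (Op \<alpha> x) = ract \<alpha> (f x)" if "lin s (*) \<alpha>" "x \<in> D" for \<alpha> x
    unfolding Op_def using that D' by (intro f_ract) auto
  have Op_Op: "Op \<alpha> (Op \<beta> x) = Op (conv \<alpha> \<beta>) x" if "lin s (*) \<alpha>" "lin s (*) \<beta>" for \<alpha> \<beta> x
  proof -
    have "Op \<alpha> (Op \<beta> x) = H.ract (H.conv (\<lambda>y. \<alpha> (f y)) (\<lambda>y. \<beta> (f y))) x"
      unfolding Op_def by (intro H.ract_ract af that)
    also have "\<dots> = Op (conv \<alpha> \<beta>) x"
      unfolding Op_def by (rule H.ract_cong) (use that f_comult in \<open>simp add: H.conv_def\<close>)
    finally show ?thesis .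
  qed
  have Op_comm: "Op \<alpha> (Op \<beta> x) = Op \<beta> (Op \<alpha> x)" if "lin s (*) \<alpha>" "lin s (*) \<beta>" "x \<in> D" for \<alpha> \<beta> x
    unfolding Op_Op[OF that(1,2)] Op_Op[OF that(2,1)] unfolding Op_def
    by (rule H.ract_cong_sub[OF D(1) that(3)]) (use that sym in \<open>auto intro!: af lin_conv\<close>)
  have Op_e: "Op e x = x" if "x \<in> D" for x
    using H.ract_counit[OF D'(2)[OF that]] H.ract_cong[of "\<lambda>y. e (f y)" eH x] f_counit
    by (simp add: Op_def)
  have Op_minus: "Op (\<lambda>c. \<alpha> c - \<beta> c) x = Op \<alpha> x - Op \<beta> x" for \<alpha> \<beta> x
    by (simp add: Op_def H.ract_minus)
  define Orb where "Orb x = {Op \<alpha> x | \<alpha>. lin s (*) \<alpha>}" for x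
  have Orb_D: "Orb x \<subseteq> D" if "x \<in> D" for x using that Op_D by (auto simp: Orb_def)
  have Orb_subspace: "H.subspace (Orb x)" for x
  proof (rule H.subspaceI)
    show "0 \<in> Orb x"
      unfolding Orb_def using H.ract_zero[of x] lin_zero[OF vector_space_field]
      by (intro CollectI exI[of _ "\<lambda>c. 0"]) (simp add: Op_def)
    fix y z assume "y \<in> Orb x" "z \<in> Orb x"
    then obtain \<alpha> \<beta> where *: "lin s (*) \<alpha>" "lin s (*) \<beta>" "y = Op \<alpha> x" "z = Op \<beta> x" by (auto simp: Orb_def)
    have "y + z = Op (\<lambda>c. \<alpha> c + \<beta> c) x" by (simp add: * Op_def H.ract_plus)
    then show "y + z \<in> Orb x" using lin_plus[OF vector_space_field *(1,2)] unfolding Orb_def by blast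
  next
    fix a y assume "y \<in> Orb x"
    then obtain \<alpha> where *: "lin s (*) \<alpha>" "y = Op \<alpha> x" by (auto simp: Orb_def)
    have "sH a y = Op (\<lambda>c. a * \<alpha> c) x" by (simp add: * Op_def H.ract_times)
    then show "sH a y \<in> Orb x" using lin_times_const[OF *(1)] unfolding Orb_def by blast
  qed
  have Orb_Op: "Orb (Op \<alpha> x) \<subseteq> Orb x" if "lin s (*) \<alpha>" for \<alpha> x
    using that lin_conv unfolding Orb_def by (auto simp: Op_Op)
  define Q where "Q x \<longleftrightarrow> x \<in> D \<and> (\<forall>\<alpha>. lin s (*) \<alpha> \<longrightarrow> \<not> M \<alpha> \<longrightarrow> Op \<alpha> x \<noteq> 0)" for x
  obtain t1 where t1: "t1 \<in> T" "e t1 \<noteq> 0" using functional_counit_nonzero[OF subT T0] by blast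
  have "t1 \<noteq> 0" using t1 lin_0[OF e] by auto
  obtain x1 where x1: "x1 \<in> D" "f x1 = t1" using t1 TD by blast
  \<comment> \<open>\<open>f\<close> carries \<open>Op \<alpha> x1\<close> to
    \<open>ract \<alpha> t1\<close>, which is nonzero for \<alpha> outside \<open>M\<close> by the
    field property.\<close>
  have "Q x1"
    unfolding Q_def using x1 f_Op ract_inj[OF _ t1(1) \<open>t1 \<noteq> 0\<close>] lin_0[OF f] by metis
  then have "\<exists>x. Q x \<and> (\<forall>y. Q y \<longrightarrow> H.dim (Orb x) \<le> H.dim (Orb y))" by (rule ex_has_least_nat)
  then obtain x where Qx: "Q x" and x_min: "\<And>y. Q y \<Longrightarrow> H.dim (Orb x) \<le> H.dim (Orb y)" by blast
  have xD: "x \<in> D" using Qx by (simp add: Q_def)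
  have x_Orb: "x \<in> Orb x" unfolding Orb_def using e Op_e[OF xD] by (intro CollectI exI[of _ e]) simp
  have Orb_eq: "Orb (Op \<alpha> x) = Orb x" if "lin s (*) \<alpha>" "Q (Op \<alpha> x)" for \<alpha>
  proof (rule ccontr)
    assume "Orb (Op \<alpha> x) \<noteq> Orb x"
    with Orb_Op[OF that(1)] have "H.dim (Orb (Op \<alpha> x)) < H.dim (Orb x)"
      by (intro dim_strict_mono[OF H.vs findim_subset[OF D(2) Orb_D[OF xD]] Orb_subspace]) blast
    then show False using x_min[OF that(2)] by simp
  qed
  \<comment> \<open>If \<open>Op \<alpha> x\<close> still has property \<open>Q\<close>, its orbit
    is that of \<open>x\<close>, so x = \<open>Op \<beta> (Op \<alpha> x)\<close>; then \<epsilon> -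
    \<beta> \<alpha>, which is outside \<open>M\<close> because \<alpha> is in it, kills
    \<open>x\<close>, a contradiction. Otherwise some \<sigma> outside \<open>M\<close> kills
    \<open>Op \<alpha> x\<close>; as \<open>M\<close> is prime, \<open>Op \<sigma> x\<close> has
    property \<open>Q\<close>, so \<open>x\<close> is recovered from \<open>Op \<sigma> x\<close>,
    and commuting the operators shows that \<alpha> kills \<open>x\<close>.\<close>
  have x_kill: "Op \<alpha> x = 0" if alpha: "lin s (*) \<alpha>" "M \<alpha>" for \<alpha>
  proof (cases "Q (Op \<alpha> x)")
    case True
    then obtain \<beta> where beta: "lin s (*) \<beta>" "x = Op \<beta> (Op \<alpha> x)"
      using Orb_eq[OF alpha(1)] x_Orb unfolding Orb_def by blast
    let ?s = "\<lambda>c. e c - conv \<beta> \<alpha> c"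
    have "conv \<beta> \<alpha> t1 = 0"
      using M_ract[OF alpha(2,1) t1(1)] beta(1) lin_0[OF beta(1)] by (simp flip: conv_ract)
    then have "\<not> M ?s" using t1 by (auto simp: M_def intro!: bexI[of _ t1])
    moreover have "Op ?s x = 0" using beta alpha xD by (simp add: Op_minus Op_e flip: Op_Op)
    ultimately show ?thesis
      using Qx lin_minus[OF vector_space_field e lin_conv[OF beta(1) alpha(1)]] by (auto simp: Q_def)
  next
    case False
    then obtain \<sigma> where sigma: "lin s (*) \<sigma>" "\<not> M \<sigma>" "Op \<sigma> (Op \<alpha> x) = 0"
      using Op_D[OF alpha(1) xD] by (auto simp: Q_def)
    have "Q (Op \<sigma> x)"
      unfolding Q_def
    proof (intro conjI allI impI)
      show "Op \<sigma> x \<in> D" by (rule Op_D[OF sigma(1) xD])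
      fix \<beta> assume beta: "lin s (*) \<beta>" "\<not> M \<beta>"
      have "ract \<sigma> t1 \<noteq> 0" using ract_inj[OF sigma(1) t1(1) \<open>t1 \<noteq> 0\<close>] sigma(2) by blast
      then have "ract \<beta> (ract \<sigma> t1) \<noteq> 0"
        using ract_inj[OF beta(1) T'(4)[OF sigma(1) t1(1)]] beta(2) by blast
      then have "\<not> M (conv \<beta> \<sigma>)"
        using M_ract[OF _ lin_conv[OF beta(1) sigma(1)] t1(1)] by (auto simp: ract_ract beta sigma)
      then show "Op \<beta> (Op \<sigma> x) \<noteq> 0"
        using Qx lin_conv[OF beta(1) sigma(1)] by (simp add: Q_def Op_Op beta sigma)
    qed
    then obtain \<beta> where beta: "lin s (*) \<beta>" "x = Op \<beta> (Op \<sigma> x)"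
      using Orb_eq[OF sigma(1)] x_Orb unfolding Orb_def by blast
    have "Op \<alpha> x = Op \<alpha> (Op \<beta> (Op \<sigma> x))" using beta(2) by simp
    also have "\<dots> = Op \<beta> (Op \<sigma> (Op \<alpha> x))"
      using Op_comm alpha(1) beta(1) sigma(1) xD Op_D by simp
    also have "\<dots> = 0" using sigma(3) lin_0[OF lin_Op[OF beta(1)]] by simp
    finally show ?thesis .
  qed
  have "\<not> M e" using t1 by (auto simp: M_def)
  then have "x \<noteq> 0" using Qx e Op_e[OF xD] by (auto simp: Q_def)
  then obtain \<phi> where phi: "lin sH (*) \<phi>" "\<phi> x \<noteq> 0" using functional_nonzero[OF H.vs] by blast
  \<comment> \<open>The counit of f(x) could be zero. The action \<open>lact\<close> commutes with
    \<open>Op\<close>, hence preserves annihilation by \<open>M\<close>, and it moves the nonzero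
    value \<phi>(x) into the counit.\<close>
  define y where "y = H.lact \<phi> x"
  have yD: "y \<in> D" unfolding y_def by (rule D'(3)[OF phi(1) xD])
  have y_kill: "Op \<alpha> y = 0" if "lin s (*) \<alpha>" "M \<alpha>" for \<alpha>
  proof -
    have "Op \<alpha> y = H.lact \<phi> (Op \<alpha> x)" unfolding Op_def y_def by (rule H.lact_ract[symmetric, OF phi(1) af[OF that(1)]])
    then show ?thesis using x_kill[OF that] lin_0[OF H.lin_lact[OF phi(1)]] by simp
  qed
  have y_e: "e (f y) \<noteq> 0"
    using H.functional_counit_lact[OF D'(2)[OF xD] phi(1)] phi(2) f_counit[OF D'(2)[OF yD]] by (simp add: y_def)
  define t0 where "t0 = f y"
  \<comment> \<open>T is the common kernel of the functionals in \<open>M\<close>, and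
    \<open>Op\<close> of such a functional kills \<open>y\<close>.\<close>
  have t0: "t0 \<in> T"
  proof (rule ccontr)
    assume "t0 \<notin> T"
    from functional_separates[OF vs T'(1) this] obtain \<alpha>
      where a: "lin s (*) \<alpha>" "\<And>t. t \<in> T \<Longrightarrow> \<alpha> t = 0" "\<alpha> t0 \<noteq> 0" by blast
    then have alpha: "lin s (*) \<alpha>" "M \<alpha>" "\<alpha> t0 \<noteq> 0" by (auto simp: M_def)
    have "f (Op \<alpha> y) = ract \<alpha> t0" using f_Op[OF alpha(1) yD] by (simp add: t0_def)
    then have "\<alpha> t0 = 0" using y_kill[OF alpha(1,2)] e_ract[OF alpha(1), of t0] lin_0[OF f] lin_0[OF e] by simp
    then show False using alpha(3) by simp
  qed
  have t0_nz: "t0 \<noteq> 0" using y_e lin_0[OF e] by (auto simp: t0_def)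
  have "{ract \<alpha> t0 | \<alpha>. lin s (*) \<alpha>} = T" (is "?R = T")
  proof (rule simple)
    show "?R \<subseteq> T" using T'(4) t0 by auto
    have "ract e t0 \<in> ?R" using e by blast
    then show "?R \<noteq> {0}" using t0_nz by (auto simp: ract_counit)
    have "ract \<alpha> t0 = f (Op \<alpha> y)" if "lin s (*) \<alpha>" for \<alpha>
      using f_Op[OF that yD] by (simp add: t0_def)
    then have "?R = f ` Orb y"
      unfolding Orb_def setcompr_eq_image image_image by (intro image_cong) auto
    then have "subspace ?R" using lin_image_subspace[OF H.vs vs f Orb_subspace] by simp
    then show "sub ?R"
      unfolding sub_def
    proof (intro conjI allI impI)
      fix \<beta> u assume beta: "lin s (*) \<beta>" and u: "u \<in> ?R"
      then obtain \<alpha> where alpha: "lin s (*) \<alpha>" "u = ract \<alpha> t0" by blast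
      have "ract \<beta> u = ract (conv \<beta> \<alpha>) t0" using alpha beta by (simp add: ract_ract)
      then show "ract \<beta> u \<in> ?R" using lin_conv[OF beta alpha(1)] by blast
      moreover have "lact \<beta> u = ract \<beta> u" using u \<open>?R \<subseteq> T\<close> lact_eq_ract[OF _ beta] by blast
      ultimately show "lact \<beta> u \<in> ?R" by simp
    qed auto
  qed
  then have "\<forall>t\<in>T. \<exists>\<alpha>. lin s (*) \<alpha> \<and> ract \<alpha> t0 = t" by blast
  then obtain A where A: "\<And>t. t \<in> T \<Longrightarrow> lin s (*) (A t) \<and> ract (A t) t0 = t" by metis
  \<comment> \<open>Two functionals taking \<open>t0\<close> to t differ by one that annihilates
    \<open>t0\<close>. By the field property it lies in \<open>M\<close>, so it kills
    \<open>y\<close>, and \<open>\<tau>\<close> below is well defined.\<close>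
  have A_eq: "Op (A t) y = Op \<alpha> y" if "t \<in> T" "lin s (*) \<alpha>" "ract \<alpha> t0 = t" for t \<alpha>
  proof -
    have l: "lin s (*) (\<lambda>c. A t c - \<alpha> c)" using A that by (intro lin_minus vector_space_field) auto
    moreover have "ract (\<lambda>c. A t c - \<alpha> c) t0 = 0" using A that by (simp add: ract_minus)
    ultimately have "Op (\<lambda>c. A t c - \<alpha> c) y = 0" using y_kill ract_inj t0 t0_nz by blast
    then show ?thesis by (simp add: Op_minus)
  qed
  obtain R where R: "lin s s R" "\<And>x. R x \<in> T" "\<And>x. x \<in> T \<Longrightarrow> R x = x"
    using subspace_projection[OF vs T'(1)] by metis
  define \<tau> where "\<tau> t = Op (A (R t)) y" for t
  have tau: "\<tau> t = Op \<alpha> y" if "t \<in> T" "lin s (*) \<alpha>" "ract \<alpha> t0 = t" for t \<alpha>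
    using A_eq[OF that] R(3)[OF that(1)] by (simp add: \<tau>_def)
  have lin_tau: "lin s sH \<tau>"
  proof (rule linI)
    fix t u
    have "Op (A (R t + R u)) y = Op (\<lambda>c. A (R t) c + A (R u) c) y"
      using A R(2) T'(1) by (intro A_eq lin_plus vector_space_field) (auto simp: ract_plus subspace_add)
    then show "\<tau> (t + u) = \<tau> t + \<tau> u"
      by (simp add: \<tau>_def lin_add[OF R(1)]) (simp add: Op_def H.ract_plus)
  next
    fix a t
    have "Op (A (s a (R t))) y = Op (\<lambda>c. a * A (R t) c) y"
      using A R(2) T'(1) by (intro A_eq lin_times_const) (auto simp: ract_times subspace_scale)
    then show "\<tau> (s a t) = sH a (\<tau> t)"
      by (simp add: \<tau>_def lin_scale[OF R(1)]) (simp add: Op_def H.ract_times)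
  qed
  have "sw d t (\<lambda>a b. g (\<tau> a) * b) = s (e t) 1" if t: "t \<in> T" for t
  proof -
    obtain \<alpha> where alpha: "lin s (*) \<alpha>" "ract \<alpha> t0 = t" using A[OF t] by blast
    have tau_t: "\<tau> t = Op \<alpha> y" by (rule tau[OF t alpha])
    \<comment> \<open>Colinearity of \<open>\<tau>\<close>: for x = \<tau>(t) the tensors
      \<tau>(t_1) \<otimes> t_2 and x_1 \<otimes> f(x_2) agree, as is seen by contracting the second
      factor with \<chi>.\<close>
    have "sw d t (\<lambda>a b. g (\<tau> a) * b) = sw dH (\<tau> t) (\<lambda>a b. g a * f b)"
      unfolding sw_def
    proof (rule bilinear_sum_eq[OF H.vs vs bil_mult[OF g lin_id]])
      fix \<chi> assume chi: "lin s (*) \<chi>"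
      have "(\<Sum>p\<leftarrow>d t. sH (\<chi> (snd p)) (\<tau> (fst p))) = \<tau> (ract \<chi> t)"
        by (simp add: ract_def sw_def lin_sum_list[OF lin_tau] lin_scale[OF lin_tau])
      also have "\<dots> = Op (conv \<chi> \<alpha>) y"
        using alpha chi t T' by (intro tau lin_conv) (auto simp: ract_ract[symmetric])
      also have "\<dots> = Op \<chi> (\<tau> t)" using alpha chi by (simp add: tau_t Op_Op)
      finally show "(\<Sum>p\<leftarrow>d t. sH (\<chi> (snd p)) (\<tau> (fst p))) = (\<Sum>p\<leftarrow>dH (\<tau> t). sH (\<chi> (f (snd p))) (fst p))"
        by (simp add: Op_def H.ract_def sw_def)
    qed
    also have "\<dots> = s (eH (\<tau> t)) 1" using Op_D[OF alpha(1) yD] by (intro gf) (simp add: tau_t)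
    also have "eH (\<tau> t) = e t"
      using Op_D[OF alpha(1) yD] D'(2) f_counit f_Op[OF alpha(1) yD] alpha(2) by (simp add: tau_t t0_def[symmetric] flip: f_counit)
    finally show ?thesis .
  qed
  then have "left_invertible_on T"
    unfolding left_invertible_on_def using lin_comp[OF g lin_tau] by blast
  then show False using badT by blast
qed

end

section \<open>Tensor products of coalgebras\<close>

text \<open>Elementary tensors depend only on the scalar multiplications, because the model tests
  against bilinear forms on the ambient spaces. One function thus serves all carriers.\<close>

definition tn :: "('k::field \<Rightarrow> 'v::ab_group_add \<Rightarrow> 'v) \<Rightarrow> ('k \<Rightarrow> 'w::ab_group_add \<Rightarrow> 'w) \<Rightarrow>
    'v \<Rightarrow> 'w \<Rightarrow> ('k, 'v, 'w) tensor" where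
  "tn s t v w = Tensor (\<lambda>\<beta>. if bil s t (*) \<beta> then \<beta> v w else 0)"

lemma tens_eq_tn: "tens V W = tn (vscale V) (vscale W)"
  by (simp add: fun_eq_iff tens_def tn_def bilinear_map_def linear_map_def base_field_def bil_def lin_def)

lemma tensor_app_tn: "bil s t (*) \<beta> \<Longrightarrow> tensor_app (tn s t v w) \<beta> = \<beta> v w"
  by (simp add: tn_def Tensor_inverse)

lemma lin_tensor_app: "lin tscale (*) (\<lambda>x. tensor_app x \<beta>)"
  by (rule linI) (simp_all add: plus_tensor.rep_eq tscale.rep_eq)

lemma bil_tn: "bil s t tscale (tn s t)"
  by (intro bilI linI; rule tensor_app_inject[THEN iffD1], rule ext)
    (auto simp: tn_def Tensor_inverse plus_tensor.rep_eq tscale.rep_eq bil_def lin_def)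

definition tspace :: "('k::field \<Rightarrow> 'v::ab_group_add \<Rightarrow> 'v) \<Rightarrow> ('k \<Rightarrow> 'w::ab_group_add \<Rightarrow> 'w) \<Rightarrow>
    'v set \<Rightarrow> 'w set \<Rightarrow> ('k, 'v, 'w) tensor set" where
  "tspace s t V W = module.span tscale {tn s t v w | v w. v \<in> V \<and> w \<in> W}"

lemma vspace_tensor_space: "vspace (tensor_space V W) = tspace (vscale V) (vscale W) (vspace V) (vspace W)"
  by (simp add: tensor_space_def tspace_def tens_eq_tn)

lemma tspace_subspace: "module.subspace tscale (tspace s t V W)"
  unfolding tspace_def by (intro module.subspace_span) (simp add: module_iff_vector_space vector_space_tscale)

lemma tn_in_tspace: "v \<in> V \<Longrightarrow> w \<in> W \<Longrightarrow> tn s t v w \<in> tspace s t V W"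
  unfolding tspace_def by (intro module.span_base) (auto simp: module_iff_vector_space vector_space_tscale)

lemma tspace_list:
  assumes "module.subspace s V" "vector_space s" "x \<in> tspace s t V W"
  shows "\<exists>l. (\<forall>p\<in>set l. fst p \<in> V \<and> snd p \<in> W) \<and> x = (\<Sum>p\<leftarrow>l. tn s t (fst p) (snd p))"
proof -
  interpret T: vector_space "tscale :: 'a \<Rightarrow> ('a, 'b, 'c) tensor \<Rightarrow> _" by (rule vector_space_tscale)
  interpret s: vector_space s by fact
  have "x \<in> T.span {tn s t v w | v w. v \<in> V \<and> w \<in> W}" using assms(3) by (simp add: tspace_def)
  then show ?thesis
  proof (induction rule: T.span_induct_alt)
    case base
    show ?case by (intro exI[of _ "[]"]) simp
  next
    case (step c x y)
    then obtain l v w where "\<forall>p\<in>set l. fst p \<in> V \<and> snd p \<in> W" "y = (\<Sum>p\<leftarrow>l. tn s t (fst p) (snd p))"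
      "x = tn s t v w" "v \<in> V" "w \<in> W" by auto
    then show ?case
      using assms(1)
      by (intro exI[of _ "(s c v, w) # l"]) (auto simp: s.subspace_scale lin_scale[OF bil1[OF bil_tn]])
  qed
qed

lemma tspace_lin_eq:
  assumes "vector_space s" "module.subspace s V" and f: "lin tscale u f" and g: "lin tscale u g"
    and "\<And>v w. v \<in> V \<Longrightarrow> w \<in> W \<Longrightarrow> f (tn s t v w) = g (tn s t v w)" and x: "x \<in> tspace s t V W"
  shows "f x = g x"
proof -
  obtain l where l: "\<forall>p\<in>set l. fst p \<in> V \<and> snd p \<in> W" "x = (\<Sum>p\<leftarrow>l. tn s t (fst p) (snd p))"
    using tspace_list[OF assms(2,1) x] by blast
  show ?thesis
    unfolding l(2) lin_sum_list[OF f] lin_sum_list[OF g]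
    by (intro arg_cong[of _ _ sum_list] map_cong refl) (use l(1) assms(5) in auto)
qed

lemma findim_tspace:
  assumes s: "vector_space s" and t: "vector_space t" and V: "findim s V" and W: "findim t W"
  shows "findim tscale (tspace s t V W)"
proof -
  interpret T: vector_space "tscale :: 'a \<Rightarrow> ('a, 'b, 'c) tensor \<Rightarrow> _" by (rule vector_space_tscale)
  interpret s: vector_space s by fact
  interpret t: vector_space t by fact
  obtain G where G: "finite G" "V \<subseteq> s.span G" using V by (auto simp: findim_def)
  obtain K where K: "finite K" "W \<subseteq> t.span K" using W by (auto simp: findim_def)
  let ?X = "(\<lambda>(v, w). tn s t v w) ` (G \<times> K)"
  have 1: "tn s t v w \<in> T.span ?X" if "v \<in> G" "w \<in> t.span K" for v w
    using that(2)
  proof (induction rule: t.span_induct_alt)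
    case base
    show ?case unfolding lin_0[OF bil2[OF bil_tn]] by (rule T.span_zero)
  next
    case (step c x y)
    then have "tn s t v x \<in> T.span ?X" using that(1) by (intro T.span_base) auto
    with step show ?case
      unfolding lin_add[OF bil2[OF bil_tn]] lin_scale[OF bil2[OF bil_tn]]
      by (intro T.span_add T.span_scale)
  qed
  have 2: "tn s t v w \<in> T.span ?X" if "v \<in> s.span G" "w \<in> t.span K" for v w
    using that(1)
  proof (induction rule: s.span_induct_alt)
    case base
    show ?case unfolding lin_0[OF bil1[OF bil_tn]] by (rule T.span_zero)
  next
    case (step c x y)
    then show ?case
      unfolding lin_add[OF bil1[OF bil_tn]] lin_scale[OF bil1[OF bil_tn]]
      using 1[OF step(1) that(2)] by (intro T.span_add T.span_scale)
  qed
  have "{tn s t v w | v w. v \<in> V \<and> w \<in> W} \<subseteq> T.span ?X" using 2 G(2) K(2) by blast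
  then have "tspace s t V W \<subseteq> T.span ?X"
    unfolding tspace_def by (rule T.span_minimal[OF _ T.subspace_span])
  moreover have "finite ?X" using G K by simp
  ultimately show ?thesis unfolding findim_def by blast
qed

locale tensor_coal = B: coal sB VB PB dB eB + C: coal sC VC PC dC eC
  for sB :: "'k::field \<Rightarrow> 'b::ab_group_add \<Rightarrow> 'b" and VB PB dB eB
    and sC :: "'k \<Rightarrow> 'c::ab_group_add \<Rightarrow> 'c" and VC PC dC eC
begin

abbreviation bc :: "'b \<Rightarrow> 'c \<Rightarrow> ('k, 'b, 'c) tensor" where
  "bc \<equiv> tn sB sC"

abbreviation VT :: "('k, 'b, 'c) tensor set" where
  "VT \<equiv> tspace sB sC VB VC"

definition PT :: "('k, 'b, 'c) tensor \<Rightarrow> ('k, 'b, 'c) tensor" where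
  "PT = (SOME Q. lin tscale tscale Q \<and> (\<forall>x. Q x \<in> VT) \<and> (\<forall>x\<in>VT. Q x = x))"

definition lT :: "('k, 'b, 'c) tensor \<Rightarrow> ('b \<times> 'c) list" where
  "lT x = (SOME l. (\<forall>p\<in>set l. fst p \<in> VB \<and> snd p \<in> VC) \<and> PT x = (\<Sum>p\<leftarrow>l. bc (fst p) (snd p)))"

definition dT :: "('k, 'b, 'c) tensor \<Rightarrow> (('k, 'b, 'c) tensor \<times> ('k, 'b, 'c) tensor) list" where
  "dT x = concat (map (\<lambda>p. concat (map (\<lambda>q. map (\<lambda>r. (bc (fst q) (fst r), bc (snd q) (snd r)))
     (dC (snd p))) (dB (fst p)))) (lT x))"

definition eT :: "('k, 'b, 'c) tensor \<Rightarrow> 'k" where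
  "eT x = tensor_app x (\<lambda>b c. eB b * eC c)"

lemma PT: "lin tscale tscale PT" "PT x \<in> VT" "x \<in> VT \<Longrightarrow> PT x = x"
proof -
  have "\<exists>Q :: ('k, 'b, 'c) tensor \<Rightarrow> _. lin tscale tscale Q \<and> (\<forall>x. Q x \<in> VT) \<and> (\<forall>x\<in>VT. Q x = x)"
    using subspace_projection[OF vector_space_tscale tspace_subspace] by metis
  from someI_ex[OF this]
  show "lin tscale tscale PT" "PT x \<in> VT" "x \<in> VT \<Longrightarrow> PT x = x" unfolding PT_def by blast+
qed

lemma lT: "p \<in> set (lT x) \<Longrightarrow> fst p \<in> VB \<and> snd p \<in> VC" "PT x = (\<Sum>p\<leftarrow>lT x. bc (fst p) (snd p))"
  using someI_ex[OF tspace_list[OF B.V B.vs PT(2)]] unfolding lT_def by blast+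

lemma sum_list_concat_map: "(\<Sum>p\<leftarrow>concat (map F l). f p) = (\<Sum>q\<leftarrow>l. \<Sum>p\<leftarrow>F q. (f p :: 'u::comm_monoid_add))"
  by (induction l) simp_all

lemma sw_dT_list: "sw dT x m = (\<Sum>p\<leftarrow>lT x. sw dB (fst p) (\<lambda>b1 b2. sw dC (snd p) (\<lambda>c1 c2. m (bc b1 c1) (bc b2 c2))))"
  for m :: "_ \<Rightarrow> _ \<Rightarrow> 'u::ab_group_add"
  by (simp add: sw_def dT_def sum_list_concat_map o_def)

lemma bil_sw_sw:
  assumes u: "vector_space u" and m: "bil tscale tscale u m"
  shows "bil sB sC u (\<lambda>b c. sw dB b (\<lambda>b1 b2. sw dC c (\<lambda>c1 c2. m (bc b1 c1) (bc b2 c2))))"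
proof -
  have 1: "lin sB u (\<lambda>b. m (bc b c) t)" "lin sB u (\<lambda>b. m t (bc b c))"
    "lin sC u (\<lambda>c. m (bc b c) t)" "lin sC u (\<lambda>c. m t (bc b c))" for b c t
    by (intro lin_comp[OF bil1[OF m]] lin_comp[OF bil2[OF m]] bil1[OF bil_tn] bil2[OF bil_tn])+
  show ?thesis
    by (intro bilI B.lin_sw C.lin_sw lin_sw_param u 1)
qed

text \<open>The right-hand side sees x only through \<open>PT x\<close>, so the lists chosen in
  \<open>lT\<close> and \<open>dT\<close> are immaterial for bilinear \<open>m\<close>, and
  linearity in x follows.\<close>

lemma sw_dT_form:
  assumes m: "bil tscale tscale (*) m"
  shows "sw dT x m = tensor_app (PT x) (\<lambda>b c. sw dB b (\<lambda>b1 b2. sw dC c (\<lambda>c1 c2. m (bc b1 c1) (bc b2 c2))))"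
  by (simp add: lT(2) sw_dT_list lin_sum_list[OF lin_tensor_app] tensor_app_tn[OF bil_sw_sw[OF vector_space_field m]])

lemma sw_dT_bc_form:
  assumes m: "bil tscale tscale (*) m" and "b \<in> VB" "c \<in> VC"
  shows "sw dT (bc b c) m = sw dB b (\<lambda>b1 b2. sw dC c (\<lambda>c1 c2. m (bc b1 c1) (bc b2 c2)))"
  using assms by (simp add: sw_dT_form PT tn_in_tspace tensor_app_tn[OF bil_sw_sw[OF vector_space_field m]])

lemma bil_eT: "bil sB sC (*) (\<lambda>b c. eB b * eC c)"
  by (intro bilI lin_times_const lin_times_var B.e C.e)

lemma eT_bc: "eT (bc b c) = eB b * eC c"
  by (simp add: eT_def tensor_app_tn[OF bil_eT])

sublocale T: coal tscale VT PT dT eT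
proof
  show "lin tscale (*) (\<lambda>c. sw dT c m)" if m: "bil tscale tscale (*) m" for m
    unfolding sw_dT_form[OF m] by (intro lin_comp[OF lin_tensor_app PT(1)])
  show "sw dT (PT x) m = sw dT x m" if m: "bil tscale tscale (*) m" for m x
    unfolding sw_dT_form[OF m] by (simp add: PT)
  show "lin tscale (*) eT" unfolding eT_def by (rule lin_tensor_app)
  show "fst p \<in> VT \<and> snd p \<in> VT" if "p \<in> set (dT x)" for x p
    using that B.d_in C.d_in by (fastforce simp: dT_def intro: tn_in_tspace)
next
  fix m :: "('k, 'b, 'c) tensor \<Rightarrow> ('k, 'b, 'c) tensor \<Rightarrow> ('k, 'b, 'c) tensor \<Rightarrow> 'k" and x
  assume m: "tril tscale tscale tscale (*) m"
  have m1: "bil tscale tscale (*) (\<lambda>x y. m x y z)" and m2: "bil tscale tscale (*) (m z)" for z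
    using m by (simp_all add: tril_def bil_def)
  have l: "lin sC (*) (\<lambda>c. m (bc b c) y z)" "lin sC (*) (\<lambda>c. m y (bc b c) z)" "lin sC (*) (\<lambda>c. m y z (bc b c))"
    "lin sB (*) (\<lambda>b. m (bc b c) y z)" "lin sB (*) (\<lambda>b. m y (bc b c) z)" "lin sB (*) (\<lambda>b. m y z (bc b c))" for b c y z
    using m unfolding tril_def
    by (auto intro!: lin_comp[of tscale "(*)" _ sC "\<lambda>c. bc b c"] lin_comp[of tscale "(*)" _ sB "\<lambda>b. bc b c"]
        bil1[OF bil_tn] bil2[OF bil_tn])
  \<comment> \<open>The sums over B and over C are interchanged so that the coassociativity of each
    factor can be applied separately.\<close>
  have G: "sw dB b (\<lambda>b1 b2. sw dC c (\<lambda>c1 c2. sw dB b1 (\<lambda>x y. sw dC c1 (\<lambda>u v. m (bc x u) (bc y v) (bc b2 c2)))))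
      = sw dB b (\<lambda>b1 b2. sw dC c (\<lambda>c1 c2. sw dB b2 (\<lambda>x y. sw dC c2 (\<lambda>u v. m (bc b1 c1) (bc x u) (bc y v)))))" for b c
  proof -
    have "sw dB b (\<lambda>b1 b2. sw dC c (\<lambda>c1 c2. sw dB b1 (\<lambda>x y. sw dC c1 (\<lambda>u v. m (bc x u) (bc y v) (bc b2 c2)))))
        = sw dB b (\<lambda>b1 b2. sw dB b1 (\<lambda>x y. sw dC c (\<lambda>c1 c2. sw dC c1 (\<lambda>u v. m (bc x u) (bc y v) (bc b2 c2)))))"
      by (subst (2) sw_swap) (rule refl)
    also have "\<dots> = sw dB b (\<lambda>b1 b2. sw dB b1 (\<lambda>x y. sw dC c (\<lambda>c1 c2. sw dC c2 (\<lambda>u v. m (bc x c1) (bc y u) (bc b2 v)))))"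
      by (subst C.coassoc[OF vector_space_field]) (intro trilI l refl)+
    also have "\<dots> = sw dB b (\<lambda>b1 b2. sw dB b2 (\<lambda>x y. sw dC c (\<lambda>c1 c2. sw dC c2 (\<lambda>u v. m (bc b1 c1) (bc x u) (bc y v)))))"
      by (rule B.coassoc[OF vector_space_field]) (intro trilI lin_sw_param vector_space_field l)
    also have "\<dots> = sw dB b (\<lambda>b1 b2. sw dC c (\<lambda>c1 c2. sw dB b2 (\<lambda>x y. sw dC c2 (\<lambda>u v. m (bc b1 c1) (bc x u) (bc y v)))))"
      by (subst (2) sw_swap) (rule refl)
    finally show ?thesis .
  qed
  have 1: "sw dB b (\<lambda>b1 b2. sw dC c (\<lambda>c1 c2. sw dT (bc b1 c1) (\<lambda>a1 a2. m a1 a2 (bc b2 c2))))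
      = sw dB b (\<lambda>b1 b2. sw dC c (\<lambda>c1 c2. sw dB b1 (\<lambda>x y. sw dC c1 (\<lambda>u v. m (bc x u) (bc y v) (bc b2 c2)))))" for b c
    by (intro B.sw_cong C.sw_cong sw_dT_bc_form m1)
  have 2: "sw dB b (\<lambda>b1 b2. sw dC c (\<lambda>c1 c2. sw dT (bc b2 c2) (m (bc b1 c1))))
      = sw dB b (\<lambda>b1 b2. sw dC c (\<lambda>c1 c2. sw dB b2 (\<lambda>x y. sw dC c2 (\<lambda>u v. m (bc b1 c1) (bc x u) (bc y v)))))" for b c
    by (intro B.sw_cong C.sw_cong sw_dT_bc_form m2)
  show "sw dT x (\<lambda>a b. sw dT a (\<lambda>a1 a2. m a1 a2 b)) = sw dT x (\<lambda>a b. sw dT b (m a))"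
    unfolding sw_dT_list[of x] 1 2 G ..
next
  fix x assume x: "x \<in> VT"
  show "sw dT x (\<lambda>a b. tscale (eT a) b) = x"
  proof (rule eq_by_functionals[OF vector_space_tscale])
    fix \<phi> :: "('k, 'b, 'c) tensor \<Rightarrow> 'k" assume phi: "lin tscale (*) \<phi>"
    have l: "lin sC (*) (\<lambda>c. \<phi> (bc b c))" "lin sB (*) (\<lambda>b. \<phi> (bc b c))" for b c
      by (intro lin_comp[OF phi] bil1[OF bil_tn] bil2[OF bil_tn])+
    have "sw dB b (\<lambda>b1 b2. sw dC c (\<lambda>c1 c2. eB b1 * eC c1 * \<phi> (bc b2 c2))) = \<phi> (bc b c)"
      if "b \<in> VB" "c \<in> VC" for b c
    proof -
      have "sw dB b (\<lambda>b1 b2. sw dC c (\<lambda>c1 c2. eB b1 * eC c1 * \<phi> (bc b2 c2)))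
          = sw dB b (\<lambda>b1 b2. eB b1 * \<phi> (bc b2 c))"
        by (simp add: mult.assoc C.counit_left_lin[OF l(1) that(2)] flip: sw_times_left)
      then show ?thesis by (simp add: B.counit_left_lin[OF l(2) that(1)])
    qed
    then have "sw dT x (\<lambda>a b. eT a * \<phi> b) = (\<Sum>p\<leftarrow>lT x. \<phi> (bc (fst p) (snd p)))"
      using lT(1)[of _ x] by (simp add: sw_dT_list eT_bc cong: map_cong)
    also have "\<dots> = \<phi> x" using lT(2)[of x] by (simp add: PT(3)[OF x] lin_sum_list[OF phi, symmetric])
    finally show "\<phi> (sw dT x (\<lambda>a b. tscale (eT a) b)) = \<phi> x"
      by (simp add: lin_sw_right[OF phi] lin_scale[OF phi])
  qed
  show "sw dT x (\<lambda>a b. tscale (eT b) a) = x"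
  proof (rule eq_by_functionals[OF vector_space_tscale])
    fix \<phi> :: "('k, 'b, 'c) tensor \<Rightarrow> 'k" assume phi: "lin tscale (*) \<phi>"
    have l: "lin sC (*) (\<lambda>c. \<phi> (bc b c))" "lin sB (*) (\<lambda>b. \<phi> (bc b c))" for b c
      by (intro lin_comp[OF phi] bil1[OF bil_tn] bil2[OF bil_tn])+
    have "sw dB b (\<lambda>b1 b2. sw dC c (\<lambda>c1 c2. eB b2 * eC c2 * \<phi> (bc b1 c1))) = \<phi> (bc b c)"
      if "b \<in> VB" "c \<in> VC" for b c
    proof -
      have "sw dB b (\<lambda>b1 b2. sw dC c (\<lambda>c1 c2. eB b2 * eC c2 * \<phi> (bc b1 c1)))
          = sw dB b (\<lambda>b1 b2. eB b2 * \<phi> (bc b1 c))"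
        by (simp add: mult.assoc C.counit_right_lin[OF l(1) that(2)] flip: sw_times_left)
      then show ?thesis by (simp add: B.counit_right_lin[OF l(2) that(1)])
    qed
    then have "sw dT x (\<lambda>a b. eT b * \<phi> a) = (\<Sum>p\<leftarrow>lT x. \<phi> (bc (fst p) (snd p)))"
      using lT(1)[of _ x] by (simp add: sw_dT_list eT_bc cong: map_cong)
    also have "\<dots> = \<phi> x" using lT(2)[of x] by (simp add: PT(3)[OF x] lin_sum_list[OF phi, symmetric])
    finally show "\<phi> (sw dT x (\<lambda>a b. tscale (eT b) a)) = \<phi> x"
      by (simp add: lin_sw_right[OF phi] lin_scale[OF phi])
  qed
qed (simp_all add: PT vector_space_simps[OF vector_space_tscale] tspace_subspace)

lemma sw_dT_bc:
  assumes u: "vector_space u" and m: "bil tscale tscale u m" and bc: "b \<in> VB" "c \<in> VC"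
  shows "sw dT (bc b c) m = sw dB b (\<lambda>b1 b2. sw dC c (\<lambda>c1 c2. m (bc b1 c1) (bc b2 c2)))"
proof (rule eq_by_functionals[OF u])
  fix \<phi> assume phi: "lin u (*) \<phi>"
  have "bil tscale tscale (*) (\<lambda>a b. \<phi> (m a b))"
    by (intro bilI lin_comp[OF phi] bil1[OF m] bil2[OF m])
  from sw_dT_bc_form[OF this bc] show "\<phi> (sw dT (bc b c) m) = \<phi> (sw dB b (\<lambda>b1 b2. sw dC c (\<lambda>c1 c2. m (bc b1 c1) (bc b2 c2))))"
    by (simp add: lin_sw_right[OF phi])
qed

text \<open>Projections onto \<open>E\<close> and \<open>F\<close> may be inserted in all four
  factors of the coproduct of b \<otimes> c; afterwards every term of a contraction is visibly in E
  \<otimes> F.\<close>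

lemma sub_tspace:
  assumes E: "B.sub E" and F: "C.sub F"
  shows "T.sub (tspace sB sC E F)"
proof -
  note E' = B.subD[OF E]
  note F' = C.subD[OF F]
  obtain Q where Q: "lin sB sB Q" "\<And>x. Q x \<in> E" "\<And>x. x \<in> E \<Longrightarrow> Q x = x"
    using subspace_projection[OF B.vs E'(1)] by metis
  obtain R where R: "lin sC sC R" "\<And>x. R x \<in> F" "\<And>x. x \<in> F \<Longrightarrow> R x = x"
    using subspace_projection[OF C.vs F'(1)] by metis
  have sw_sw_in: "sw dB b (\<lambda>b1 b2. sw dC c (\<lambda>c1 c2. tscale (\<phi> b1 b2 c1 c2) (bc (Q (\<beta> b1 b2)) (R (\<gamma> c1 c2)))))
      \<in> tspace sB sC E F" for \<phi> \<beta> \<gamma> b c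
    unfolding sw_def using tspace_subspace Q R
    by (intro T.sum_list_in_subspace T.subspace_scale tn_in_tspace) auto
  show ?thesis
    unfolding tspace_def[of sB sC E F]
  proof (rule T.sub_span)
    show "{bc v w | v w. v \<in> E \<and> w \<in> F} \<subseteq> VT"
      using E'(2) F'(2) by (auto intro: tn_in_tspace)
    fix \<phi> :: "('k, 'b, 'c) tensor \<Rightarrow> 'k" and y assume phi: "lin tscale (*) \<phi>" and "y \<in> {bc v w | v w. v \<in> E \<and> w \<in> F}"
    then obtain b c where y: "y = bc b c" "b \<in> E" "c \<in> F" by blast
    have *: "sw dT y m = sw dB b (\<lambda>b1 b2. sw dC c (\<lambda>c1 c2. m (bc (Q b1) (R c1)) (bc (Q b2) (R c2))))"
      if m: "bil tscale tscale tscale m" for m :: "_ \<Rightarrow> _ \<Rightarrow> ('k, 'b, 'c) tensor"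
    proof -
      have 1: "lin sB tscale (\<lambda>b. m (bc b c) t)" "lin sB tscale (\<lambda>b. m t (bc b c))"
        "lin sC tscale (\<lambda>c. m (bc b c) t)" "lin sC tscale (\<lambda>c. m t (bc b c))" for b c t
        by (intro lin_comp[OF bil1[OF m]] lin_comp[OF bil2[OF m]] bil1[OF bil_tn] bil2[OF bil_tn])+
      have inner: "sw dC c (\<lambda>c1 c2. m (bc b1 c1) (bc b2 c2)) = sw dC c (\<lambda>c1 c2. m (bc b1 (R c1)) (bc b2 (R c2)))" for b1 b2
        by (rule C.sw_project[OF R(1,3) vector_space_tscale _ F y(3), symmetric]) (assumption | intro bilI 1)+
      have "sw dT y m = sw dB b (\<lambda>b1 b2. sw dC c (\<lambda>c1 c2. m (bc b1 c1) (bc b2 c2)))"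
        unfolding y(1) by (rule sw_dT_bc[OF vector_space_tscale m]) (use y E' F' in auto)
      also have "\<dots> = sw dB b (\<lambda>b1 b2. sw dC c (\<lambda>c1 c2. m (bc b1 (R c1)) (bc b2 (R c2))))"
        by (simp only: inner)
      also have "\<dots> = sw dB b (\<lambda>b1 b2. sw dC c (\<lambda>c1 c2. m (bc (Q b1) (R c1)) (bc (Q b2) (R c2))))"
        by (rule B.sw_project[OF Q(1,3) vector_space_tscale _ E y(2), symmetric])
          (assumption | intro bilI lin_sw_param vector_space_tscale 1)+
      finally show ?thesis .
    qed
    have "T.lact \<phi> y \<in> tspace sB sC E F"
      unfolding T.lact_def by (subst *) (auto intro!: T.bil_lact phi lin_id vector_space_tscale sw_sw_in Q R)
    moreover have "T.ract \<phi> y \<in> tspace sB sC E F"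
      unfolding T.ract_def by (subst *) (auto intro!: T.bil_ract phi lin_id vector_space_tscale sw_sw_in Q R)
    ultimately show "T.lact \<phi> y \<in> T.span {bc v w |v w. v \<in> E \<and> w \<in> F} \<and> T.ract \<phi> y \<in> T.span {bc v w |v w. v \<in> E \<and> w \<in> F}"
      by (simp add: tspace_def)
  qed
qed

end

section \<open>Coverings\<close>

text \<open>The covering enters through the bilinear map \<open>h\<close> on elementary tensors, so
  that the exchange identity can be proved on pairs. Surjectivity is added in
  \<open>antipode_exists\<close>.\<close>

locale covering_data = A: alg_coal sA dA eA + B: alg_coal sB dB eB + C: coal sC VC PC dC eC
  for sA :: "'k::field \<Rightarrow> 'a::ring_1 \<Rightarrow> 'a" and dA eA
    and sB :: "'k \<Rightarrow> 'b::ring_1 \<Rightarrow> 'b" and dB eB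
    and sC :: "'k \<Rightarrow> 'c::ab_group_add \<Rightarrow> 'c" and VC PC dC eC +
  fixes h :: "'b \<Rightarrow> 'c \<Rightarrow> 'a" and S :: "'b \<Rightarrow> 'b"
  assumes h: "bil sB sC sA h"
    and h_mult: "\<And>b b' c. h (b * b') c = sw dC c (\<lambda>c1 c2. h b c1 * h b' c2)"
    and h_one: "\<And>c. c \<in> VC \<Longrightarrow> h 1 c = sA (eC c) 1"
    and h_comult: "\<And>b c m. bil sA sA (*) m \<Longrightarrow>
      sw dA (h b c) m = sw dB b (\<lambda>b1 b2. sw dC c (\<lambda>c1 c2. m (h b1 c1) (h b2 c2)))"
    and h_counit: "\<And>b c. c \<in> VC \<Longrightarrow> eA (h b c) = eB b * eC c"
    and A_mult: "\<And>x y m. bil sA sA (*) m \<Longrightarrow>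
      sw dA (x * y) m = sw dA x (\<lambda>x1 x2. sw dA y (\<lambda>y1 y2. m (x1 * y1) (x2 * y2)))"
    and B_mult: "\<And>x y m. bil sB sB (*) m \<Longrightarrow>
      sw dB (x * y) m = sw dB x (\<lambda>x1 x2. sw dB y (\<lambda>y1 y2. m (x1 * y1) (x2 * y2)))"
    and S: "lin sB sB S"
    and S_left: "\<And>b. sw dB b (\<lambda>b1 b2. S b1 * b2) = sB (eB b) 1"
    and S_right: "\<And>b. sw dB b (\<lambda>b1 b2. b1 * S b2) = sB (eB b) 1"
begin

lemmas vk = vector_space_field

text \<open>
  Elements \<open>b\<close> act on trilinear forms \<open>F(c, x, y)\<close> by \<open>H1\<close> and \<open>H2\<close>: these encode
  convolution with \<open>h(b, -) \<otimes> 1\<close> and \<open>1 \<otimes> h(b, -)\<close> in \<open>Hom(C, A \<otimes> A)\<close>, and associativity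
  becomes that of composition.
\<close>

definition H1 :: "'b \<Rightarrow> ('c \<Rightarrow> 'a \<Rightarrow> 'a \<Rightarrow> 'k) \<Rightarrow> 'c \<Rightarrow> 'a \<Rightarrow> 'a \<Rightarrow> 'k" where
  "H1 b F c x y = sw dC c (\<lambda>c1 c2. F c2 (x * h b c1) y)"

definition H2 :: "'b \<Rightarrow> ('c \<Rightarrow> 'a \<Rightarrow> 'a \<Rightarrow> 'k) \<Rightarrow> 'c \<Rightarrow> 'a \<Rightarrow> 'a \<Rightarrow> 'k" where
  "H2 b F c x y = sw dC c (\<lambda>c1 c2. F c2 x (y * h b c1))"

text \<open>The condition on \<open>PC\<close> makes a form live on the carrier of C. It is what
  turns \<open>H1 1\<close> and \<open>H2 1\<close> into the identity, since the counit law of C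
  holds on the carrier.\<close>

definition form :: "('c \<Rightarrow> 'a \<Rightarrow> 'a \<Rightarrow> 'k) \<Rightarrow> bool" where
  "form F \<longleftrightarrow> tril sC sA sA (*) F \<and> (\<forall>c. F (PC c) = F c)"

lemma formD:
  assumes "form F"
  shows "lin s sC g \<Longrightarrow> lin s (*) (\<lambda>t. F (g t) x y)"
    "lin s sA k \<Longrightarrow> lin s (*) (\<lambda>t. F c (k t) y)" "lin s sA k \<Longrightarrow> lin s (*) (\<lambda>t. F c x (k t))"
    "F (PC c) = F c"
proof -
  have F: "lin sC (*) (\<lambda>c. F c x y)" "lin sA (*) (\<lambda>x. F c x y)" "lin sA (*) (\<lambda>y. F c x y)" for c x y
    using assms by (simp_all add: form_def tril_def)
  show "lin s sC g \<Longrightarrow> lin s (*) (\<lambda>t. F (g t) x y)" by (rule lin_comp[OF F(1)])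
  show "lin s sA k \<Longrightarrow> lin s (*) (\<lambda>t. F c (k t) y)" by (rule lin_comp[OF F(2)])
  show "lin s sA k \<Longrightarrow> lin s (*) (\<lambda>t. F c x (k t))" by (rule lin_comp[OF F(3)])
  show "F (PC c) = F c" using assms by (simp add: form_def)
qed

lemma h_lin: "lin t sB g \<Longrightarrow> lin t sA (\<lambda>t. h (g t) c)" "lin t sC k \<Longrightarrow> lin t sA (\<lambda>t. h b (k t))"
  by (rule lin_comp[OF bil1[OF h]] lin_comp[OF bil2[OF h]]; assumption)+

lemmas lin_rules = A.lin_mult_left A.lin_mult_right B.lin_mult_left B.lin_mult_right h_lin lin_id
  lin_comp[OF S]

lemma form_H1:
  assumes F: "form F"
  shows "form (H1 b F)"
  unfolding form_def[of "H1 b F"] H1_def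
  by (intro conjI trilI allI ext C.lin_sw[OF vk] C.sw_P[OF vk] bilI lin_sw_param vk formD[OF F] lin_rules)

lemma form_H2:
  assumes F: "form F"
  shows "form (H2 b F)"
  unfolding form_def[of "H2 b F"] H2_def
  by (intro conjI trilI allI ext C.lin_sw[OF vk] C.sw_P[OF vk] bilI lin_sw_param vk formD[OF F] lin_rules)

lemma form_sw: "(\<And>p q. form (F p q)) \<Longrightarrow> form (\<lambda>c x y. sw d z (\<lambda>p q. F p q c x y))"
  unfolding form_def tril_def by (auto intro!: lin_sw_param vk)

lemma lin_H1_param: "(\<And>c x y. lin s (*) (\<lambda>t. G t c x y)) \<Longrightarrow> lin s (*) (\<lambda>t. H1 b (G t) c x y)"
  unfolding H1_def by (intro lin_sw_param vk) blast

lemma lin_H2_param: "(\<And>c x y. lin s (*) (\<lambda>t. G t c x y)) \<Longrightarrow> lin s (*) (\<lambda>t. H2 b (G t) c x y)"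
  unfolding H2_def by (intro lin_sw_param vk) blast

lemma lin_H1: "form F \<Longrightarrow> lin s sB g \<Longrightarrow> lin s (*) (\<lambda>t. H1 (g t) F c x y)"
  unfolding H1_def by (intro lin_sw_param vk formD lin_rules)

lemma lin_H2: "form F \<Longrightarrow> lin s sB g \<Longrightarrow> lin s (*) (\<lambda>t. H2 (g t) F c x y)"
  unfolding H2_def by (intro lin_sw_param vk formD lin_rules)

lemma H1_sw: "H1 b (\<lambda>c x y. sw d z (\<lambda>p q. F p q c x y)) c x y = sw d z (\<lambda>p q. H1 b (F p q) c x y)"
  unfolding H1_def by (rule sw_swap)

lemma H2_sw: "H2 b (\<lambda>c x y. sw d z (\<lambda>p q. F p q c x y)) c x y = sw d z (\<lambda>p q. H2 b (F p q) c x y)"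
  unfolding H2_def by (rule sw_swap)

text \<open>The measuring property: b \<mapsto> h(b, -) is multiplicative into Hom(C, A) with
  convolution, so \<open>H1\<close> is a representation of B on forms.\<close>

lemma H1_mult:
  assumes F: "form F"
  shows "H1 b (H1 b' F) = H1 (b * b') F"
proof (intro ext)
  fix c x y
  have "H1 b (H1 b' F) c x y = sw dC c (\<lambda>c1 c2. sw dC c1 (\<lambda>u v. F c2 (x * h b u * h b' v) y))"
    unfolding H1_def
    by (rule C.coassoc[OF vk, symmetric]) (intro trilI formD[OF F] lin_rules)
  also have "\<dots> = sw dC c (\<lambda>c1 c2. F c2 (x * sw dC c1 (\<lambda>u v. h b u * h b' v)) y)"
    by (simp add: lin_sw_right[OF formD(2)[OF F A.lin_mult_left[OF lin_id]]] mult.assoc)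
  finally show "H1 b (H1 b' F) c x y = H1 (b * b') F c x y"
    by (simp add: H1_def h_mult)
qed

lemma H2_mult:
  assumes F: "form F"
  shows "H2 b (H2 b' F) = H2 (b * b') F"
proof (intro ext)
  fix c x y
  have "H2 b (H2 b' F) c x y = sw dC c (\<lambda>c1 c2. sw dC c1 (\<lambda>u v. F c2 x (y * h b u * h b' v)))"
    unfolding H2_def
    by (rule C.coassoc[OF vk, symmetric]) (intro trilI formD[OF F] lin_rules)
  also have "\<dots> = sw dC c (\<lambda>c1 c2. F c2 x (y * sw dC c1 (\<lambda>u v. h b u * h b' v)))"
    by (simp add: lin_sw_right[OF formD(3)[OF F A.lin_mult_left[OF lin_id]]] mult.assoc)
  finally show "H2 b (H2 b' F) c x y = H2 (b * b') F c x y"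
    by (simp add: H2_def h_mult)
qed

lemma H1_one: "form F \<Longrightarrow> H1 1 F = F"
proof (intro ext)
  fix c x y assume F: "form F"
  have "H1 1 F c x y = sw dC (PC c) (\<lambda>c1 c2. F c2 (x * h 1 c1) y)"
    unfolding H1_def by (rule C.sw_P[OF vk, symmetric]) (intro bilI formD[OF F] lin_rules)
  also have "\<dots> = sw dC (PC c) (\<lambda>c1 c2. eC c1 * F c2 x y)"
    by (rule C.sw_cong) (simp add: h_one A.smult_right lin_scale[OF formD(2)[OF F lin_id]])
  also have "\<dots> = F (PC c) x y"
    by (rule C.counit_left_lin[OF formD(1)[OF F lin_id] C.P(2)])
  finally show "H1 1 F c x y = F c x y" by (simp add: formD(4)[OF F])
qed

lemma H2_one: "form F \<Longrightarrow> H2 1 F = F"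
proof (intro ext)
  fix c x y assume F: "form F"
  have "H2 1 F c x y = sw dC (PC c) (\<lambda>c1 c2. F c2 x (y * h 1 c1))"
    unfolding H2_def by (rule C.sw_P[OF vk, symmetric]) (intro bilI formD[OF F] lin_rules)
  also have "\<dots> = sw dC (PC c) (\<lambda>c1 c2. eC c1 * F c2 x y)"
    by (rule C.sw_cong) (simp add: h_one A.smult_right lin_scale[OF formD(3)[OF F lin_id]])
  also have "\<dots> = F (PC c) x y"
    by (rule C.counit_left_lin[OF formD(1)[OF F lin_id] C.P(2)])
  finally show "H2 1 F c x y = F c x y" by (simp add: formD(4)[OF F])
qed

text \<open>Convolution with \<Delta>(h(b, -)), as \<open>HD_eq\<close> shows; the coproduct is
  expanded in B because f is a coalgebra map.\<close>

definition HD :: "'b \<Rightarrow> ('c \<Rightarrow> 'a \<Rightarrow> 'a \<Rightarrow> 'k) \<Rightarrow> 'c \<Rightarrow> 'a \<Rightarrow> 'a \<Rightarrow> 'k" where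
  "HD b F c x y = sw dB b (\<lambda>b1 b2. H1 b1 (H2 b2 F) c x y)"

lemma HD_eq:
  assumes F: "form F"
  shows "HD b F c x y = sw dC c (\<lambda>c1 c2. sw dA (h b c1) (\<lambda>u v. F c2 (x * u) (y * v)))"
proof -
  have "HD b F c x y = sw dB b (\<lambda>b1 b2. sw dC c (\<lambda>c1 c2. sw dC c1 (\<lambda>p q. F c2 (x * h b1 p) (y * h b2 q))))"
    unfolding HD_def H1_def H2_def
    by (subst C.coassoc[OF vk, where m = "\<lambda>p q c2. F c2 (x * h _ p) (y * h _ q)"])
      (intro trilI formD[OF F] lin_rules refl)+
  also have "\<dots> = sw dC c (\<lambda>c1 c2. sw dB b (\<lambda>b1 b2. sw dC c1 (\<lambda>p q. F c2 (x * h b1 p) (y * h b2 q))))"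
    by (rule sw_swap)
  also have "\<dots> = sw dC c (\<lambda>c1 c2. sw dA (h b c1) (\<lambda>u v. F c2 (x * u) (y * v)))"
    by (subst h_comult) (intro bilI formD[OF F] lin_rules refl)+
  finally show ?thesis .
qed

lemma form_HD: "form F \<Longrightarrow> form (HD b F)"
  unfolding HD_def[abs_def] by (intro form_sw form_H1 form_H2)

text \<open>The coproduct of A is multiplicative and h is a measuring, so b \<mapsto> \<Delta>(h(b,
  -)) is again multiplicative for convolution.\<close>

lemma HD_mult:
  assumes F: "form F"
  shows "HD b (HD b' F) c x y = HD (b * b') F c x y"
proof -
  have bil: "bil sA sA (*) (\<lambda>u v. F q (x * u) (y * v))" for q
    by (intro bilI formD[OF F] lin_rules)
  have lin_q: "lin sA (*) (\<lambda>z. sw dA z (\<lambda>u v. F q (x * u) (y * v)))" for q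
    by (rule A.lin_sw[OF vk bil])
  have "HD b (HD b' F) c x y = sw dC c (\<lambda>c1 c2. sw dA (h b c1) (\<lambda>u v. sw dC c2 (\<lambda>p q.
      sw dA (h b' p) (\<lambda>u' v'. F q (x * (u * u')) (y * (v * v'))))))"
    by (simp add: HD_eq[OF form_HD[OF F]] HD_eq[OF F] mult.assoc)
  also have "\<dots> = sw dC c (\<lambda>c1 c2. sw dC c2 (\<lambda>p q. sw dA (h b c1) (\<lambda>u v.
      sw dA (h b' p) (\<lambda>u' v'. F q (x * (u * u')) (y * (v * v'))))))"
    by (subst (2) sw_swap) (rule refl)
  also have "\<dots> = sw dC c (\<lambda>c1 c2. sw dC c2 (\<lambda>p q. sw dA (h b c1 * h b' p) (\<lambda>u v. F q (x * u) (y * v))))"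
    by (simp only: A_mult[OF bil])
  also have "\<dots> = sw dC c (\<lambda>c1 c2. sw dC c1 (\<lambda>p q. sw dA (h b p * h b' q) (\<lambda>u v. F c2 (x * u) (y * v))))"
    by (rule C.coassoc[OF vk, symmetric])
      (intro trilI lin_comp[OF lin_q] lin_rules lin_sw_param vk formD[OF F])
  also have "\<dots> = sw dC c (\<lambda>c1 c2. sw dA (h (b * b') c1) (\<lambda>u v. F c2 (x * u) (y * v)))"
    by (simp only: h_mult lin_sw_right[OF lin_q])
  finally show ?thesis by (simp add: HD_eq[OF F])
qed

text \<open>
  Both sides compute \<open>\<Delta>(h(b b', c))\<close>: the left one with \<open>h(b b', c)\<close> first expanded by the
  measuring property, the right one with \<open>b b'\<close> comultiplied in \<open>B\<close>.
\<close>

lemma H_exchange1: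
  assumes F: "form F"
  shows "sw dB b (\<lambda>b1 b2. sw dB b' (\<lambda>p q. H1 b1 (H2 b2 (H1 p (H2 q F))) c x y))
    = sw dB b (\<lambda>b1 b2. sw dB b' (\<lambda>p q. H1 b1 (H1 p (H2 b2 (H2 q F))) c x y))"
proof -
  have "sw dB b (\<lambda>b1 b2. sw dB b' (\<lambda>p q. H1 b1 (H2 b2 (H1 p (H2 q F))) c x y)) = HD b (HD b' F) c x y"
    unfolding HD_def[of b] HD_def[of b', abs_def]
    by (subst H2_sw[abs_def]) (simp add: H1_sw)
  also have "\<dots> = sw dB (b * b') (\<lambda>u v. H1 u (H2 v F) c x y)"
    by (simp only: HD_mult[OF F] HD_def[of "b * b'"])
  also have "\<dots> = sw dB b (\<lambda>b1 b2. sw dB b' (\<lambda>p q. H1 (b1 * p) (H2 (b2 * q) F) c x y))"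
    by (intro B_mult bilI lin_H1 lin_H1_param lin_H2 form_H2 F lin_id)
  finally show ?thesis by (simp add: H1_mult H2_mult form_H2 form_H1 F)
qed

text \<open>Multiplying by h(S b_1, -) recovers \<open>X b\<close>, because S(b_1) b_2 \<otimes> b_3
  = 1 \<otimes> b.\<close>

lemma H1_cancel:
  assumes X: "\<And>b. form (X b)" "\<And>c x y. lin sB (*) (\<lambda>b. X b c x y)"
  shows "sw dB b (\<lambda>u v. H1 (S u) (\<lambda>c x y. sw dB v (\<lambda>v1 v2. H1 v1 (X v2) c x y)) c x y) = X b c x y"
proof -
  have "sw dB b (\<lambda>u v. H1 (S u) (\<lambda>c x y. sw dB v (\<lambda>v1 v2. H1 v1 (X v2) c x y)) c x y)
      = sw dB b (\<lambda>u v. sw dB v (\<lambda>v1 v2. H1 (S u * v1) (X v2) c x y))"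
    by (simp add: H1_sw H1_mult X(1))
  also have "\<dots> = sw dB b (\<lambda>u v. sw dB u (\<lambda>u1 u2. H1 (S u1 * u2) (X v) c x y))"
    by (rule B.coassoc[OF vk, symmetric])
      (intro trilI lin_H1 lin_H1_param X lin_rules)
  also have "\<dots> = sw dB b (\<lambda>u v. H1 (sw dB u (\<lambda>u1 u2. S u1 * u2)) (X v) c x y)"
    by (simp add: lin_sw_right[OF lin_H1[OF X(1) lin_id]])
  also have "\<dots> = sw dB b (\<lambda>u v. eB u * X v c x y)"
    by (simp add: S_left lin_scale[OF lin_H1[OF X(1) lin_id]] H1_one X(1))
  also have "\<dots> = X b c x y"
    by (rule B.counit_left_lin[OF X(2)]) simp
  finally show ?thesis .
qed

text \<open>Strips the outermost \<open>H1 b1\<close> from both sides of \<open>H_exchange1\<close>: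
  as functions of \<open>b2\<close> the remaining expressions are forms that
  \<open>H1_cancel\<close> recovers.\<close>

lemma H_exchange2:
  assumes F: "form F"
  shows "sw dB b' (\<lambda>p q. H2 b (H1 p (H2 q F)) c x y) = sw dB b' (\<lambda>p q. H1 p (H2 b (H2 q F)) c x y)"
proof -
  define X where "X v c x y = sw dB b' (\<lambda>p q. H2 v (H1 p (H2 q F)) c x y)" for v c x y
  define Y where "Y v c x y = sw dB b' (\<lambda>p q. H1 p (H2 v (H2 q F)) c x y)" for v c x y
  have X: "form (X v)" "lin sB (*) (\<lambda>b. X b c x y)" for v c x y
    unfolding X_def[abs_def]
    by (intro form_sw form_H1 form_H2 F lin_sw_param vk lin_H2 lin_id)+
  have Y: "form (Y v)" "lin sB (*) (\<lambda>b. Y b c x y)" for v c x y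
    unfolding Y_def[abs_def]
    by (intro form_sw form_H1 form_H2 F lin_sw_param vk lin_H1_param lin_H2 lin_id)+
  have "sw dB v (\<lambda>v1 v2. H1 v1 (X v2) c x y) = sw dB v (\<lambda>v1 v2. H1 v1 (Y v2) c x y)" for v c x y
    using H_exchange1[OF F, of v b' c x y]
    by (simp add: X_def[abs_def] Y_def[abs_def] H1_sw)
  then have "X b c x y = Y b c x y"
    using H1_cancel[OF X, of b c x y] H1_cancel[OF Y, of b c x y] by simp
  then show ?thesis by (simp add: X_def Y_def)
qed

text \<open>The opposite move: b is rewritten as b_1 \<otimes> b_2 S(b_3), which supplies the factor
  \<open>H2 q\<close> that \<open>H_exchange2\<close> requires next to \<open>H1 p\<close>.\<close>

lemma H2_absorb:
  assumes F: "form F"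
    and \<Theta>: "\<And>G. form G \<Longrightarrow> lin sB (*) (\<lambda>p. \<Theta> p G)"
      "\<And>p G g. form G \<Longrightarrow> lin sB sB g \<Longrightarrow> lin sB (*) (\<lambda>q. \<Theta> p (H2 (g q) G))"
  shows "sw dB b (\<lambda>u v. sw dB u (\<lambda>p q. \<Theta> p (H2 q (H2 (S v) F)))) = \<Theta> b F"
proof -
  have "sw dB b (\<lambda>u v. sw dB u (\<lambda>p q. \<Theta> p (H2 q (H2 (S v) F))))
      = sw dB b (\<lambda>u v. sw dB v (\<lambda>p q. \<Theta> u (H2 (p * S q) F)))"
    unfolding H2_mult[OF F]
    by (rule B.coassoc[OF vk]) (intro trilI \<Theta> form_H2 F lin_rules)
  also have "\<dots> = sw dB b (\<lambda>u v. \<Theta> u (H2 (sw dB v (\<lambda>p q. p * S q)) F))"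
    by (simp only: lin_sw_right[OF \<Theta>(2)[OF F lin_id]])
  also have "\<dots> = sw dB b (\<lambda>u v. eB v * \<Theta> u F)"
    by (simp add: S_right lin_scale[OF \<Theta>(2)[OF F lin_id]] H2_one F)
  also have "\<dots> = \<Theta> b F"
    by (rule B.counit_right_lin[OF \<Theta>(1)[OF F]]) simp
  finally show ?thesis .
qed

lemma H_exchange:
  assumes F: "form F"
  shows "H2 b (H1 b' F) c x y = H1 b' (H2 b F) c x y"
proof -
  have "H2 b (H1 b' F) c x y = sw dB b' (\<lambda>u v. sw dB u (\<lambda>p q. H2 b (H1 p (H2 q (H2 (S v) F))) c x y))"
    by (rule H2_absorb[symmetric, OF F])
      (intro lin_H2_param lin_H1 lin_H1_param lin_H2 lin_id; assumption)+
  also have "\<dots> = sw dB b' (\<lambda>u v. sw dB u (\<lambda>p q. H1 p (H2 b (H2 q (H2 (S v) F))) c x y))"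
    by (simp only: H_exchange2[OF form_H2[OF F]])
  also have "\<dots> = H1 b' (H2 b F) c x y"
    by (rule H2_absorb[OF F])
      (intro lin_H2_param lin_H1 lin_H1_param lin_H2 lin_id form_H2; assumption)+
  finally show ?thesis .
qed

lemma h_exchange:
  assumes n: "bil sA sA (*) n"
  shows "sw dC c (\<lambda>c1 c2. n (h b' c2) (h b c1)) = sw dC c (\<lambda>c1 c2. n (h b' c1) (h b c2))"
proof -
  \<comment> \<open>The counit in the C slot discards the last factor of the iterated coproduct of
    c, and the units inserted for x and y below leave n evaluated on two values of h.\<close>
  define F where "F c x y = eC (PC c) * n x y" for c x y
  have F: "form F"
    unfolding form_def F_def
    by (auto intro!: trilI lin_times_var lin_times_const lin_comp[OF C.e C.P(1)] bil1[OF n] bil2[OF n] simp: C.P)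
  have lin_h: "lin sC (*) (\<lambda>c. n x (h b c))" "lin sC (*) (\<lambda>c. n (h b c) x)" for x b
    by (intro lin_comp[OF bil2[OF n]] lin_comp[OF bil1[OF n]] h_lin lin_id)+
  have "H2 b (H1 b' F) c 1 1 = sw dC c (\<lambda>c1 c2. sw dC c2 (\<lambda>p q. eC q * n (h b' p) (h b c1)))"
    unfolding H1_def H2_def F_def by (intro C.sw_cong) (simp add: C.P)
  also have "\<dots> = sw dC c (\<lambda>c1 c2. n (h b' c2) (h b c1))"
    by (intro C.sw_cong C.counit_right_lin lin_h)
  finally have 1: "H2 b (H1 b' F) c 1 1 = sw dC c (\<lambda>c1 c2. n (h b' c2) (h b c1))" .
  have "H1 b' (H2 b F) c 1 1 = sw dC c (\<lambda>c1 c2. sw dC c2 (\<lambda>p q. eC q * n (h b' c1) (h b p)))"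
    unfolding H1_def H2_def F_def by (intro C.sw_cong) (simp add: C.P)
  also have "\<dots> = sw dC c (\<lambda>c1 c2. n (h b' c1) (h b c2))"
    by (intro C.sw_cong C.counit_right_lin lin_h)
  finally show ?thesis using H_exchange[OF F, of b b' c 1 1] 1 by simp
qed

end

text \<open>The universal property yields linearity only on the span of elementary tensors; a
  projection onto that span extends it to the whole tensor type.\<close>

lemma bilinear_lift:
  fixes s :: "'k::field \<Rightarrow> 'v::ab_group_add \<Rightarrow> 'v" and t :: "'k \<Rightarrow> 'w::ab_group_add \<Rightarrow> 'w"
    and u :: "'k \<Rightarrow> 'u::ab_group_add \<Rightarrow> 'u"
  assumes s: "vector_space s" and t: "vector_space t" and u: "vector_space u" and m: "bil s t u m"
  shows "\<exists>L. lin tscale u L \<and> (\<forall>v w. L (tn s t v w) = m v w)"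
proof -
  let ?V = "\<lparr>vscale = s, vspace = UNIV\<rparr>" and ?W = "\<lparr>vscale = t, vspace = UNIV\<rparr>"
    and ?U = "\<lparr>vscale = u, vspace = UNIV\<rparr>"
  have "vec_space ?V" "vec_space ?W" "vec_space ?U"
    using s t u by (simp_all add: vec_space_def module.subspace_UNIV module_iff_vector_space)
  moreover have "bilinear_map ?V ?W ?U m"
    using m by (simp add: bilinear_map_def linear_map_def bil_def lin_def)
  ultimately obtain L where L: "linear_map (tensor_space ?V ?W) ?U L" "\<And>v w. L (tn s t v w) = m v w"
    using tensor_universal[of ?V ?W ?U m] by (auto simp: tens_eq_tn)
  obtain Q where Q: "lin tscale tscale Q" "\<And>x. Q x \<in> tspace s t UNIV UNIV"
    "\<And>x. x \<in> tspace s t UNIV UNIV \<Longrightarrow> Q x = x"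
    using subspace_projection[OF vector_space_tscale tspace_subspace] by metis
  have "lin tscale u (\<lambda>x. L (Q x))"
    using L(1) Q by (simp add: linear_map_def lin_def vspace_tensor_space) (simp add: tensor_space_def)
  moreover have "L (Q (tn s t v w)) = m v w" for v w
    by (simp add: Q(3) tn_in_tspace L(2))
  ultimately show ?thesis by (intro exI[of _ "\<lambda>x. L (Q x)"]) simp
qed

text \<open>An arbitrary, not necessarily linear, section k of f does: by the kernel condition g
  \<circ> k is independent of its choice, which gives linearity.\<close>

lemma linear_section_factor:
  assumes s: "vector_space s" and t: "vector_space t" and X: "module.subspace s X"
    and f: "lin s t f" "\<And>y. \<exists>x\<in>X. f x = y" and g: "lin s u g"
    and ker: "\<And>x. x \<in> X \<Longrightarrow> f x = 0 \<Longrightarrow> g x = 0"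
  shows "\<exists>r. lin t u r \<and> (\<forall>x\<in>X. r (f x) = g x)"
proof -
  interpret s: vector_space s by fact
  obtain k where k: "\<And>y. k y \<in> X \<and> f (k y) = y" using f(2) by metis
  have r: "g (k (f x)) = g x" if "x \<in> X" for x
  proof -
    have "f (k (f x) - x) = 0" using k by (simp add: lin_diff[OF f(1)])
    then have "g (k (f x) - x) = 0" using that k s.subspace_diff[OF X] by (intro ker) auto
    then show ?thesis by (simp add: lin_diff[OF g])
  qed
  have "lin t u (\<lambda>y. g (k y))"
  proof (rule linI)
    fix x y
    show "g (k (x + y)) = g (k x) + g (k y)"
      using r[of "k x + k y"] k s.subspace_add[OF X] by (simp add: lin_add[OF f(1)] lin_add[OF g])
  next
    fix a y
    show "g (k (t a y)) = u a (g (k y))"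
      using r[of "s a (k y)"] k s.subspace_scale[OF X] by (simp add: lin_scale[OF f(1)] lin_scale[OF g])
  qed
  with r show ?thesis by blast
qed

section \<open>The covering and its convolution inverse\<close>

context covering_data
begin

sublocale H: tensor_coal sB UNIV "\<lambda>x. x" dB eB sC VC PC dC eC ..

abbreviation bc :: "'b \<Rightarrow> 'c \<Rightarrow> ('k, 'b, 'c) tensor" where
  "bc \<equiv> tn sB sC"

abbreviation VT :: "('k, 'b, 'c) tensor set" where
  "VT \<equiv> tspace sB sC UNIV VC"

definition fT :: "('k, 'b, 'c) tensor \<Rightarrow> 'a" where
  "fT = (SOME L. lin tscale sA L \<and> (\<forall>b c. L (bc b c) = h b c))"

definition gT :: "('k, 'b, 'c) tensor \<Rightarrow> 'a" where
  "gT = (SOME L. lin tscale sA L \<and> (\<forall>b c. L (bc b c) = h (S b) c))"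

lemma fT: "lin tscale sA fT" "fT (bc b c) = h b c"
  using someI_ex[OF bilinear_lift[OF B.vs C.vs A.vs h]] unfolding fT_def by blast+

lemma gT: "lin tscale sA gT" "gT (bc b c) = h (S b) c"
proof -
  have "bil sB sC sA (\<lambda>b c. h (S b) c)" by (intro bilI lin_rules)
  from someI_ex[OF bilinear_lift[OF B.vs C.vs A.vs this]]
  show "lin tscale sA gT" "gT (bc b c) = h (S b) c" unfolding gT_def by blast+
qed

lemma generators_eq:
  assumes "lin tscale u p" "lin tscale u q" "\<And>b c. c \<in> VC \<Longrightarrow> p (bc b c) = q (bc b c)" "x \<in> VT"
  shows "p x = q x"
  by (rule tspace_lin_eq[OF B.vs B.V assms(1,2) _ assms(4)]) (rule assms(3))

lemma h_comult_gen:
  assumes u: "vector_space u" and m: "bil sA sA u m"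
  shows "sw dA (h b c) m = sw dB b (\<lambda>b1 b2. sw dC c (\<lambda>c1 c2. m (h b1 c1) (h b2 c2)))"
proof (rule eq_by_functionals[OF u])
  fix \<phi> assume phi: "lin u (*) \<phi>"
  have "bil sA sA (*) (\<lambda>x y. \<phi> (m x y))" by (intro bilI lin_comp[OF phi] bil1[OF m] bil2[OF m])
  from h_comult[OF this]
  show "\<phi> (sw dA (h b c) m) = \<phi> (sw dB b (\<lambda>b1 b2. sw dC c (\<lambda>c1 c2. m (h b1 c1) (h b2 c2))))"
    by (simp add: lin_sw_right[OF phi])
qed

lemma fT_comult:
  assumes u: "vector_space u" and m: "bil sA sA u m" and x: "x \<in> VT"
  shows "sw dA (fT x) m = sw H.dT x (\<lambda>a b. m (fT a) (fT b))"
proof -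
  have m': "bil tscale tscale u (\<lambda>a b. m (fT a) (fT b))"
    by (intro bilI lin_comp[OF bil1[OF m]] lin_comp[OF bil2[OF m]] fT)
  show ?thesis
    by (rule generators_eq[OF lin_comp[OF A.lin_sw[OF u m] fT(1)] H.T.lin_sw[OF u m'] _ x])
      (simp add: H.sw_dT_bc[OF u m'] fT(2) h_comult_gen[OF u m])
qed

lemma fT_counit:
  assumes "x \<in> VT"
  shows "eA (fT x) = H.eT x"
  by (rule generators_eq[OF lin_comp[OF A.e fT(1)] H.T.e _ assms]) (simp add: fT(2) h_counit H.eT_bc)

text \<open>On generators, h(S b_1, c_1) h(b_2, c_2) = h(S(b_1) b_2, c) = \<epsilon>(b)
  \<epsilon>(c) 1 by the measuring property and the antipode of B, and symmetrically on the other
  side.\<close>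

lemma gT_fT:
  assumes x: "x \<in> VT"
  shows "sw H.dT x (\<lambda>a b. gT a * fT b) = sA (H.eT x) 1"
    and "sw H.dT x (\<lambda>a b. fT a * gT b) = sA (H.eT x) 1"
proof -
  have e: "lin tscale sA (\<lambda>x. sA (H.eT x) 1)" by (rule lin_scale_var[OF A.vs H.T.e])
  have 1: "h (sB (eB b) 1) c = sA (H.eT (bc b c)) 1" if "c \<in> VC" for b c
    using that by (simp add: lin_scale[OF bil1[OF h]] h_one H.eT_bc)
  have l: "lin sB sA (\<lambda>b. h b c)" for c by (rule bil1[OF h])
  have m: "bil tscale tscale sA (\<lambda>a b. gT a * fT b)" by (rule A.bil_mult[OF gT(1) fT(1)])
  show "sw H.dT x (\<lambda>a b. gT a * fT b) = sA (H.eT x) 1"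
    by (rule generators_eq[OF H.T.lin_sw[OF A.vs m] e _ x])
      (simp add: H.sw_dT_bc[OF A.vs m] fT(2) gT(2) 1[symmetric] S_left[symmetric] lin_sw_right[OF l] flip: h_mult)
  have m: "bil tscale tscale sA (\<lambda>a b. fT a * gT b)" by (rule A.bil_mult[OF fT(1) gT(1)])
  show "sw H.dT x (\<lambda>a b. fT a * gT b) = sA (H.eT x) 1"
    by (rule generators_eq[OF H.T.lin_sw[OF A.vs m] e _ x])
      (simp add: H.sw_dT_bc[OF A.vs m] fT(2) gT(2) 1[symmetric] S_right[symmetric] lin_sw_right[OF l] flip: h_mult)
qed

section \<open>Left inverses on images of finite-dimensional subcoalgebras\<close>

definition cocomm_on :: "'b set \<Rightarrow> bool" where
  "cocomm_on E \<longleftrightarrow> (\<forall>b\<in>E. \<forall>m. bil sB sB (*) m \<longrightarrow> sw dB b (\<lambda>x y. m y x) = sw dB b (m :: _ \<Rightarrow> _ \<Rightarrow> 'k))"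

text \<open>Cocommutativity of \<open>E\<close> swaps the two factors of b, and
  \<open>h_exchange\<close> swaps those of c.\<close>

lemma conv_symmetric:
  assumes E: "cocomm_on E" "b \<in> E" and \<alpha>: "lin sA (*) \<alpha>" and \<beta>: "lin sA (*) \<beta>"
  shows "A.conv \<alpha> \<beta> (h b c) = A.conv \<beta> \<alpha> (h b c)"
proof -
  have ab: "bil sA sA (*) (\<lambda>x y. \<alpha> x * \<beta> y)" and ba: "bil sA sA (*) (\<lambda>x y. \<beta> x * \<alpha> y)"
    by (intro A.bil_lact \<alpha> \<beta> vk)+
  have m: "bil sB sB (*) (\<lambda>b1 b2. sw dC c (\<lambda>c1 c2. \<alpha> (h b2 c1) * \<beta> (h b1 c2)))"
    by (intro bilI lin_sw_param vk lin_times_const lin_times_var lin_comp[OF \<alpha>] lin_comp[OF \<beta>] lin_rules)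
  have "A.conv \<alpha> \<beta> (h b c) = sw dB b (\<lambda>b1 b2. sw dC c (\<lambda>c1 c2. \<alpha> (h b1 c1) * \<beta> (h b2 c2)))"
    unfolding A.conv_def by (rule h_comult[OF ab])
  also have "\<dots> = sw dB b (\<lambda>b1 b2. sw dC c (\<lambda>c1 c2. \<alpha> (h b2 c1) * \<beta> (h b1 c2)))"
    using E m unfolding cocomm_on_def by blast
  also have "\<dots> = sw dB b (\<lambda>b1 b2. sw dC c (\<lambda>c1 c2. \<beta> (h b1 c1) * \<alpha> (h b2 c2)))"
    by (subst h_exchange[OF ab, symmetric]) (simp add: mult.commute)
  also have "\<dots> = A.conv \<beta> \<alpha> (h b c)"
    unfolding A.conv_def by (rule h_comult[OF ba, symmetric])
  finally show ?thesis .
qed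

text \<open>For fixed c_1 and c_2 in \<open>F\<close> the functionals \<phi>(h(-, c_1)) and
  \<psi>(h(-, c_2)) kill \<open>X\<close> and \<open>Y\<close>, so their product kills
  \<open>E\<close>. The projection \<open>R\<close> keeps c_1 and c_2 in \<open>F\<close>.\<close>

lemma wedge_image:
  assumes F: "C.sub F" and w: "B.wedge E X Y" and E: "B.sub E"
  shows "A.wedge (fT ` tspace sB sC E F) (fT ` tspace sB sC X F) (fT ` tspace sB sC Y F)"
  unfolding A.wedge_def
proof (intro ballI allI impI)
  fix y \<phi> \<psi> assume "y \<in> fT ` tspace sB sC E F" and phi: "lin sA (*) \<phi>" and psi: "lin sA (*) \<psi>"
    and X: "\<forall>x\<in>fT ` tspace sB sC X F. \<phi> x = 0" and Y: "\<forall>x\<in>fT ` tspace sB sC Y F. \<psi> x = 0"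
  then obtain x where x: "x \<in> tspace sB sC E F" "y = fT x" by blast
  note F' = C.subD[OF F]
  obtain R where R: "lin sC sC R" "\<And>x. R x \<in> F" "\<And>x. x \<in> F \<Longrightarrow> R x = x"
    using subspace_projection[OF C.vs F'(1)] by metis
  have X0: "\<phi> (h b c) = 0" if "b \<in> X" "c \<in> F" for b c
    using X tn_in_tspace[OF that, of sB sC] fT(2)[of b c] by (metis image_eqI)
  have Y0: "\<psi> (h b c) = 0" if "b \<in> Y" "c \<in> F" for b c
    using Y tn_in_tspace[OF that, of sB sC] fT(2)[of b c] by (metis image_eqI)
  have m: "bil sA sA (*) (\<lambda>x y. \<phi> x * \<psi> y)" by (intro A.bil_lact phi psi vk)
  have "A.conv \<phi> \<psi> (fT x) = 0"
  proof (rule tspace_lin_eq[OF B.vs B.subD(1)[OF E] _ _ _ x(1)])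
    show "lin tscale (*) (\<lambda>x. A.conv \<phi> \<psi> (fT x))"
      by (rule lin_comp[OF A.lin_conv[OF phi psi] fT(1)])
    show "lin tscale (*) (\<lambda>x. 0 :: 'k)" by (rule lin_zero[OF vk])
    fix b c assume b: "b \<in> E" and c: "c \<in> F"
    have "A.conv \<phi> \<psi> (h b c) = sw dB b (\<lambda>b1 b2. sw dC c (\<lambda>c1 c2. \<phi> (h b1 c1) * \<psi> (h b2 c2)))"
      unfolding A.conv_def by (rule h_comult[OF m])
    also have "\<dots> = sw dB b (\<lambda>b1 b2. sw dC c (\<lambda>c1 c2. \<phi> (h b1 (R c1)) * \<psi> (h b2 (R c2))))"
    proof -
      have "sw dC c (\<lambda>c1 c2. \<phi> (h b1 c1) * \<psi> (h b2 c2)) = sw dC c (\<lambda>c1 c2. \<phi> (h b1 (R c1)) * \<psi> (h b2 (R c2)))" for b1 b2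
        by (rule C.sw_project[OF R(1,3) vk _ F c, symmetric])
          (assumption | intro bilI lin_times_const lin_times_var lin_comp[OF phi] lin_comp[OF psi] lin_rules)+
      then show ?thesis by simp
    qed
    also have "\<dots> = sw dC c (\<lambda>c1 c2. sw dB b (\<lambda>b1 b2. \<phi> (h b1 (R c1)) * \<psi> (h b2 (R c2))))"
      by (rule sw_swap)
    also have "\<dots> = sw dC c (\<lambda>c1 c2. 0)"
    proof (rule C.sw_cong)
      fix c1 c2
      have "B.conv (\<lambda>b. \<phi> (h b (R c1))) (\<lambda>b. \<psi> (h b (R c2))) b = 0"
        by (rule w[unfolded B.wedge_def, rule_format, OF b])
          (intro lin_comp[OF phi] lin_comp[OF psi] lin_rules X0 Y0 R; assumption)+
      then show "sw dB b (\<lambda>b1 b2. \<phi> (h b1 (R c1)) * \<psi> (h b2 (R c2))) = 0" by (simp add: B.conv_def)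
    qed
    finally show "A.conv \<phi> \<psi> (fT (bc b c)) = 0" by (simp add: fT(2) sw_def)
  qed
  then show "A.conv \<phi> \<psi> y = 0" by (simp add: x(2))
qed

text \<open>The descent takes place in B with \<open>F\<close> fixed, since
  \<open>wedge_image\<close> carries wedges of subcoalgebras of B to wedges in A. A second descent,
  among subcoalgebras of A, is inside \<open>left_invertible_cocommutative\<close>.\<close>

lemma left_invertible_image:
  assumes cocomm: "\<And>E. B.wedge_prime E \<Longrightarrow> findim sB E \<Longrightarrow> cocomm_on E"
    and E: "B.sub E" "findim sB E" and F: "C.sub F" "findim sC F"
  shows "A.left_invertible_on (fT ` tspace sB sC E F)"
proof (rule ccontr)
  assume bad: "\<not> A.left_invertible_on (fT ` tspace sB sC E F)"
  let ?I = "\<lambda>E. fT ` tspace sB sC E F"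
  define bads where "bads X \<longleftrightarrow> B.sub X \<and> findim sB X \<and> \<not> A.left_invertible_on (?I X)" for X
  have "bads E" using bad E by (simp add: bads_def)
  then have "\<exists>X. bads X \<and> (\<forall>Y. bads Y \<longrightarrow> B.dim X \<le> B.dim Y)" by (rule ex_has_least_nat)
  then obtain M where M: "bads M" and M_min: "\<And>Y. bads Y \<Longrightarrow> B.dim M \<le> B.dim Y" by blast
  have subM: "B.sub M" and finM: "findim sB M" and badM: "\<not> A.left_invertible_on (?I M)"
    using M by (auto simp: bads_def)
  have sI: "A.subspace (?I X)" for X
    by (rule lin_image_subspace[OF vector_space_tscale A.vs fT(1) tspace_subspace])
  have good: "A.left_invertible_on (?I X)" if X: "B.sub X" "X \<subseteq> M" "X \<noteq> M" for X
  proof (rule ccontr)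
    assume "\<not> A.left_invertible_on (?I X)"
    then have "B.dim M \<le> B.dim X" using X findim_subset[OF finM X(2)] by (intro M_min) (auto simp: bads_def)
    moreover have "B.dim X < B.dim M"
      by (rule dim_strict_mono[OF B.vs finM B.subD(1)[OF X(1)]]) (use X in blast)
    ultimately show False by simp
  qed
  have "?I {0} = {0}"
  proof -
    have "fT x = 0" if "x \<in> tspace sB sC {0} F" for x
      by (rule tspace_lin_eq[OF B.vs B.subspace_single_0 fT(1) lin_zero[OF A.vs] _ that])
        (simp add: fT(2) lin_0[OF bil1[OF h]])
    moreover have "0 \<in> ?I {0}" by (rule A.subspace_0[OF sI])
    ultimately show ?thesis by blast
  qed
  then have "M \<noteq> {0}" using badM A.left_invertible_on_zero by auto
  moreover have "X = M \<or> Y = M"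
    if "B.sub X" "X \<subseteq> M" "B.sub Y" "Y \<subseteq> M" "B.wedge M X Y" for X Y
  proof (rule ccontr)
    assume "\<not> (X = M \<or> Y = M)"
    then have "A.left_invertible_on (?I X)" "A.left_invertible_on (?I Y)" using good that by blast+
    then show False
      using badM A.left_invertible_on_wedge[OF wedge_image[OF F(1) that(5) subM] sI _ sI] by blast
  qed
  ultimately have "B.wedge_prime M" using subM by (auto simp: B.wedge_prime_def)
  then have coM: "cocomm_on M" using cocomm finM by blast
  have MV: "tspace sB sC M F \<subseteq> VT"
    using H.T.subD(2)[OF H.sub_tspace[OF subM F(1)]] by blast
  have "A.left_invertible_on (?I M)"
  proof (rule A.left_invertible_cocommutative[OF H.T.coal_axioms fT(1) gT(1) _ _ H.sub_tspace[OF subM F(1)]])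
    show "findim tscale (tspace sB sC M F)" by (rule findim_tspace[OF B.vs C.vs finM F(2)])
    show "A.conv \<alpha> \<beta> (fT x) = sw H.dT x (\<lambda>a b. \<alpha> (fT a) * \<beta> (fT b))"
      if "x \<in> VT" "lin sA (*) \<alpha>" "lin sA (*) \<beta>" for x \<alpha> \<beta>
      unfolding A.conv_def by (rule fT_comult[OF vk A.bil_lact[OF that(2,3) vk] that(1)])
    show "eA (fT x) = H.eT x" if "x \<in> VT" for x by (rule fT_counit[OF that])
    show "sw H.dT x (\<lambda>a b. gT a * fT b) = sA (H.eT x) 1" if "x \<in> tspace sB sC M F" for x
      using that MV by (intro gT_fT) auto
    show "A.conv \<alpha> \<beta> (fT x) = A.conv \<beta> \<alpha> (fT x)"
      if "x \<in> tspace sB sC M F" "lin sA (*) \<alpha>" "lin sA (*) \<beta>" for x \<alpha> \<beta>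
      by (rule tspace_lin_eq[OF B.vs B.subD(1)[OF subM] lin_comp[OF A.lin_conv[OF that(2,3)] fT(1)]
            lin_comp[OF A.lin_conv[OF that(3,2)] fT(1)] _ that(1)])
        (use that coM in \<open>simp add: fT(2) conv_symmetric\<close>)
  qed
  then show False using badM by blast
qed

text \<open>Associativity of convolution: r \<circ> f = (r \<circ> f) * (f * g) = ((r \<circ> f) *
  f) * g = g at x, where \<open>E\<close> and \<open>F\<close> are chosen to contain the components
  of one representation of x.\<close>

lemma gT_kernel:
  assumes cocomm: "\<And>E. B.wedge_prime E \<Longrightarrow> findim sB E \<Longrightarrow> cocomm_on E"
    and x: "x \<in> VT" "fT x = 0"
  shows "gT x = 0"
proof -
  obtain l where l: "\<forall>p\<in>set l. fst p \<in> UNIV \<and> snd p \<in> VC" "x = (\<Sum>p\<leftarrow>l. bc (fst p) (snd p))"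
    using tspace_list[OF B.V B.vs x(1)] by blast
  obtain E where E: "B.sub E" "findim sB E" "fst ` set l \<subseteq> E"
    using B.findim_sub_cover[of "fst ` set l"] by auto
  obtain F where F: "C.sub F" "findim sC F" "snd ` set l \<subseteq> F"
    using C.findim_sub_cover[of "snd ` set l"] l(1) by auto
  let ?D = "tspace sB sC E F"
  have D: "H.T.sub ?D" by (rule H.sub_tspace[OF E(1) F(1)])
  note D' = H.T.subD[OF D]
  have xD: "x \<in> ?D"
    unfolding l(2) using E(3) F(3)
    by (intro H.T.sum_list_in_subspace D'(1) tn_in_tspace) auto
  obtain r where r: "lin sA sA r" "\<And>y. y \<in> ?D \<Longrightarrow> sw dA (fT y) (\<lambda>a b. r a * b) = sA (eA (fT y)) 1"
    using left_invertible_image[OF cocomm E(1,2) F(1,2)] by (auto simp: A.left_invertible_on_def)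
  obtain Q where Q: "lin tscale tscale Q" "\<And>x. Q x \<in> ?D" "\<And>x. x \<in> ?D \<Longrightarrow> Q x = x"
    using subspace_projection[OF vector_space_tscale D'(1)] by metis
  have rf: "lin tscale sA (\<lambda>x. r (fT x))" by (rule lin_comp[OF r(1) fT(1)])
  have r': "sw H.dT y (\<lambda>a b. r (fT a) * fT b) = sA (H.eT y) 1" if "y \<in> ?D" for y
    using r(2)[OF that] D'(2)[OF that]
    by (simp add: fT_comult[OF A.vs A.bil_mult[OF r(1) lin_id]] fT_counit)
  have "sw H.dT x (\<lambda>u v. sw H.dT u (\<lambda>u1 u2. r (fT u1) * fT u2 * gT v))
      = sw H.dT x (\<lambda>u v. sw H.dT v (\<lambda>v1 v2. r (fT u) * fT v1 * gT v2))"
    by (rule H.T.coassoc[OF A.vs])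
      (intro trilI A.lin_mult_left A.lin_mult_right rf fT(1) gT(1))
  also have "\<dots> = sw H.dT x (\<lambda>u v. r (fT u) * sA (H.eT v) 1)"
    by (rule H.T.sw_cong) (simp add: mult.assoc gT_fT(2)[symmetric] sw_times_left)
  also have "\<dots> = r (fT x)"
    using H.T.counit_right_lin[OF rf x(1)] by (simp add: A.smult_right)
  finally have 1: "r (fT x) = sw H.dT x (\<lambda>u v. sw H.dT u (\<lambda>u1 u2. r (fT u1) * fT u2) * gT v)"
    by (simp add: sw_times_right)
  have m: "bil tscale tscale sA (\<lambda>u v. sw H.dT u (\<lambda>u1 u2. r (fT u1) * fT u2) * gT v)"
    by (intro A.bil_mult H.T.lin_sw A.vs rf fT(1) gT(1))
  have m': "bil tscale tscale sA (\<lambda>u v. sA (H.eT u) (gT v))"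
    by (intro H.T.bil_lact H.T.e gT(1) A.vs)
  \<comment> \<open>\<open>Q\<close> may be inserted because x lies in the subcoalgebra E \<otimes>
    F; this confines the sum to where r is known to be a left inverse.\<close>
  have "r (fT x) = sw H.dT x (\<lambda>u v. sw H.dT (Q u) (\<lambda>u1 u2. r (fT u1) * fT u2) * gT (Q v))"
    unfolding 1 by (rule H.T.sw_project[OF Q(1) Q(3) A.vs m D xD, symmetric])
  also have "\<dots> = sw H.dT x (\<lambda>u v. sA (H.eT (Q u)) (gT (Q v)))"
    by (simp add: r' Q(2) A.smult_left)
  also have "\<dots> = sw H.dT x (\<lambda>u v. sA (H.eT u) (gT v))"
    by (rule H.T.sw_project[OF Q(1) Q(3) A.vs m' D xD])
  also have "\<dots> = gT x" by (rule H.T.counit_left_lin[OF gT(1) x(1)])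
  finally show ?thesis using x(2) by (simp add: lin_0[OF r(1)])
qed

theorem antipode_exists:
  assumes cocomm: "\<And>E. B.wedge_prime E \<Longrightarrow> findim sB E \<Longrightarrow> cocomm_on E"
    and surj: "\<And>a. \<exists>x\<in>VT. fT x = a"
  shows "\<exists>T. lin sA sA T \<and> (\<forall>a. sw dA a (\<lambda>u v. T u * v) = sA (eA a) 1) \<and>
    (\<forall>a. sw dA a (\<lambda>u v. u * T v) = sA (eA a) 1)"
proof -
  obtain T where T: "lin sA sA T" "\<And>x. x \<in> VT \<Longrightarrow> T (fT x) = gT x"
    using linear_section_factor[OF vector_space_tscale A.vs tspace_subspace fT(1) surj gT(1) gT_kernel[OF cocomm]]
    by blast
  have "sw dA a (\<lambda>u v. T u * v) = sA (eA a) 1 \<and> sw dA a (\<lambda>u v. u * T v) = sA (eA a) 1" for a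
  proof -
    obtain x where x: "x \<in> VT" "fT x = a" using surj by blast
    have "sw dA a (\<lambda>u v. T u * v) = sw H.dT x (\<lambda>a b. gT a * fT b)"
      unfolding x(2)[symmetric] fT_comult[OF A.vs A.bil_mult[OF T(1) lin_id] x(1)]
      by (rule H.T.sw_cong) (simp add: T)
    moreover have "sw dA a (\<lambda>u v. u * T v) = sw H.dT x (\<lambda>a b. fT a * gT b)"
      unfolding x(2)[symmetric] fT_comult[OF A.vs A.bil_mult[OF lin_id T(1)] x(1)]
      by (rule H.T.sw_cong) (simp add: T)
    ultimately show ?thesis using x by (simp add: gT_fT fT_counit[symmetric])
  qed
  with T show ?thesis by blast
qed

end

section \<open>From tensors to Sweedler sums\<close>

lemma vec_spaceD: "vec_space V \<Longrightarrow> vector_space (vscale V)" "vec_space V \<Longrightarrow> module.subspace (vscale V) (vspace V)"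
  by (simp_all add: vec_space_def)

lemma vscale_tensor_space: "vscale (tensor_space V W) = tscale"
  by (simp add: tensor_space_def)

lemma vec_space_zero: "vec_space V \<Longrightarrow> 0 \<in> vspace V"
  unfolding vec_space_def using module.subspace_0 module_iff_vector_space by blast

lemma vec_space_sum_list:
  assumes "vec_space V" "\<And>p. p \<in> set l \<Longrightarrow> g p \<in> vspace V"
  shows "(\<Sum>p\<leftarrow>l. g p) \<in> vspace V"
proof -
  interpret vector_space "vscale V" using assms(1) by (rule vec_spaceD)
  show ?thesis
    using assms(2) vec_spaceD(2)[OF assms(1)] by (induction l) (auto simp: subspace_0 subspace_add)
qed

lemma linear_map_0: "vec_space V \<Longrightarrow> linear_map V W f \<Longrightarrow> f 0 = (0 :: 'w::ab_group_add)"
  using vec_space_zero[of V] by (auto simp: linear_map_def dest!: bspec[of _ _ 0])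

lemma linear_map_sum_list:
  fixes f :: "'v::ab_group_add \<Rightarrow> 'w::ab_group_add"
  assumes V: "vec_space V" and f: "linear_map V W f" and g: "\<And>p. p \<in> set l \<Longrightarrow> g p \<in> vspace V"
  shows "f (\<Sum>p\<leftarrow>l. g p) = (\<Sum>p\<leftarrow>l. f (g p))"
  using g
proof (induction l)
  case Nil
  show ?case by (simp add: linear_map_0[OF V f])
next
  case (Cons a l)
  then have "(\<Sum>p\<leftarrow>l. g p) \<in> vspace V" "g a \<in> vspace V" by (auto intro: vec_space_sum_list[OF V])
  with Cons f show ?case by (simp add: linear_map_def)
qed

lemma tens_in: "v \<in> vspace V \<Longrightarrow> w \<in> vspace W \<Longrightarrow> tens V W v w \<in> vspace (tensor_space V W)"
  by (simp add: vspace_tensor_space tens_eq_tn tn_in_tspace)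

lemma tensor_space_list:
  assumes "vec_space V" "x \<in> vspace (tensor_space V W)"
  shows "\<exists>l. (\<forall>p\<in>set l. fst p \<in> vspace V \<and> snd p \<in> vspace W) \<and> x = (\<Sum>p\<leftarrow>l. tens V W (fst p) (snd p))"
  using tspace_list[of "vscale V" "vspace V" x "vscale W" "vspace W"] assms
  by (simp add: vspace_tensor_space tens_eq_tn vec_space_def)

lemma tensor_lift_sum_list:
  assumes VW: "vec_space V" "vec_space W" "vec_space U" "bilinear_map V W U m"
    and l: "\<And>p. p \<in> set l \<Longrightarrow> F p \<in> vspace V \<and> G p \<in> vspace W"
  shows "tensor_lift V W U m (\<Sum>p\<leftarrow>l. tens V W (F p) (G p)) = (\<Sum>p\<leftarrow>l. m (F p) (G p))"
proof -
  have "tensor_lift V W U m (\<Sum>p\<leftarrow>l. tens V W (F p) (G p)) = (\<Sum>p\<leftarrow>l. tensor_lift V W U m (tens V W (F p) (G p)))"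
    using l by (intro linear_map_sum_list[OF vec_space_tensor linear_map_tensor_lift[OF VW]] tens_in) auto
  also have "\<dots> = (\<Sum>p\<leftarrow>l. m (F p) (G p))"
    by (intro arg_cong[of _ _ sum_list] map_cong refl tensor_lift_tens[OF VW]) (use l in auto)
  finally show ?thesis .
qed

lemma bilinear_mapI:
  assumes "bil (vscale V) (vscale W) (vscale U) m" "\<And>v w. v \<in> vspace V \<Longrightarrow> w \<in> vspace W \<Longrightarrow> m v w \<in> vspace U"
  shows "bilinear_map V W U m"
  using assms by (auto simp: bilinear_map_def linear_map_def bil_def lin_def)

lemma linear_map_compose_tens:
  assumes "linear_map U V f" "linear_map U' V' f'"
  shows "bilinear_map U U' (tensor_space V V') (\<lambda>x y. tens V V' (f x) (f' y))"
  using assms bil_tn[of "vscale V" "vscale V'"]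
  by (auto simp: bilinear_map_def linear_map_def bil_def lin_def tens_eq_tn vscale_tensor_space
      vspace_tensor_space tn_in_tspace)

text \<open>One fixed list for \<open>t\<close> turns the lift into a finite sum in which linearity
  in the parameter is visible term by term.\<close>

lemma linear_map_tensor_lift_param:
  assumes V: "vec_space V" and W: "vec_space W" and U: "vec_space U" and Z: "vec_space Z"
    and m: "\<And>z. z \<in> vspace Z \<Longrightarrow> bilinear_map V W U (m z)"
    and lin: "\<And>v w. v \<in> vspace V \<Longrightarrow> w \<in> vspace W \<Longrightarrow> linear_map Z U (\<lambda>z. m z v w)"
    and t: "t \<in> vspace (tensor_space V W)"
  shows "linear_map Z U (\<lambda>z. tensor_lift V W U (m z) t)"
proof -
  interpret U: vector_space "vscale U" using U by (rule vec_spaceD)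
  interpret Z: vector_space "vscale Z" using Z by (rule vec_spaceD)
  obtain l where l: "\<forall>p\<in>set l. fst p \<in> vspace V \<and> snd p \<in> vspace W" "t = (\<Sum>p\<leftarrow>l. tens V W (fst p) (snd p))"
    using tensor_space_list[OF V t] by blast
  have *: "tensor_lift V W U (m z) t = (\<Sum>p\<leftarrow>l. m z (fst p) (snd p))" if "z \<in> vspace Z" for z
    unfolding l(2) using l(1) by (intro tensor_lift_sum_list[OF V W U m[OF that]]) auto
  have **: "linear_map Z U (\<lambda>z. \<Sum>p\<leftarrow>l. m z (fst p) (snd p))"
    using l(1) lin
  proof (induction l)
    case Nil
    show ?case using vec_space_zero[OF U] by (simp add: linear_map_def)
  next
    case (Cons a l)
    then have "linear_map Z U (\<lambda>z. \<Sum>p\<leftarrow>l. m z (fst p) (snd p))" "linear_map Z U (\<lambda>z. m z (fst a) (snd a))" by auto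
    then show ?case
      using U.subspace_add[OF vec_spaceD(2)[OF U]] by (simp add: linear_map_def algebra_simps)
  qed
  have "x + y \<in> vspace Z" "vscale Z a x \<in> vspace Z" if "x \<in> vspace Z" "y \<in> vspace Z" for x y a
    using that Z.subspace_add[OF vec_spaceD(2)[OF Z]] Z.subspace_scale[OF vec_spaceD(2)[OF Z]] by auto
  then show ?thesis using ** by (simp add: linear_map_def *)
qed

section \<open>Coalgebras as instances of the Sweedler calculus\<close>

definition cproj :: "('k::field, 'c::ab_group_add, 'z) coalg_scheme \<Rightarrow> 'c \<Rightarrow> 'c" where
  "cproj C = (SOME Q. lin (vscale C) (vscale C) Q \<and> (\<forall>x. Q x \<in> vspace C) \<and> (\<forall>x\<in>vspace C. Q x = x))"

definition clist :: "('k::field, 'c::ab_group_add, 'z) coalg_scheme \<Rightarrow> 'c \<Rightarrow> ('c \<times> 'c) list" where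
  "clist C c = (SOME l. (\<forall>p\<in>set l. fst p \<in> vspace C \<and> snd p \<in> vspace C) \<and>
     comult C (cproj C c) = (\<Sum>p\<leftarrow>l. tens C C (fst p) (snd p)))"

context
  fixes C :: "('k::field, 'c::ab_group_add, 'z) coalg_scheme"
  assumes C: "coalgebra C"
begin

lemma coalgebra_vec_space: "vec_space C"
  using C by (simp add: coalgebra_def)

lemma cproj: "lin (vscale C) (vscale C) (cproj C)" "cproj C x \<in> vspace C" "x \<in> vspace C \<Longrightarrow> cproj C x = x"
proof -
  have "\<exists>Q. lin (vscale C) (vscale C) Q \<and> (\<forall>x. Q x \<in> vspace C) \<and> (\<forall>x\<in>vspace C. Q x = x)"
    using subspace_projection[OF vec_spaceD[OF coalgebra_vec_space]] by metis
  from someI_ex[OF this]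
  show "lin (vscale C) (vscale C) (cproj C)" "cproj C x \<in> vspace C" "x \<in> vspace C \<Longrightarrow> cproj C x = x"
    unfolding cproj_def by blast+
qed

lemma clist:
  "p \<in> set (clist C c) \<Longrightarrow> fst p \<in> vspace C \<and> snd p \<in> vspace C"
  "comult C (cproj C c) = (\<Sum>p\<leftarrow>clist C c. tens C C (fst p) (snd p))"
proof -
  have "comult C (cproj C c) \<in> vspace (tensor_space C C)"
    using C cproj(2) by (simp add: coalgebra_def linear_map_def)
  from someI_ex[OF tensor_space_list[OF coalgebra_vec_space this]]
  show "p \<in> set (clist C c) \<Longrightarrow> fst p \<in> vspace C \<and> snd p \<in> vspace C"
    "comult C (cproj C c) = (\<Sum>p\<leftarrow>clist C c. tens C C (fst p) (snd p))"
    unfolding clist_def by blast+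
qed

lemma comult_clist: "c \<in> vspace C \<Longrightarrow> comult C c = (\<Sum>p\<leftarrow>clist C c. tens C C (fst p) (snd p))"
  using clist(2)[of c] cproj(3) by simp

lemma tensor_lift_comult:
  assumes "vec_space U" "bilinear_map C C U m" "c \<in> vspace C"
  shows "tensor_lift C C U m (comult C c) = sw (clist C) c m"
  unfolding comult_clist[OF assms(3)] sw_def
  by (rule tensor_lift_sum_list[OF coalgebra_vec_space coalgebra_vec_space assms(1,2)]) (rule clist(1))

lemma sweedler_clist:
  assumes "vec_space U" "bilinear_map C C U m" "c \<in> vspace C"
  shows "sweedler C U m c = sw (clist C) c m"
  unfolding sweedler_def by (rule tensor_lift_comult[OF assms])

text \<open>In the tensor model a tensor is evaluated at a form, so independence of the chosen list
  is immediate.\<close>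

lemma sw_clist_form:
  assumes "bil (vscale C) (vscale C) (*) m"
  shows "sw (clist C) c m = tensor_app (comult C (cproj C c)) m"
  by (simp add: clist(2) sw_def lin_sum_list[OF lin_tensor_app] tens_eq_tn tensor_app_tn[OF assms])

text \<open>Coassociativity is an equation between nested tensors. Evaluating it at a bilinear form
  \<open>\<beta>\<close> on C \<times> (C \<otimes> C) with \<beta>(a, v \<otimes> w) = m(a, v, w)
  gives the scalar identity.\<close>

lemma clist_coassoc:
  fixes m :: "'c \<Rightarrow> 'c \<Rightarrow> 'c \<Rightarrow> 'k"
  assumes m: "tril (vscale C) (vscale C) (vscale C) (*) m"
  shows "sw (clist C) c (\<lambda>a b. sw (clist C) a (\<lambda>a1 a2. m a1 a2 b)) = sw (clist C) c (\<lambda>a b. sw (clist C) b (m a))"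
proof -
  let ?s = "vscale C" and ?T = "tensor_space C C" and ?l = "clist C c"
  note vC = coalgebra_vec_space
  have c: "cproj C c \<in> vspace C" by (rule cproj(2))
  have comult: "linear_map C ?T (comult C)" using C by (simp add: coalgebra_def)
  have cin: "comult C x \<in> vspace ?T" if "x \<in> vspace C" for x
    using comult that by (simp add: linear_map_def)
  have id: "linear_map C C id" by (simp add: linear_map_def)
  have 1: "tensor_map C C ?T C (comult C) id (comult C (cproj C c)) = (\<Sum>p\<leftarrow>?l. tens ?T C (comult C (fst p)) (snd p))"
    unfolding tensor_map_def clist(2)
    by (subst tensor_lift_sum_list[OF vC vC vec_space_tensor linear_map_compose_tens[OF comult id]])
      (use clist(1) in auto)
  have 2: "tensor_map C C C ?T id (comult C) (comult C (cproj C c)) = (\<Sum>p\<leftarrow>?l. tens C ?T (fst p) (comult C (snd p)))"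
    unfolding tensor_map_def clist(2)
    by (subst tensor_lift_sum_list[OF vC vC vec_space_tensor linear_map_compose_tens[OF id comult]])
      (use clist(1) in auto)
  let ?W = "tensor_space C ?T"
  let ?n = "\<lambda>w u v. tens C ?T u (tens C C v w)"
  have n_bil: "bil ?s ?s tscale (\<lambda>u v. ?n w u v)" and n_lin: "lin ?s tscale (\<lambda>w. ?n w u v)" for u v w
    unfolding tens_eq_tn vscale_tensor_space
    by (intro bilI bil1[OF bil_tn] lin_comp[OF bil2[OF bil_tn]] bil2[OF bil_tn])+
  have n_in: "?n w u v \<in> vspace ?W" if "w \<in> vspace C" "u \<in> vspace C" "v \<in> vspace C" for u v w
    using that by (intro tens_in)
  have n: "bilinear_map C C ?W (?n w)" if "w \<in> vspace C" for w
    using n_bil n_in that by (intro bilinear_mapI) (simp_all add: vscale_tensor_space)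
  have nl: "linear_map C ?W (\<lambda>w. ?n w u v)" if "u \<in> vspace C" "v \<in> vspace C" for u v
    using n_lin n_in that by (simp add: linear_map_def lin_def vscale_tensor_space)
  have outer: "bilinear_map ?T C ?W (\<lambda>t w. tensor_lift C C ?W (?n w) t)"
    unfolding bilinear_map_def
    using linear_map_tensor_lift[OF vC vC vec_space_tensor n]
      linear_map_tensor_lift_param[OF vC vC vec_space_tensor vC n nl] by blast
  have "(\<Sum>p\<leftarrow>?l. sw (clist C) (fst p) (?n (snd p))) = (\<Sum>p\<leftarrow>?l. tensor_lift C C ?W (?n (snd p)) (comult C (fst p)))"
    using clist(1)[of _ c] by (intro arg_cong[of _ _ sum_list] map_cong refl)
      (simp add: tensor_lift_comult[OF vec_space_tensor n])
  also have "\<dots> = tensor_assoc C C C (\<Sum>p\<leftarrow>?l. tens ?T C (comult C (fst p)) (snd p))"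
    unfolding tensor_assoc_def
    by (rule tensor_lift_sum_list[OF vec_space_tensor vC vec_space_tensor outer, symmetric])
      (use clist(1)[of _ c] cin in auto)
  also have "\<dots> = (\<Sum>p\<leftarrow>?l. tens C ?T (fst p) (comult C (snd p)))"
    using C c unfolding 1[symmetric] 2[symmetric] coalgebra_def by blast
  finally have eq: "(\<Sum>p\<leftarrow>?l. sw (clist C) (fst p) (?n (snd p))) = (\<Sum>p\<leftarrow>?l. tens C ?T (fst p) (comult C (snd p)))" .
  have ma: "bil ?s ?s (*) (m a)" for a using m by (simp add: tril_def bil_def)
  have vs: "vector_space ?s" using vC by (rule vec_spaceD)
  then have sUNIV: "module.subspace ?s UNIV" by (simp add: module.subspace_UNIV module_iff_vector_space)
  \<comment> \<open>An inhabitant of the tensor type is an arbitrary function on forms, so its value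
    at \<open>m a\<close> need not be linear in a. On the span of elementary tensors it is, hence
    the projection.\<close>
  obtain Q where Q: "lin tscale tscale Q" "\<And>x. Q x \<in> tspace ?s ?s UNIV UNIV"
    "\<And>x. x \<in> tspace ?s ?s UNIV UNIV \<Longrightarrow> Q x = x"
    using subspace_projection[OF vector_space_tscale tspace_subspace] by metis
  define \<beta> where "\<beta> a t = tensor_app (Q t) (m a)" for a t
  have "lin ?s (*) (\<lambda>a. \<beta> a t)" for t
  proof -
    obtain l where l: "Q t = (\<Sum>p\<leftarrow>l. tn ?s ?s (fst p) (snd p))"
      using tspace_list[OF sUNIV vs Q(2)] by blast
    show ?thesis
      unfolding \<beta>_def l lin_sum_list[OF lin_tensor_app] tensor_app_tn[OF ma]
      using m by (intro lin_sum vector_space_field) (simp add: tril_def)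
  qed
  then have beta: "bil ?s tscale (*) \<beta>"
    using lin_comp[OF lin_tensor_app Q(1)] by (simp add: bil_def \<beta>_def[abs_def])
  have beta_tn: "\<beta> a (tn ?s ?s v w) = m a v w" for a v w
    by (simp add: \<beta>_def Q(3) tn_in_tspace tensor_app_tn[OF ma])
  have beta_comult: "\<beta> a (comult C b) = sw (clist C) b (m a)" if "b \<in> vspace C" for a b
  proof -
    have "comult C b \<in> tspace ?s ?s UNIV UNIV"
      unfolding comult_clist[OF that] tens_eq_tn
      using vec_space_sum_list[OF vec_space_tensor, of "clist C b" "\<lambda>p. tn ?s ?s (fst p) (snd p)"
        "\<lparr>vscale = ?s, vspace = UNIV\<rparr>" "\<lparr>vscale = ?s, vspace = UNIV\<rparr>"]
      by (simp add: vspace_tensor_space tn_in_tspace)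
    then show ?thesis
      by (simp add: \<beta>_def Q(3) sw_clist_form[OF ma] cproj(3)[OF that])
  qed
  have "(\<Sum>p\<leftarrow>?l. sw (clist C) (fst p) (\<lambda>u v. m u v (snd p))) = tensor_app (\<Sum>p\<leftarrow>?l. sw (clist C) (fst p) (?n (snd p))) \<beta>"
    by (simp add: lin_sum_list[OF lin_tensor_app] lin_sw_right[OF lin_tensor_app] tens_eq_tn vscale_tensor_space
        tensor_app_tn[OF beta] beta_tn)
  also have "\<dots> = (\<Sum>p\<leftarrow>?l. sw (clist C) (snd p) (m (fst p)))"
    using clist(1)[of _ c] unfolding eq
    by (simp add: lin_sum_list[OF lin_tensor_app] tens_eq_tn vscale_tensor_space
        tensor_app_tn[OF beta] beta_comult cong: map_cong)
  finally show ?thesis by (simp add: sw_def[of "clist C" c])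
qed

lemma linear_counit: "lin (vscale C) (*) (\<lambda>c. counit C (cproj C c))"
  using C cproj(2) by (simp add: coalgebra_def linear_map_def base_field_def lin_def lin_add[OF cproj(1)] lin_scale[OF cproj(1)])

lemma coal_coalgebra: "coal (vscale C) (vspace C) (cproj C) (clist C) (\<lambda>c. counit C (cproj C c))"
proof (rule coal.intro)
  note vC = coalgebra_vec_space
  interpret vector_space "vscale C" using vC by (rule vec_spaceD)
  show "vector_space (vscale C)" "module.subspace (vscale C) (vspace C)" using vC by (rule vec_spaceD)+
  show "lin (vscale C) (*) (\<lambda>c. sw (clist C) c m)" if m: "bil (vscale C) (vscale C) (*) m" for m
  proof -
    have "comult C (cproj C (x + y)) = comult C (cproj C x) + comult C (cproj C y)"
      "comult C (cproj C (vscale C a x)) = tscale a (comult C (cproj C x))" for x y a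
      using C cproj(2) by (simp_all add: coalgebra_def linear_map_def lin_add[OF cproj(1)] lin_scale[OF cproj(1)] vscale_tensor_space)
    then have "lin (vscale C) tscale (\<lambda>c. comult C (cproj C c))" by (intro linI)
    then show ?thesis unfolding sw_clist_form[OF m] by (rule lin_comp[OF lin_tensor_app])
  qed
  show "sw (clist C) (cproj C c) m = sw (clist C) c m" if m: "bil (vscale C) (vscale C) (*) m" for m c
    by (simp add: sw_clist_form[OF m] cproj)
  have b: "bil (vscale C) (vscale C) (vscale C) (\<lambda>a b. vscale C (counit C (cproj C a)) b)"
    "bil (vscale C) (vscale C) (vscale C) (\<lambda>a b. vscale C (counit C (cproj C b)) a)"
    by (intro bilI lin_scale_const lin_scale_var linear_counit lin_id vector_space_axioms)+
  have sub: "vscale C a x \<in> vspace C" if "x \<in> vspace C" for a x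
    using that vec_spaceD(2)[OF vC] by (rule subspace_scale[rotated])
  have eq: "bilinear_map C C C (\<lambda>a b. vscale C (counit C a) b)" "bilinear_map C C C (\<lambda>a b. vscale C (counit C b) a)"
    using C sub by (auto simp: bilinear_map_def linear_map_def coalgebra_def base_field_def algebra_simps)
  have cong: "sw (clist C) c m = sw (clist C) c n" if "\<And>a b. a \<in> vspace C \<Longrightarrow> b \<in> vspace C \<Longrightarrow> m a b = n a b"
    for c and m n :: "'c \<Rightarrow> 'c \<Rightarrow> 'c"
    unfolding sw_def by (intro arg_cong[of _ _ sum_list] map_cong refl that) (auto dest: clist(1))
  show "sw (clist C) c (\<lambda>a b. vscale C (counit C (cproj C a)) b) = c" if "c \<in> vspace C" for c
  proof -
    have "sw (clist C) c (\<lambda>a b. vscale C (counit C (cproj C a)) b) = sw (clist C) c (\<lambda>a b. vscale C (counit C a) b)"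
      by (rule cong) (simp add: cproj)
    then show ?thesis using C that sweedler_clist[OF vC eq(1) that] by (simp add: coalgebra_def)
  qed
  show "sw (clist C) c (\<lambda>a b. vscale C (counit C (cproj C b)) a) = c" if "c \<in> vspace C" for c
  proof -
    have "sw (clist C) c (\<lambda>a b. vscale C (counit C (cproj C b)) a) = sw (clist C) c (\<lambda>a b. vscale C (counit C b) a)"
      by (rule cong) (simp add: cproj)
    then show ?thesis using C that sweedler_clist[OF vC eq(2) that] by (simp add: coalgebra_def)
  qed
qed (rule cproj clist(1) clist_coassoc linear_counit; assumption)+

end

context
  fixes C :: "('k::field, 'c::ab_group_add, 'z) coalg_scheme"
  assumes C: "coalgebra C"
begin

interpretation coal "vscale C" "vspace C" "cproj C" "clist C" "\<lambda>c. counit C (cproj C c)"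
  by (rule coal_coalgebra[OF C])

text \<open>From actions to tensors: for a projection Q onto \<open>E\<close>, \<Delta>(x) equals (Q
  \<otimes> Q) \<Delta>(x). Conversely, contractions of a list with entries in \<open>E\<close> stay
  in \<open>E\<close>.\<close>

lemma subcoalgebra_iff_sub: "subcoalgebra C E \<longleftrightarrow> sub E"
proof
  assume E: "subcoalgebra C E"
  have EV: "E \<subseteq> vspace C" and sE: "subspace E" using E by (auto simp: subcoalgebra_def)
  show "sub E"
    unfolding sub_def
  proof (intro conjI allI impI sE EV)
    fix \<phi> x assume phi: "lin (vscale C) (*) \<phi>" and x: "x \<in> E"
    have "comult C x \<in> tspace (vscale C) (vscale C) E E"
      using E x by (simp add: subcoalgebra_def vspace_tensor_space)
    then obtain l where l: "\<forall>p\<in>set l. fst p \<in> E \<and> snd p \<in> E"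
      "comult C x = (\<Sum>p\<leftarrow>l. tn (vscale C) (vscale C) (fst p) (snd p))"
      using tspace_list[OF sE vs] by blast
    have form: "sw (clist C) x m = (\<Sum>p\<leftarrow>l. m (fst p) (snd p))" if m: "bil (vscale C) (vscale C) (*) m" for m
      using x EV by (simp add: sw_clist_form[OF C m] cproj(3)[OF C] subsetD l(2) lin_sum_list[OF lin_tensor_app] tensor_app_tn[OF m])
    have gen: "sw (clist C) x m = (\<Sum>p\<leftarrow>l. m (fst p) (snd p))" if m: "bil (vscale C) (vscale C) (vscale C) m" for m
    proof (rule eq_by_functionals[OF vs])
      fix \<psi> assume psi: "lin (vscale C) (*) \<psi>"
      have "bil (vscale C) (vscale C) (*) (\<lambda>a b. \<psi> (m a b))"
        by (intro bilI lin_comp[OF psi] bil1[OF m] bil2[OF m])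
      from form[OF this] show "\<psi> (sw (clist C) x m) = \<psi> (\<Sum>p\<leftarrow>l. m (fst p) (snd p))"
        by (simp add: lin_sw_right[OF psi] lin_sum_list[OF psi])
    qed
    show "lact \<phi> x \<in> E"
      unfolding lact_def gen[OF bil_lact[OF phi lin_id vs]]
      using l(1) by (intro sum_list_in_subspace sE subspace_scale) auto
    show "ract \<phi> x \<in> E"
      unfolding ract_def gen[OF bil_ract[OF phi lin_id vs]]
      using l(1) by (intro sum_list_in_subspace sE subspace_scale) auto
  qed
next
  assume E: "sub E"
  note E' = subD[OF E]
  obtain Q where Q: "lin (vscale C) (vscale C) Q" "\<And>x. Q x \<in> E" "\<And>x. x \<in> E \<Longrightarrow> Q x = x"
    using subspace_projection[OF vs E'(1)] by metis
  have "comult C x \<in> tspace (vscale C) (vscale C) E E" if x: "x \<in> E" for x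
  proof -
    have "comult C x = sw (clist C) x (tn (vscale C) (vscale C))"
      using comult_clist[OF C E'(2)[OF x]] by (simp add: sw_def tens_eq_tn)
    also have "\<dots> = sw (clist C) x (\<lambda>a b. tn (vscale C) (vscale C) (Q a) (Q b))"
      by (rule sw_project[OF Q(1,3) vector_space_tscale bil_tn E x, symmetric])
    also have "\<dots> \<in> tspace (vscale C) (vscale C) E E"
      unfolding sw_def using vec_space_sum_list[OF vec_space_tensor, of "clist C x" "\<lambda>p. tn (vscale C) (vscale C) (Q (fst p)) (Q (snd p))"
          "C\<lparr>vspace := E\<rparr>" "C\<lparr>vspace := E\<rparr>"] Q(2)
      by (simp add: vspace_tensor_space tn_in_tspace)
    finally show ?thesis .
  qed
  then show "subcoalgebra C E" using E' by (auto simp: subcoalgebra_def vspace_tensor_space)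
qed

lemma simple_subcoalgebra_wedge_prime:
  assumes "wedge_prime E" "findim (vscale C) E"
  shows "simple_subcoalgebra C E"
  using assms wedge_prime_simple[OF assms(2,1)]
  by (auto simp: simple_subcoalgebra_def subcoalgebra_iff_sub wedge_prime_def)

text \<open>A finite-dimensional prime \<open>E\<close> is simple, hence inside the coradical.
  \<open>tensor_flip\<close> is specified only on tensors of the coradical, so \<Delta>(x) is first
  written with entries in \<open>E\<close>.\<close>

lemma cocommutative_wedge_prime:
  assumes co: "cocommutative (coradical C)" and E: "wedge_prime E" "findim (vscale C) E"
    and x: "x \<in> E" and m: "bil (vscale C) (vscale C) (*) m"
  shows "sw (clist C) x (\<lambda>a b. m b a) = sw (clist C) x m"
proof -
  let ?R = "coradical C"
  have R: "vscale ?R = vscale C" "comult ?R = comult C" "vspace ?R = span (\<Union>{D. simple_subcoalgebra C D})"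
    by (simp_all add: coradical_def)
  have vR: "vec_space ?R" by (simp add: vec_space_def R vs subspace_span)
  have ER: "E \<subseteq> vspace ?R"
    using simple_subcoalgebra_wedge_prime[OF E] unfolding R by (intro order_trans[OF _ span_superset]) blast
  have subE: "subcoalgebra C E" using simple_subcoalgebra_wedge_prime[OF E] by (simp add: simple_subcoalgebra_def)
  then have "comult C x \<in> tspace (vscale C) (vscale C) E E" and sE: "subspace E"
    using x by (simp_all add: subcoalgebra_def vspace_tensor_space)
  then obtain l where l: "\<forall>p\<in>set l. fst p \<in> E \<and> snd p \<in> E"
    "comult C x = (\<Sum>p\<leftarrow>l. tens ?R ?R (fst p) (snd p))"
    using tspace_list[OF sE vs] unfolding tens_eq_tn R by blast
  have "bilinear_map ?R ?R (tensor_space ?R ?R) (\<lambda>v w. tens ?R ?R w v)"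
    by (rule bilinear_mapI) (simp_all add: tens_in tens_eq_tn vscale_tensor_space bil_flip[OF bil_tn] vspace_tensor_space tn_in_tspace)
  then have "tensor_flip ?R ?R (comult C x) = (\<Sum>p\<leftarrow>l. tens ?R ?R (snd p) (fst p))"
    unfolding tensor_flip_def l(2)
    by (intro tensor_lift_sum_list vR vec_space_tensor) (use l(1) ER in auto)
  moreover have "tensor_flip ?R ?R (comult C x) = comult C x"
    using co x ER by (auto simp: cocommutative_def R)
  ultimately have eq: "comult C x = (\<Sum>p\<leftarrow>l. tens ?R ?R (snd p) (fst p))" by simp
  have xV: "cproj C x = x" using subE x by (intro cproj(3)[OF C]) (auto simp: subcoalgebra_def)
  have "sw (clist C) x (\<lambda>a b. m b a) = (\<Sum>p\<leftarrow>l. m (snd p) (fst p))"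
    unfolding sw_clist_form[OF C bil_flip[OF m]] xV l(2)
    by (simp add: lin_sum_list[OF lin_tensor_app] tens_eq_tn R tensor_app_tn[OF bil_flip[OF m]])
  moreover have "sw (clist C) x m = (\<Sum>p\<leftarrow>l. m (snd p) (fst p))"
    unfolding sw_clist_form[OF C m] xV eq
    by (simp add: lin_sum_list[OF lin_tensor_app] tens_eq_tn R tensor_app_tn[OF m])
  ultimately show ?thesis by simp
qed

lemma linear_map_sw:
  fixes L :: "'u::ab_group_add \<Rightarrow> 'w::ab_group_add"
  assumes "vec_space U" "linear_map U W L" "\<And>a b. a \<in> vspace C \<Longrightarrow> b \<in> vspace C \<Longrightarrow> m a b \<in> vspace U"
  shows "L (sw (clist C) c m) = sw (clist C) c (\<lambda>a b. L (m a b))"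
  unfolding sw_def by (rule linear_map_sum_list[OF assms(1,2)]) (use clist(1)[OF C] assms(3) in auto)

lemma sw_in_vspace:
  assumes "vec_space U" "\<And>a b. a \<in> vspace C \<Longrightarrow> b \<in> vspace C \<Longrightarrow> m a b \<in> vspace U"
  shows "sw (clist C) c m \<in> vspace U"
  unfolding sw_def by (rule vec_space_sum_list[OF assms(1)]) (use clist(1)[OF C] assms(2) in auto)

lemma linear_map_sweedler:
  assumes "vec_space U" "bilinear_map C C U m"
  shows "linear_map C U (sweedler C U m)"
  using C linear_map_tensor_lift[OF coalgebra_vec_space[OF C] coalgebra_vec_space[OF C] assms]
  by (simp add: linear_map_def coalgebra_def sweedler_def)

lemma linear_map_sweedler_param:
  assumes "vec_space U" "vec_space Z" "\<And>z. z \<in> vspace Z \<Longrightarrow> bilinear_map C C U (m z)"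
    "\<And>v w. v \<in> vspace C \<Longrightarrow> w \<in> vspace C \<Longrightarrow> linear_map Z U (\<lambda>z. m z v w)" "c \<in> vspace C"
  shows "linear_map Z U (\<lambda>z. sweedler C U (m z) c)"
  unfolding sweedler_def
  using C assms by (intro linear_map_tensor_lift_param coalgebra_vec_space[OF C]) (auto simp: coalgebra_def linear_map_def)

end

section \<open>The coproduct of the tensor product coalgebra\<close>

lemma tensor_coalg_sel:
  "vscale (tensor_coalg B C) = tscale"
  "vspace (tensor_coalg B C) = vspace (tensor_space B C)"
  "counit (tensor_coalg B C) = tensor_lift B C base_field (\<lambda>b c. counit B b * counit C c)"
  "comult (tensor_coalg B C) = tensor_lift B C (tensor_space (tensor_space B C) (tensor_space B C))
     (\<lambda>b c. sweedler B (tensor_space (tensor_space B C) (tensor_space B C)) (\<lambda>b1 b2.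
        sweedler C (tensor_space (tensor_space B C) (tensor_space B C)) (\<lambda>c1 c2.
          tens (tensor_space B C) (tensor_space B C) (tens B C b1 c1) (tens B C b2 c2)) c) b)"
  by (simp_all add: tensor_coalg_def Let_def vscale_tensor_space)

lemma vec_space_base_field: "vec_space (base_field :: ('k::field, 'k) vsp)"
  by (simp add: vec_space_def base_field_def vector_space_field module.subspace_UNIV module_iff_vector_space)

text \<open>A lift has a known value only once its argument is bilinear between the carriers, so
  each nested lift in \<open>tensor_coalg\<close> is justified before it is evaluated.\<close>

lemma comult_tensor_coalg:
  fixes B :: "('k::field, 'b::ab_group_add, 'y) coalg_scheme" and C :: "('k, 'c::ab_group_add, 'z) coalg_scheme"
  assumes B: "coalgebra B" and C: "coalgebra C" and b: "b \<in> vspace B" and c: "c \<in> vspace C"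
  shows "comult (tensor_coalg B C) (tens B C b c) = sw (clist B) b (\<lambda>b1 b2. sw (clist C) c (\<lambda>c1 c2.
     tens (tensor_space B C) (tensor_space B C) (tens B C b1 c1) (tens B C b2 c2)))"
proof -
  let ?T = "tensor_space B C" let ?TT = "tensor_space ?T ?T"
  let ?n = "\<lambda>b1 b2 c1 c2. tens ?T ?T (tens B C b1 c1) (tens B C b2 c2)"
  note vB = coalgebra_vec_space[OF B] and vC = coalgebra_vec_space[OF C]
  have n_in: "?n b1 b2 c1 c2 \<in> vspace ?TT" if "b1 \<in> vspace B" "b2 \<in> vspace B" "c1 \<in> vspace C" "c2 \<in> vspace C" for b1 b2 c1 c2
    using that by (intro tens_in)
  have l1: "lin (vscale B) tscale (\<lambda>b1. ?n b1 b2 c1 c2)" "lin (vscale B) tscale (\<lambda>b2. ?n b1 b2 c1 c2)"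
    "lin (vscale C) tscale (\<lambda>c1. ?n b1 b2 c1 c2)" "lin (vscale C) tscale (\<lambda>c2. ?n b1 b2 c1 c2)" for b1 b2 c1 c2
    unfolding tens_eq_tn vscale_tensor_space
    by (intro lin_comp[OF bil1[OF bil_tn]] lin_comp[OF bil2[OF bil_tn]] bil1[OF bil_tn] bil2[OF bil_tn])+
  have nC: "bilinear_map C C ?TT (?n b1 b2)" if "b1 \<in> vspace B" "b2 \<in> vspace B" for b1 b2
    using that n_in l1 by (intro bilinear_mapI bilI) (simp_all add: vscale_tensor_space)
  have nB: "linear_map B ?TT (\<lambda>b1. ?n b1 b2 c1 c2)" "linear_map B ?TT (\<lambda>b2. ?n b3 b2 c1 c2)"
    if "b2 \<in> vspace B" "b3 \<in> vspace B" "c1 \<in> vspace C" "c2 \<in> vspace C" for b2 b3 c1 c2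
    using that n_in l1 by (auto simp: linear_map_def lin_def vscale_tensor_space)
  have in1: "bilinear_map B B ?TT (\<lambda>b1 b2. sweedler C ?TT (?n b1 b2) c)" if "c \<in> vspace C" for c
    unfolding bilinear_map_def
  proof (intro conjI ballI)
    fix b2 assume "b2 \<in> vspace B"
    then show "linear_map B ?TT (\<lambda>b1. sweedler C ?TT (?n b1 b2) c)"
      by (intro linear_map_sweedler_param[OF C vec_space_tensor vB nC nB(1) that])
  next
    fix b1 assume "b1 \<in> vspace B"
    then show "linear_map B ?TT (\<lambda>b2. sweedler C ?TT (?n b1 b2) c)"
      by (intro linear_map_sweedler_param[OF C vec_space_tensor vB nC nB(2) that])
  qed
  have "bilinear_map B C ?TT (\<lambda>b c. sweedler B ?TT (\<lambda>b1 b2. sweedler C ?TT (?n b1 b2) c) b)"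
    unfolding bilinear_map_def
  proof (intro conjI ballI)
    show "linear_map B ?TT (\<lambda>b. sweedler B ?TT (\<lambda>b1 b2. sweedler C ?TT (?n b1 b2) c) b)" if "c \<in> vspace C" for c
      using linear_map_sweedler[OF B vec_space_tensor in1[OF that]] by simp
    show "linear_map C ?TT (\<lambda>c. sweedler B ?TT (\<lambda>b1 b2. sweedler C ?TT (?n b1 b2) c) b)" if "b \<in> vspace B" for b
      by (rule linear_map_sweedler_param[OF B vec_space_tensor vC in1 _ that])
        (use linear_map_sweedler[OF C vec_space_tensor nC] in simp_all)
  qed
  from tensor_lift_tens[OF vB vC vec_space_tensor this b c]
  have "comult (tensor_coalg B C) (tens B C b c) = sweedler B ?TT (\<lambda>b1 b2. sweedler C ?TT (?n b1 b2) c) b"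
    by (simp add: tensor_coalg_sel)
  also have "\<dots> = sw (clist B) b (\<lambda>b1 b2. sweedler C ?TT (?n b1 b2) c)"
    by (rule sweedler_clist[OF B vec_space_tensor in1[OF c] b])
  also have "\<dots> = sw (clist B) b (\<lambda>b1 b2. sw (clist C) c (?n b1 b2))"
    by (rule coal.sw_cong[OF coal_coalgebra[OF B]]) (rule sweedler_clist[OF C vec_space_tensor nC c])
  finally show ?thesis .
qed

section \<open>Bialgebras as instances of the Sweedler calculus\<close>

context
  fixes A :: "('k::field, 'a::ring_1, 'z) coalg_scheme"
  assumes A: "bialgebra A"
begin

lemma bialgebra_coalgebra: "coalgebra A" and bialgebra_UNIV: "vspace A = UNIV"
  using A by (auto simp: bialgebra_def)

lemma bialgebra_cproj: "cproj A = (\<lambda>x. x)"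
  using cproj(3)[OF bialgebra_coalgebra] by (auto simp: bialgebra_UNIV)

lemma alg_coal_bialgebra: "alg_coal (vscale A) (clist A) (counit A)"
proof -
  have "coal (vscale A) UNIV (\<lambda>x. x) (clist A) (counit A)"
    using coal_coalgebra[OF bialgebra_coalgebra] by (simp add: bialgebra_cproj bialgebra_UNIV)
  moreover have "alg_coal_axioms (vscale A)"
    by (intro alg_coal_axioms.intro) (use A in \<open>metis bialgebra_def\<close>)+
  ultimately show ?thesis by (rule alg_coal.intro)
qed

interpretation alg_coal "vscale A" "clist A" "counit A" by (rule alg_coal_bialgebra)

lemma sw_clist_comult: "bil (vscale A) (vscale A) (*) m \<Longrightarrow> sw (clist A) x m = tensor_app (comult A x) m"
  using sw_clist_form[OF bialgebra_coalgebra] by (simp add: bialgebra_cproj)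

lemma sweedler_bialgebra:
  "bil (vscale A) (vscale A) (vscale A) m \<Longrightarrow> sweedler A A m x = sw (clist A) x m"
  by (intro sweedler_clist bialgebra_coalgebra coalgebra_vec_space bilinear_mapI) (simp_all add: bialgebra_UNIV)

lemma bialgebra_sw_mult:
  assumes m: "bil (vscale A) (vscale A) (*) m"
  shows "sw (clist A) (x * y) m = sw (clist A) x (\<lambda>x1 x2. sw (clist A) y (\<lambda>y1 y2. m (x1 * y1) (x2 * y2)))"
proof -
  let ?T = "tensor_space A A" let ?n = "\<lambda>a b c d. tens A A (a * c) (b * d)"
  note cA = bialgebra_coalgebra and vA = coalgebra_vec_space[OF bialgebra_coalgebra]
  have n_in: "?n a b c d \<in> vspace ?T" for a b c d
    by (intro tens_in) (simp_all add: bialgebra_UNIV)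
  have l: "lin (vscale A) tscale (\<lambda>a. ?n a b c d)" "lin (vscale A) tscale (\<lambda>b. ?n a b c d)"
    "lin (vscale A) tscale (\<lambda>c. ?n a b c d)" "lin (vscale A) tscale (\<lambda>d. ?n a b c d)" for a b c d
    unfolding tens_eq_tn
    by (intro lin_comp[OF bil1[OF bil_tn]] lin_comp[OF bil2[OF bil_tn]] lin_mult_left lin_mult_right lin_id)+
  have lm: "linear_map A ?T k" if "lin (vscale A) tscale k" "\<And>z. k z \<in> vspace ?T" for k
    using that by (simp add: linear_map_def lin_def vscale_tensor_space)
  have inner: "bilinear_map A A ?T (?n a b)" for a b
    using n_in l by (intro bilinear_mapI bilI) (simp_all add: vscale_tensor_space)
  have yin: "comult A y \<in> vspace ?T"
    using cA by (simp add: coalgebra_def linear_map_def bialgebra_UNIV)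
  have outer: "bilinear_map A A ?T (\<lambda>a b. tensor_lift A A ?T (?n a b) (comult A y))"
    unfolding bilinear_map_def
    by (intro conjI ballI linear_map_tensor_lift_param[OF vA vA vec_space_tensor vA _ _ yin] inner lm l n_in)
  have "comult A (x * y) = tensor_mult A (comult A x) (comult A y)"
    using A by (simp add: bialgebra_def)
  also have "\<dots> = sw (clist A) x (\<lambda>a b. tensor_lift A A ?T (?n a b) (comult A y))"
    unfolding tensor_mult_def by (rule tensor_lift_comult[OF cA vec_space_tensor outer]) (simp add: bialgebra_UNIV)
  also have "\<dots> = sw (clist A) x (\<lambda>a b. sw (clist A) y (?n a b))"
    by (simp add: tensor_lift_comult[OF cA vec_space_tensor inner] bialgebra_UNIV)
  finally show ?thesis
    by (simp add: sw_clist_comult[OF m] lin_sw_right[OF lin_tensor_app] tens_eq_tn tensor_app_tn[OF m])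
qed

end

section \<open>The theorem\<close>

theorem theorem4p5:
  fixes A :: "('k::field, 'a::ring_1) coalg"
    and B :: "('k, 'b::ring_1) coalg"
    and C :: "('k, 'c::ab_group_add) coalg"
    and f :: "('k, 'b, 'c) tensor \<Rightarrow> 'a"
  assumes "bialgebra A" and "bialgebra B" and "coalgebra C"
    and "covering B C A f"
    and "hopf_algebra B" and "cocommutative (coradical B)"
  shows "hopf_algebra A"
proof -
  note A = assms(1) and B = assms(2) and C = assms(3)
  let ?T = "tensor_space B C"
  note cA = bialgebra_coalgebra[OF A] and cB = bialgebra_coalgebra[OF B]
  note vA = coalgebra_vec_space[OF cA] and vB = coalgebra_vec_space[OF cB] and vC = coalgebra_vec_space[OF C]
  interpret A: alg_coal "vscale A" "clist A" "counit A" by (rule alg_coal_bialgebra[OF A])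
  interpret B: alg_coal "vscale B" "clist B" "counit B" by (rule alg_coal_bialgebra[OF B])
  interpret C: coal "vscale C" "vspace C" "cproj C" "clist C" "\<lambda>c. counit C (cproj C c)"
    by (rule coal_coalgebra[OF C])
  obtain S where S: "antipode B S" using assms(5) by (auto simp: hopf_algebra_def)
  have f: "linear_map ?T A f" and measuring: "measuring B C A f" and cmap: "coalgebra_map (tensor_coalg B C) A f"
    and surj: "f ` vspace ?T = UNIV"
    using assms(4) by (auto simp: covering_def partial_covering_def measuring_def bialgebra_UNIV[OF A])
  have bT: "tens B C b c \<in> vspace ?T" if "c \<in> vspace C" for b c
    using that by (intro tens_in) (simp_all add: bialgebra_UNIV[OF B])
  \<comment> \<open>\<open>f\<close> is constrained on B \<otimes> C only; composing with
    \<open>cproj C\<close> makes \<open>h\<close> bilinear on the ambient types.\<close>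
  define h where "h b c = f (tens B C b (cproj C c))" for b c
  have h_eq: "f (tens B C b c) = h b c" if "c \<in> vspace C" for b c
    using that by (simp add: h_def C.P)
  have h: "bil (vscale B) (vscale C) (vscale A) h"
  proof -
    have "lin (vscale B) (vscale A) (\<lambda>b. f (tens B C b c))" if "c \<in> vspace C" for c
      using f bT[OF that] bil1[OF bil_tn, of "vscale B" "vscale C" c]
      by (simp add: linear_map_def lin_def tens_eq_tn vscale_tensor_space)
    moreover have "lin (vscale C) (vscale A) (\<lambda>c. f (tens B C b (cproj C c)))" for b
      using f bT[OF C.P(2)] lin_comp[OF bil2[OF bil_tn] C.P(1), of "vscale B" b]
      by (simp add: linear_map_def lin_def tens_eq_tn vscale_tensor_space)
    ultimately show ?thesis by (simp add: bil_def h_def[abs_def] C.P)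
  qed
  interpret covering_data "vscale A" "clist A" "counit A" "vscale B" "clist B" "counit B"
    "vscale C" "vspace C" "cproj C" "clist C" "\<lambda>c. counit C (cproj C c)" h S
  proof
    show "bil (vscale B) (vscale C) (vscale A) h" by (rule h)
    show "h (b * b') c = sw (clist C) c (\<lambda>c1 c2. h b c1 * h b' c2)" for b b' c
    proof -
      have m: "bil (vscale C) (vscale C) (vscale A) (\<lambda>c1 c2. h b c1 * h b' c2)"
        by (intro A.bil_mult bil2[OF h])
      have fm: "bilinear_map C C A (\<lambda>c1 c2. f (tens B C b c1) * f (tens B C b' c2))"
      proof -
        have "bilinear_map C C A (\<lambda>c1 c2. h b c1 * h b' c2)"
          by (rule bilinear_mapI[OF m]) (simp add: bialgebra_UNIV[OF A])
        then show ?thesis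
          using C.subspace_add[OF C.V] C.subspace_scale[OF C.V]
          by (simp add: bilinear_map_def linear_map_def h_eq)
      qed
      have "h (b * b') c = sweedler C A (\<lambda>c1 c2. f (tens B C b c1) * f (tens B C b' c2)) (cproj C c)"
        using measuring C.P(2) by (simp add: h_def measuring_def bialgebra_UNIV[OF B])
      also have "\<dots> = sw (clist C) (cproj C c) (\<lambda>c1 c2. f (tens B C b c1) * f (tens B C b' c2))"
        by (rule sweedler_clist[OF C vA fm C.P(2)])
      also have "\<dots> = sw (clist C) (cproj C c) (\<lambda>c1 c2. h b c1 * h b' c2)"
        by (rule C.sw_cong) (simp add: h_eq)
      also have "\<dots> = sw (clist C) c (\<lambda>c1 c2. h b c1 * h b' c2)"
        by (rule C.sw_P[OF A.vs m])
      finally show ?thesis .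
    qed
    show "h 1 c = vscale A (counit C (cproj C c)) 1" if "c \<in> vspace C" for c
      using measuring that by (simp add: h_def C.P measuring_def)
    show "sw (clist A) (h b c) m = sw (clist B) b (\<lambda>b1 b2. sw (clist C) c (\<lambda>c1 c2. m (h b1 c1) (h b2 c2)))"
      if m: "bil (vscale A) (vscale A) (*) m" for b c m
    proof -
      let ?TC = "tensor_coalg B C" let ?TT = "tensor_space ?TC ?TC"
      \<comment> \<open>\<open>tensor_coalg B C\<close> and \<open>tensor_space B C\<close> are
        different records with the same scalars and carrier, so their tensors coincide.\<close>
      have TT: "tens ?T ?T = tens ?TC ?TC" "vspace ?TT = vspace (tensor_space ?T ?T)"
        by (simp_all add: tens_eq_tn vspace_tensor_space[of ?TC] vspace_tensor_space[of ?T] tensor_coalg_sel vscale_tensor_space)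
      have vTC: "vec_space ?TC"
        using vec_space_tensor[of B C] by (simp add: vec_space_def tensor_coalg_sel vscale_tensor_space)
      have f': "linear_map ?TC A f"
        using f by (simp add: linear_map_def tensor_coalg_sel vscale_tensor_space)
      note ff = linear_map_compose_tens[OF f' f']
      have L: "linear_map ?TT (tensor_space A A) (tensor_map ?TC ?TC A A f f)"
        unfolding tensor_map_def by (rule linear_map_tensor_lift[OF vTC vTC vec_space_tensor ff])
      have L_tens: "tensor_map ?TC ?TC A A f f (tens ?TC ?TC x y) = tens A A (f x) (f y)"
        if "x \<in> vspace ?TC" "y \<in> vspace ?TC" for x y
        unfolding tensor_map_def by (rule tensor_lift_tens[OF vTC vTC vec_space_tensor ff that])
      have in_TC: "tens B C b c \<in> vspace ?TC" if "c \<in> vspace C" for b c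
        using bT[OF that] by (simp add: tensor_coalg_sel)
      have "comult A (h b c) = tensor_map ?TC ?TC A A f f (comult ?TC (tens B C b (cproj C c)))"
        using cmap in_TC[OF C.P(2)] by (simp add: coalgebra_map_def h_def)
      also have "comult ?TC (tens B C b (cproj C c)) = sw (clist B) b (\<lambda>b1 b2. sw (clist C) (cproj C c)
          (\<lambda>c1 c2. tens ?TC ?TC (tens B C b1 c1) (tens B C b2 c2)))"
        by (simp add: comult_tensor_coalg[OF cB C] bialgebra_UNIV[OF B] C.P(2) TT)
      also have "tensor_map ?TC ?TC A A f f \<dots> = sw (clist B) b (\<lambda>b1 b2. tensor_map ?TC ?TC A A f f (sw (clist C) (cproj C c)
          (\<lambda>c1 c2. tens ?TC ?TC (tens B C b1 c1) (tens B C b2 c2))))"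
        by (rule linear_map_sw[OF cB vec_space_tensor L])
          (intro sw_in_vspace[OF C vec_space_tensor] tens_in in_TC)
      also have "\<dots> = sw (clist B) b (\<lambda>b1 b2. sw (clist C) (cproj C c)
          (\<lambda>c1 c2. tensor_map ?TC ?TC A A f f (tens ?TC ?TC (tens B C b1 c1) (tens B C b2 c2))))"
        by (intro B.sw_cong linear_map_sw[OF C vec_space_tensor L] tens_in in_TC)
      also have "\<dots> = sw (clist B) b (\<lambda>b1 b2. sw (clist C) (cproj C c) (\<lambda>c1 c2. tens A A (h b1 c1) (h b2 c2)))"
        by (intro B.sw_cong C.sw_cong) (simp add: L_tens in_TC h_eq)
      finally have "sw (clist A) (h b c) m = sw (clist B) b (\<lambda>b1 b2. sw (clist C) (cproj C c) (\<lambda>c1 c2. m (h b1 c1) (h b2 c2)))"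
        by (simp add: sw_clist_comult[OF A m] lin_sw_right[OF lin_tensor_app] tens_eq_tn tensor_app_tn[OF m])
      also have "\<dots> = sw (clist B) b (\<lambda>b1 b2. sw (clist C) c (\<lambda>c1 c2. m (h b1 c1) (h b2 c2)))"
        by (intro B.sw_cong C.sw_P[OF vector_space_field] bilI lin_comp[OF bil1[OF m]] lin_comp[OF bil2[OF m]] bil2[OF h])
      finally show ?thesis .
    qed
    show "counit A (h b c) = counit B b * counit C (cproj C c)" if c: "c \<in> vspace C" for b c
    proof -
      have "bil (vscale B) (vscale C) (vscale base_field) (\<lambda>b c. counit B b * counit C (cproj C c))"
        unfolding base_field_def by (simp add: bilI lin_times_const lin_times_var B.e C.e)
      then have "bilinear_map B C base_field (\<lambda>b c. counit B b * counit C (cproj C c))"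
        by (rule bilinear_mapI) (simp add: base_field_def)
      then have "bilinear_map B C base_field (\<lambda>b c. counit B b * counit C c)"
        using C.subspace_add[OF C.V] C.subspace_scale[OF C.V]
        by (simp add: bilinear_map_def linear_map_def C.P)
      from tensor_lift_tens[OF vB vC vec_space_base_field this] c
      have "counit (tensor_coalg B C) (tens B C b c) = counit B b * counit C c"
        by (simp add: tensor_coalg_sel bialgebra_UNIV[OF B])
      then show ?thesis
        using cmap c bT[OF c] by (simp add: coalgebra_map_def h_def C.P tensor_coalg_sel)
    qed
    show "lin (vscale B) (vscale B) S"
      using S by (simp add: antipode_def linear_map_def lin_def bialgebra_UNIV[OF B])
    then have "bil (vscale B) (vscale B) (vscale B) (\<lambda>b1 b2. S b1 * b2)"
      "bil (vscale B) (vscale B) (vscale B) (\<lambda>b1 b2. b1 * S b2)"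
      by (intro B.bil_mult lin_id; assumption)+
    then show "sw (clist B) b (\<lambda>b1 b2. S b1 * b2) = vscale B (counit B b) 1"
      "sw (clist B) b (\<lambda>b1 b2. b1 * S b2) = vscale B (counit B b) 1" for b
      using S by (simp_all add: antipode_def flip: sweedler_bialgebra[OF B])
  qed (rule bialgebra_sw_mult[OF A] bialgebra_sw_mult[OF B]; assumption)+
  have "\<exists>T. lin (vscale A) (vscale A) T \<and> (\<forall>a. sw (clist A) a (\<lambda>u v. T u * v) = vscale A (counit A a) 1) \<and>
      (\<forall>a. sw (clist A) a (\<lambda>u v. u * T v) = vscale A (counit A a) 1)"
  proof (rule antipode_exists)
    show "cocomm_on E" if "B.wedge_prime E" "findim (vscale B) E" for E
      unfolding cocomm_on_def
      using cocommutative_wedge_prime[OF cB assms(6)] that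
      by (simp add: bialgebra_UNIV[OF B] bialgebra_cproj[OF B])
    fix a
    obtain x where x: "x \<in> vspace ?T" "f x = a" using surj by (metis UNIV_I imageE)
    \<comment> \<open>\<open>fT\<close> is linear on the whole tensor type and need not be
      \<open>f\<close>; the two agree on B \<otimes> C, as expanding in elementary tensors
      shows.\<close>
    obtain l where l: "\<forall>p\<in>set l. fst p \<in> vspace B \<and> snd p \<in> vspace C" "x = (\<Sum>p\<leftarrow>l. tens B C (fst p) (snd p))"
      using tensor_space_list[OF vB x(1)] by blast
    have "f x = (\<Sum>p\<leftarrow>l. f (tens B C (fst p) (snd p)))"
      unfolding l(2) using l(1) by (intro linear_map_sum_list[OF vec_space_tensor f] bT) auto
    also have "\<dots> = fT x"
      using l(1) by (simp add: l(2) lin_sum_list[OF fT(1)] tens_eq_tn fT(2) h_eq[unfolded tens_eq_tn] cong: map_cong)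
    finally show "\<exists>x\<in>VT. fT x = a"
      using x by (intro bexI[of _ x]) (simp_all add: vspace_tensor_space bialgebra_UNIV[OF B])
  qed
  then obtain T where T: "lin (vscale A) (vscale A) T" "\<And>a. sw (clist A) a (\<lambda>u v. T u * v) = vscale A (counit A a) 1"
    "\<And>a. sw (clist A) a (\<lambda>u v. u * T v) = vscale A (counit A a) 1" by blast
  have "antipode A T"
    unfolding antipode_def
    using T(2,3) sweedler_bialgebra[OF A A.bil_mult[OF T(1) lin_id]] sweedler_bialgebra[OF A A.bil_mult[OF lin_id T(1)]] T(1)
    by (simp add: linear_map_def lin_def bialgebra_UNIV[OF A])
  then show ?thesis using A by (auto simp: hopf_algebra_def)
qed

end
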